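(* Let $\alpha\in(-1,\infty)$ and $p\in[1,\infty]$. Let $F:\mathbb{T}\to\mathbb{C}$ be absolutely continuous on $\mathbb{T}$ with $\dot F\in \mathcal{L}^{p}(\mathbb{T})$, and let $f=\mathcal{K}_{\alpha}[F]$ in $\mathbb{D}$. Then the following three statements hold. (1) If $(\alpha,p)\in\Pi$, then $\partial_\theta f\in\mathcal{H}^p_{\mathcal{G}}(\mathbb{D})$. (2) If $(\alpha,p)\in\Pi_1$, then all the partial derivatives $\partial_rf$, $\partial_zf$ and $\partial_{\overline z}f$ of $f$ belong to $\mathcal{H}^p_{\mathcal{G}}(\mathbb{D})$. (3) If $(\alpha,p)\in\Pi_2\cup\Pi_3$ and $f$ is a $(K,K')$-elliptic mapping in $\mathbb{D}$ (for some constants $K\ge1$, $K'\ge0$), then all the partial derivatives $\partial_rf$, $\partial_zf$ and $\partial_{\overline z}f$ of $f$ belong to $\mathcal{H}^p_{\mathcal{G}}(\mathbb{D})$.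
   Context: $\mathbb{D}=\{z\in\mathbb{C}:|z|<1\}$, $\mathbb{T}=\partial\mathbb{D}$. Poisson type integral: for $\alpha>-1$ and $F\in\mathcal{L}^1(\mathbb{T})$, $$\mathcal{K}_{\alpha}[F](z)=\frac{1}{2\pi}\int_{0}^{2\pi}\mathcal{K}_{\alpha}(ze^{-it})F(e^{it})\,dt,\quad \mathcal{K}_{\alpha}(z)=\mathcal{C}_{\alpha}\frac{(1-|z|^2)^{\alpha+1}}{|1-z|^{\alpha+2}},\quad \mathcal{C}_{\alpha}=\frac{\Gamma^2(1+\frac{\alpha}{2})}{\Gamma(1+\alpha)},\quad z\in\mathbb{D}.$$ Absolute continuity of $F$ on $\mathbb{T}$ refers to $\theta\mapsto F(e^{i\theta})$ on $[0,2\pi]$, and $\dot F(e^{i\theta})=\frac{d}{d\theta}F(e^{i\theta})$, which exists a.e. $\mathcal{L}^p(\mathbb{T})$ is the usual Lebesgue space on $\mathbb{T}$. Derivatives: $\partial_z=\frac12(\partial_x-i\partial_y)$, $\partial_{\overline z}=\frac12(\partial_x+i\partial_y)$; for $z=re^{i\theta}$, $\partial_\theta f(z)=i(z\partial_zf(z)-\overline z\,\partial_{\overline z}f(z))$ and $\partial_r f(z)=\partial_zf(z)e^{i\theta}+\partial_{\overline z}f(z)e^{-i\theta}$. Hardy type space: $\mathcal{H}^p_{\mathcal{G}}(\mathbb{D})$ consists of all measurable complex-valued $g$ on $\mathbb{D}$ with $\sup_{r\in[0,1)}M_p(r,g)<\infty$, where $M_p(r,g)=\big(\frac1{2\pi}\int_0^{2\pi}|g(re^{i\theta})|^p\,d\theta\big)^{1/p}$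 for $p<\infty$ and $M_\infty(r,g)=\max_{\theta\in[0,2\pi]}|g(re^{i\theta})|$. Parameter sets: $\Pi=\{(\alpha,p):-1<\alpha<\infty,\ 1\le p\le\infty\}$; $\Pi_1=\{(\alpha,p):0<\alpha<\infty,\ 1\le p\le\infty\}\cup\{(\alpha,p):\alpha=0,\ 1<p<\infty\}$; $\Pi_2=\{(\alpha,p):-1<\alpha<0,\ 1\le p<-\frac1\alpha\}\cup\{(0,1)\}$; $\Pi_3=\{(\alpha,p):-1<\alpha<0,\ -\frac1\alpha\le p\le\infty\}\cup\{(0,\infty)\}$. Elliptic mappings: put $\|D_f(z)\|=|\partial_zf(z)|+|\partial_{\overline z}f(z)|$ and $J_f=|\partial_zf|^2-|\partial_{\overline z}f|^2$ (the Jacobian). A sense-preserving (so $J_f\ge0$ a.e.) continuous mapping $f:\mathbb{D}\to\mathbb{C}$ is $(K,K')$-elliptic, for constants $K\ge1$ and $K'\ge0$, if (i) $f$ is absolutely continuous on almost every horizontal line and almost every vertical line in every closed rectangle $R\subset\mathbb{D}$ with sides parallel to the axes, the partial derivatives of $f$ are locally square integrable in $\mathbb{D}$, and $J_f\ne0$ a.e. in $\mathbb{D}$; and (ii) $\|D_f(z)\|^2\le KJ_f(z)+K'$ a.e. in $\mathbb{D}$. *)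

theory Defs
  imports "HOL-Analysis.Analysis"
begin

abbreviation unit_disc :: "complex set" where
  "unit_disc \<equiv> ball 0 1"

section \<open>Functions on the unit circle\<close>

text \<open>Functions on the unit circle are functions \<open>complex \<Rightarrow> complex\<close> of which only the values
  at the points \<open>cis \<theta>\<close> are used.\<close>

definition abs_cont_on :: "(real \<Rightarrow> complex) \<Rightarrow> real \<Rightarrow> real \<Rightarrow> bool" where
  "abs_cont_on g a b \<longleftrightarrow>
     (\<forall>\<epsilon>>0. \<exists>\<delta>>0. \<forall>I :: (real \<times> real) set.
        finite I \<and>
        (\<forall>(l, u)\<in>I. a \<le> l \<and> l < u \<and> u \<le> b) \<and>
        pairwise (\<lambda>p q. {fst p<..<snd p} \<inter> {fst q<..<snd q} = {}) I \<and>
        (\<Sum>(l, u)\<in>I. u - l) < \<delta>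
        \<longrightarrow> (\<Sum>(l, u)\<in>I. norm (g u - g l)) < \<epsilon>)"

definition abs_cont_circle :: "(complex \<Rightarrow> complex) \<Rightarrow> bool" where
  "abs_cont_circle F \<longleftrightarrow> abs_cont_on (\<lambda>\<theta>. F (cis \<theta>)) 0 (2 * pi)"

text \<open>At \<open>\<zeta> = cis \<theta>\<close> this is the derivative of \<open>\<theta> \<mapsto> F (cis \<theta>)\<close>, because
  \<open>\<zeta> * cis h = cis (\<theta> + h)\<close>.\<close>

definition circle_deriv :: "(complex \<Rightarrow> complex) \<Rightarrow> complex \<Rightarrow> complex" where
  "circle_deriv F \<zeta> = vector_derivative (\<lambda>h. F (\<zeta> * cis h)) (at 0)"

definition Lp_circle :: "ereal \<Rightarrow> (complex \<Rightarrow> complex) \<Rightarrow> bool" where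
  "Lp_circle p G \<longleftrightarrow>
     (\<lambda>\<theta>. G (cis \<theta>)) \<in> borel_measurable (lebesgue_on {0..2*pi}) \<and>
     (if p = \<infinity>
      then \<exists>C::real. AE \<theta> in lebesgue_on {0..2*pi}. norm (G (cis \<theta>)) \<le> C
      else integrable (lebesgue_on {0..2*pi}) (\<lambda>\<theta>. norm (G (cis \<theta>)) powr real_of_ereal p))"

section \<open>The Poisson type integral\<close>

definition poisson_const :: "real \<Rightarrow> real" where
  "poisson_const \<alpha> = (Gamma (1 + \<alpha> / 2))\<^sup>2 / Gamma (1 + \<alpha>)"

definition poisson_kernel :: "real \<Rightarrow> complex \<Rightarrow> real" where
  "poisson_kernel \<alpha> z =
     poisson_const \<alpha> * ((1 - (norm z)\<^sup>2) powr (\<alpha> + 1) / norm (1 - z) powr (\<alpha> + 2))"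

definition poisson_integral :: "real \<Rightarrow> (complex \<Rightarrow> complex) \<Rightarrow> complex \<Rightarrow> complex" where
  "poisson_integral \<alpha> F z =
     of_real (1 / (2 * pi)) *
     (LINT t|lebesgue_on {0..2*pi}. complex_of_real (poisson_kernel \<alpha> (z * cis (- t))) * F (cis t))"

section \<open>Partial derivatives\<close>

definition partial_x :: "(complex \<Rightarrow> complex) \<Rightarrow> complex \<Rightarrow> complex" where
  "partial_x f z = vector_derivative (\<lambda>t. f (z + of_real t)) (at 0)"

definition partial_y :: "(complex \<Rightarrow> complex) \<Rightarrow> complex \<Rightarrow> complex" where
  "partial_y f z = vector_derivative (\<lambda>t. f (z + \<i> * of_real t)) (at 0)"

definition partial_z :: "(complex \<Rightarrow> complex) \<Rightarrow> complex \<Rightarrow> complex" where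
  "partial_z f z = (partial_x f z - \<i> * partial_y f z) / 2"

definition partial_zbar :: "(complex \<Rightarrow> complex) \<Rightarrow> complex \<Rightarrow> complex" where
  "partial_zbar f z = (partial_x f z + \<i> * partial_y f z) / 2"

definition partial_theta :: "(complex \<Rightarrow> complex) \<Rightarrow> complex \<Rightarrow> complex" where
  "partial_theta f z = \<i> * (z * partial_z f z - cnj z * partial_zbar f z)"

text \<open>The radial derivative depends on a choice of \<open>\<theta>\<close> at the origin only; there
  \<open>Arg 0 = 0\<close> selects \<open>\<theta> = 0\<close>.\<close>

definition partial_r :: "(complex \<Rightarrow> complex) \<Rightarrow> complex \<Rightarrow> complex" where
  "partial_r f z = partial_z f z * cis (Arg z) + partial_zbar f z * cis (- Arg z)"

section \<open>Hardy type spaces\<close>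

definition ennreal_powr :: "ennreal \<Rightarrow> real \<Rightarrow> ennreal" where
  "ennreal_powr x q = (if x = \<infinity> then \<infinity> else ennreal (enn2real x powr q))"

text \<open>Integral means take the value \<open>\<infinity>\<close> when the integral diverges. For \<open>p = \<infinity>\<close> the maximum
  is a supremum, since it need not be attained for a general measurable function.\<close>

definition integral_mean :: "ereal \<Rightarrow> real \<Rightarrow> (complex \<Rightarrow> complex) \<Rightarrow> ennreal" where
  "integral_mean p r g =
     (if p = \<infinity>
      then SUP \<theta>\<in>{0..2*pi}. ennreal (norm (g (of_real r * cis \<theta>)))
      else ennreal_powr
             (ennreal (1 / (2 * pi)) *
              (\<integral>\<^sup>+ \<theta>. ennreal (norm (g (of_real r * cis \<theta>)) powr real_of_ereal p)
                 \<partial>lebesgue_on {0..2*pi}))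
             (1 / real_of_ereal p))"

text \<open>Lebesgue measurability on the disc does not imply that the restriction to every circle
  is measurable; this is required separately, so that the integral means are meaningful for
  every radius.\<close>

definition hardy_space :: "ereal \<Rightarrow> (complex \<Rightarrow> complex) set" where
  "hardy_space p =
     {g. g \<in> borel_measurable (lebesgue_on unit_disc) \<and>
         (\<forall>r\<in>{0..<1}. (\<lambda>\<theta>. g (of_real r * cis \<theta>)) \<in> borel_measurable (lebesgue_on {0..2*pi})) \<and>
         (SUP r\<in>{0..<1}. integral_mean p r g) < \<infinity>}"

section \<open>Parameter sets\<close>

definition Pi0 :: "(real \<times> ereal) set" where
  "Pi0 = {(\<alpha>, p). -1 < \<alpha> \<and> 1 \<le> p \<and> p \<le> \<infinity>}"

definition Pi1 :: "(real \<times> ereal) set" where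
  "Pi1 = {(\<alpha>, p). 0 < \<alpha> \<and> 1 \<le> p \<and> p \<le> \<infinity>} \<union> {(\<alpha>, p). \<alpha> = 0 \<and> 1 < p \<and> p < \<infinity>}"

definition Pi2 :: "(real \<times> ereal) set" where
  "Pi2 = {(\<alpha>, p). -1 < \<alpha> \<and> \<alpha> < 0 \<and> 1 \<le> p \<and> p < ereal (- 1 / \<alpha>)} \<union> {(0, 1)}"

definition Pi3 :: "(real \<times> ereal) set" where
  "Pi3 = {(\<alpha>, p). -1 < \<alpha> \<and> \<alpha> < 0 \<and> ereal (- 1 / \<alpha>) \<le> p \<and> p \<le> \<infinity>} \<union> {(0, \<infinity>)}"

section \<open>Elliptic mappings\<close>

definition D_norm :: "(complex \<Rightarrow> complex) \<Rightarrow> complex \<Rightarrow> real" where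
  "D_norm f z = norm (partial_z f z) + norm (partial_zbar f z)"

definition jacobian :: "(complex \<Rightarrow> complex) \<Rightarrow> complex \<Rightarrow> real" where
  "jacobian f z = (norm (partial_z f z))\<^sup>2 - (norm (partial_zbar f z))\<^sup>2"

definition ACL_disc :: "(complex \<Rightarrow> complex) \<Rightarrow> bool" where
  "ACL_disc f \<longleftrightarrow>
     (\<forall>a b c d. a < b \<and> c < d \<and> cbox (Complex a c) (Complex b d) \<subseteq> unit_disc \<longrightarrow>
        (AE y in lebesgue_on {c..d}. abs_cont_on (\<lambda>x. f (Complex x y)) a b) \<and>
        (AE x in lebesgue_on {a..b}. abs_cont_on (\<lambda>y. f (Complex x y)) c d))"

definition locally_L2_disc :: "(complex \<Rightarrow> complex) \<Rightarrow> bool" where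
  "locally_L2_disc g \<longleftrightarrow>
     g \<in> borel_measurable (lebesgue_on unit_disc) \<and>
     (\<forall>S. compact S \<and> S \<subseteq> unit_disc \<longrightarrow> integrable (lebesgue_on S) (\<lambda>z. (norm (g z))\<^sup>2))"

text \<open>Being sense-preserving enters through the sign of the Jacobian, in the weak form
  \<open>J \<ge> 0\<close> almost everywhere.\<close>

definition elliptic_disc :: "real \<Rightarrow> real \<Rightarrow> (complex \<Rightarrow> complex) \<Rightarrow> bool" where
  "elliptic_disc K K' f \<longleftrightarrow>
     continuous_on unit_disc f \<and>
     (AE z in lebesgue_on unit_disc. jacobian f z \<ge> 0) \<and>
     ACL_disc f \<and>
     locally_L2_disc (partial_x f) \<and> locally_L2_disc (partial_y f) \<and>
     (AE z in lebesgue_on unit_disc. jacobian f z \<noteq> 0) \<and>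
     (AE z in lebesgue_on unit_disc. (D_norm f z)\<^sup>2 \<le> K * jacobian f z + K')"

end

theory Submission
  imports Defs "HOL-Complex_Analysis.Cauchy_Integral_Formula"
begin

text \<open>Let \<open>D = |cis t - z|\<^sup>2\<close> and \<open>\<delta> = 1 - |z|\<^sup>2\<close>, so that the kernel of \<open>f\<close> is a constant times
  \<open>P = \<delta> powr (\<alpha> + 1) / D powr (\<alpha>/2 + 1)\<close>. The proof rests on two exact identities for \<open>P\<close>: its
  angular derivative in \<open>z\<close> is minus its derivative in \<open>t\<close>, and its radial derivative \<open>r \<partial>\<^sub>r P\<close>
  equals \<open>(\<alpha>/2) (P - E)\<close> minus the derivative of \<open>B\<close> in \<open>t\<close>, where
  \<open>B = 2 Im (z / cis t) \<delta> powr \<alpha> / D powr (\<alpha>/2 + 1)\<close> and \<open>E = \<delta> powr \<alpha> / D powr (\<alpha>/2)\<close>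
  (\<open>ker_radial_identity\<close>). Integration by parts moves the derivatives in \<open>t\<close> onto the
  absolutely continuous boundary function. Up to the constant, the angular derivative of \<open>f\<close> is
  therefore the transform of \<open>F'\<close> with kernel \<open>P\<close>, and the radial derivative \<open>r \<partial>\<^sub>r f\<close> is the
  transform of \<open>F'\<close> with kernel \<open>B\<close> plus \<open>\<alpha>/2\<close> times the transform of \<open>F\<close> with kernel \<open>P - E\<close>
  (\<open>partial_theta_eq\<close>, \<open>radial_eq\<close>).

  A kernel whose integrals in either angle are bounded uniformly in \<open>r\<close> maps \<open>L\<^sup>p\<close> into the
  Hardy type space, by the Schur test (\<open>schur_kernel\<close>). For \<open>\<gamma> > 1/2\<close> the kernel
  \<open>\<delta> powr (2 \<gamma> - 1) / D powr \<gamma>\<close> has this property (\<open>ker_critical_integral_bound\<close>). The kernel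
  \<open>P\<close> is the case \<open>\<gamma> = \<alpha>/2 + 1\<close>, which gives (1). If \<open>\<alpha> > 0\<close>, then \<open>|B|\<close> is at most twice the
  case \<open>\<gamma> = (\<alpha> + 1)/2\<close>, because \<open>|Im (z / cis t)| \<le> sqrt D\<close>, and \<open>E\<close> is bounded, because
  \<open>\<delta> \<le> 2 sqrt D\<close>. If \<open>\<alpha> = 0\<close>, then \<open>B\<close> is the conjugate Poisson kernel, and the theorem of M.
  Riesz on conjugate functions takes over for \<open>1 < p < \<infinity>\<close> (\<open>riesz_conjugate\<close>). As \<open>z \<partial>\<^sub>z f\<close> is
  a combination of the angular and the radial derivative, and all derivatives are bounded near
  the origin, (2) follows.

  For (3) ellipticity replaces the kernel estimates. If \<open>d\<close> is the norm of the differential and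
  \<open>l\<close> the difference of the absolute values of the two complex derivatives, then the Jacobian
  is \<open>d l\<close>, so \<open>d\<^sup>2 \<le> K d l + K'\<close> forces \<open>d \<le> K l + sqrt K'\<close>; and \<open>|z| l\<close> is at most the
  absolute value of the angular derivative, which (1) controls. The inequalities hold almost
  everywhere by hypothesis, hence everywhere, since the partial derivatives are continuous.

  Integration by parts needs the fundamental theorem of calculus for absolutely continuous
  functions, including their differentiability almost everywhere. Differentiability is proved
  directly for complex-valued functions by a Vitali covering argument on the arc length of the
  graph (\<open>oscillating_slopes_null\<close>); the fundamental theorem then follows from the gauge
  definition of the integral (\<open>abs_cont_on_fundamental_theorem\<close>).\<close>

section \<open>Families of nonoverlapping intervals and bounded variation\<close>

definition nonoverlapping :: "real \<Rightarrow> real \<Rightarrow> (real \<times> real) set \<Rightarrow> bool" where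
  "nonoverlapping a b I \<longleftrightarrow> finite I \<and> (\<forall>q\<in>I. a \<le> fst q \<and> fst q < snd q \<and> snd q \<le> b) \<and>
     pairwise (\<lambda>p q. {fst p<..<snd p} \<inter> {fst q<..<snd q} = {}) I"

abbreviation variation :: "(real \<Rightarrow> 'a::real_normed_vector) \<Rightarrow> (real \<times> real) set \<Rightarrow> real" where
  "variation g I \<equiv> \<Sum>q\<in>I. norm (g (snd q) - g (fst q))"

lemma nonoverlapping_subset:
  "nonoverlapping a b I \<Longrightarrow> J \<subseteq> I \<Longrightarrow> nonoverlapping a b J"
  by (auto simp: nonoverlapping_def pairwise_subset intro: finite_subset)

lemma nonoverlapping_finite: "nonoverlapping a b I \<Longrightarrow> finite I"
  by (simp add: nonoverlapping_def)

lemma nonoverlapping_mono: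
  "nonoverlapping a b I \<Longrightarrow> a' \<le> a \<Longrightarrow> b \<le> b' \<Longrightarrow> nonoverlapping a' b' I"
  by (fastforce simp: nonoverlapping_def)

lemma open_intervals_disjoint_le:
  fixes l u l' u' :: real
  assumes "{l<..<u} \<inter> {l'<..<u'} = {}" "l < u" "l' < u'"
  shows "u \<le> l' \<or> u' \<le> l"
proof (rule ccontr)
  assume "\<not> ?thesis"
  then have "(max l l' + min u u') / 2 \<in> {l<..<u} \<inter> {l'<..<u'}"
    using assms(2,3) by (auto simp: max_def min_def)
  with assms(1) show False by blast
qed

lemma nonoverlapping_insert:
  assumes "nonoverlapping a c I" "a \<le> c" "c < d"
  shows "nonoverlapping a d (insert (c, d) I)" "(c, d) \<notin> I"
proof -
  show n: "(c, d) \<notin> I" using assms by (fastforce simp: nonoverlapping_def)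
  have "{fst q<..<snd q} \<inter> {c<..<d} = {}" if "q \<in> I" for q
    using assms that by (fastforce simp: nonoverlapping_def)
  then show "nonoverlapping a d (insert (c, d) I)"
    using assms unfolding nonoverlapping_def pairwise_insert
    by (auto simp: Int_commute intro: order_trans)
qed

text \<open>After sorting, the increments telescope; the induction peels off the rightmost interval.\<close>

lemma sum_increments_le:
  fixes \<psi> :: "real \<Rightarrow> real"
  assumes "nonoverlapping a b I" "a \<le> b"
    and "\<And>x y. a \<le> x \<Longrightarrow> x \<le> y \<Longrightarrow> y \<le> b \<Longrightarrow> \<psi> x \<le> \<psi> y"
  shows "(\<Sum>q\<in>I. \<psi> (snd q) - \<psi> (fst q)) \<le> \<psi> b - \<psi> a"
  using assms
proof (induction "card I" arbitrary: I b)
  case 0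
  then have "I = {}" by (simp add: nonoverlapping_def)
  with 0 show ?case by simp
next
  case (Suc n)
  have fin: "finite I" and ne: "I \<noteq> {}" using Suc by (auto simp: nonoverlapping_def)
  obtain q where q: "q \<in> I" "\<And>q'. q' \<in> I \<Longrightarrow> snd q' \<le> snd q"
  proof -
    have "Max (snd ` I) \<in> snd ` I" using fin ne by simp
    then obtain q where "q \<in> I" "snd q = Max (snd ` I)" by auto
    then show ?thesis using that[of q] fin by simp
  qed
  obtain l u where [simp]: "q = (l, u)" by (cases q)
  have lu: "a \<le> l" "l < u" "u \<le> b" using Suc.prems(1) q(1) by (auto simp: nonoverlapping_def)
  have "snd q' \<le> l" if q': "q' \<in> I - {q}" for q'
  proof -
    have "{fst q'<..<snd q'} \<inter> {l<..<u} = {}"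
      using Suc.prems(1) q(1) q' by (fastforce simp: nonoverlapping_def pairwise_def)
    moreover have "fst q' < snd q'" "snd q' \<le> u"
      using Suc.prems(1) q(2)[of q'] q' by (auto simp: nonoverlapping_def)
    ultimately show ?thesis
      using open_intervals_disjoint_le[of "fst q'" "snd q'" l u] lu by auto
  qed
  then have "nonoverlapping a l (I - {q})"
    using nonoverlapping_subset[OF Suc.prems(1), of "I - {q}"]
    by (auto simp: nonoverlapping_def)
  moreover have "n = card (I - {q})" using Suc.hyps(2) q(1) fin by simp
  ultimately have "(\<Sum>q\<in>I - {q}. \<psi> (snd q) - \<psi> (fst q)) \<le> \<psi> l - \<psi> a"
    using Suc.hyps(1)[of "I - {q}" l] Suc.prems(3) lu by auto
  moreover have "\<psi> u \<le> \<psi> b" using Suc.prems(3) lu by auto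
  ultimately show ?case
    using sum.remove[OF fin q(1), of "\<lambda>q. \<psi> (snd q) - \<psi> (fst q)"] by simp
qed

lemma abs_cont_onD:
  assumes "abs_cont_on g a b" "\<epsilon> > 0"
  obtains \<delta> where "\<delta> > 0"
    "\<And>I. nonoverlapping a b I \<Longrightarrow> (\<Sum>q\<in>I. snd q - fst q) < \<delta> \<Longrightarrow>
       variation g I < \<epsilon>"
proof -
  from assms obtain \<delta> where "\<delta> > 0" and d: "\<And>I :: (real \<times> real) set.
        finite I \<Longrightarrow>
        (\<forall>(l, u)\<in>I. a \<le> l \<and> l < u \<and> u \<le> b) \<Longrightarrow>
        pairwise (\<lambda>p q. {fst p<..<snd p} \<inter> {fst q<..<snd q} = {}) I \<Longrightarrow>
        (\<Sum>(l, u)\<in>I. u - l) < \<delta>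
        \<Longrightarrow> (\<Sum>(l, u)\<in>I. norm (g u - g l)) < \<epsilon>"
    unfolding abs_cont_on_def by meson
  show ?thesis
  proof (rule that[OF \<open>\<delta> > 0\<close>])
    fix I assume "nonoverlapping a b I" "(\<Sum>q\<in>I. snd q - fst q) < \<delta>"
    then show "variation g I < \<epsilon>"
      using d[of I] by (simp add: nonoverlapping_def case_prod_beta)
  qed
qed

lemma abs_cont_onI:
  assumes "\<And>\<epsilon>. \<epsilon> > 0 \<Longrightarrow> \<exists>\<delta>>0. \<forall>I. nonoverlapping a b I \<longrightarrow> (\<Sum>q\<in>I. snd q - fst q) < \<delta> \<longrightarrow>
       variation g I < \<epsilon>"
  shows "abs_cont_on g a b"
  unfolding abs_cont_on_def
proof (intro allI impI)
  fix \<epsilon> :: real assume "\<epsilon> > 0"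
  from assms[OF this] obtain \<delta> where "\<delta> > 0" and "\<And>I. nonoverlapping a b I \<Longrightarrow> (\<Sum>q\<in>I. snd q - fst q) < \<delta> \<Longrightarrow>
       variation g I < \<epsilon>" by blast
  then show "\<exists>\<delta>>0. \<forall>I :: (real \<times> real) set.
        finite I \<and>
        (\<forall>(l, u)\<in>I. a \<le> l \<and> l < u \<and> u \<le> b) \<and>
        pairwise (\<lambda>p q. {fst p<..<snd p} \<inter> {fst q<..<snd q} = {}) I \<and>
        (\<Sum>(l, u)\<in>I. u - l) < \<delta>
        \<longrightarrow> (\<Sum>(l, u)\<in>I. norm (g u - g l)) < \<epsilon>"
    by (intro exI[of _ \<delta>]) (simp add: nonoverlapping_def case_prod_beta)
qed

text \<open>With \<open>\<delta>\<close> belonging to \<open>\<epsilon> = 1\<close>, the variation grows by a finite amount on every step of length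
  \<open>\<delta>/2\<close>, and finitely many steps exhaust the interval. At most one interval of a family
  straddles a step point, and it can be cut there.\<close>

lemma abs_cont_on_bounded_variation:
  assumes ac: "abs_cont_on g a b" and ab: "a \<le> b"
  obtains B where "\<And>I. nonoverlapping a b I \<Longrightarrow> variation g I \<le> B"
proof -
  from abs_cont_onD[OF ac zero_less_one] obtain \<delta> where "\<delta> > 0" and
    \<delta>: "\<And>I. nonoverlapping a b I \<Longrightarrow> (\<Sum>q\<in>I. snd q - fst q) < \<delta> \<Longrightarrow>
       variation g I < 1" by blast
  define x where "x n = min b (a + real n * (\<delta> / 2))" for n
  have "\<exists>B. \<forall>I. nonoverlapping a (x n) I \<longrightarrow> variation g I \<le> B" for n
  proof (induction n)
    case 0
    have "I = {}" if "nonoverlapping a (x 0) I" for I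
      using that ab by (force simp: nonoverlapping_def x_def)
    note empty = this
    have "variation g I \<le> 0" if "nonoverlapping a (x 0) I" for I
      by (simp add: empty[OF that])
    then show ?case by blast
  next
    case (Suc n)
    then obtain B where B: "\<And>I. nonoverlapping a (x n) I \<Longrightarrow>
      variation g I \<le> B" by blast
    have xn: "a \<le> x n" "x n \<le> x (Suc n)" "x (Suc n) \<le> b" "x (Suc n) - x n < \<delta>"
      using ab \<open>\<delta> > 0\<close> by (auto simp: x_def min_def field_simps)
    have B0: "0 \<le> B" using B[of "{}"] by (simp add: nonoverlapping_def)
    have near: "variation g I \<le> 1"
      if "nonoverlapping (x n) (x (Suc n)) I" for I
    proof -
      have "(\<Sum>q\<in>I. snd q - fst q) \<le> x (Suc n) - x n"
        using sum_increments_le[OF that xn(2), of "\<lambda>x. x"] by simp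
      with \<delta>[of I] nonoverlapping_mono[OF that xn(1,3)] xn(4) show ?thesis by fastforce
    qed
    have "variation g I \<le> B + 1 + (B + 1)"
      if I: "nonoverlapping a (x (Suc n)) I" for I
    proof -
      let ?v = "\<lambda>q. norm (g (snd q) - g (fst q))"
      have fin: "finite I" using I by (simp add: nonoverlapping_def)
      define L where "L = {q\<in>I. snd q \<le> x n}"
      define R where "R = {q\<in>I. x n \<le> fst q}"
      define S where "S = {q\<in>I. fst q < x n \<and> x n < snd q}"
      have dec: "I = (L \<union> R) \<union> S" by (auto simp: L_def R_def S_def)
      have "sum ?v I = sum ?v (L \<union> R) + sum ?v S"
        unfolding dec using fin
        by (intro sum.union_disjoint) (use I in \<open>auto simp: L_def R_def S_def nonoverlapping_def\<close>)
      also have "sum ?v (L \<union> R) = sum ?v L + sum ?v R"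
        using fin by (intro sum.union_disjoint)
          (use I in \<open>force simp: L_def R_def nonoverlapping_def\<close>)+
      also have "sum ?v L \<le> B"
        by (intro B) (use I nonoverlapping_subset[OF I, of L] in \<open>auto simp: L_def nonoverlapping_def\<close>)
      also have "sum ?v R \<le> 1"
        by (intro near) (use I nonoverlapping_subset[OF I, of R] in \<open>auto simp: R_def nonoverlapping_def\<close>)
      also have "sum ?v S \<le> B + 1"
      proof (cases "S = {}")
        case True then show ?thesis using B0 by simp
      next
        case False
        then obtain q where q: "q \<in> S" by blast
        have "q' = q" if "q' \<in> S" for q'
        proof (rule ccontr)
          assume "q' \<noteq> q"
          with q that I have "{fst q'<..<snd q'} \<inter> {fst q<..<snd q} = {}"
            by (auto simp: S_def nonoverlapping_def pairwise_def)
          moreover have "x n \<in> {fst q'<..<snd q'} \<inter> {fst q<..<snd q}"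
            using q that by (auto simp: S_def)
          ultimately show False by blast
        qed
        then have S: "S = {q}" using q by blast
        have q2: "a \<le> fst q" "fst q < x n" "x n < snd q" "snd q \<le> x (Suc n)"
          using q I by (auto simp: S_def nonoverlapping_def)
        have "norm (g (x n) - g (fst q)) \<le> B"
          using B[of "{(fst q, x n)}"] q2 by (simp add: nonoverlapping_def)
        moreover have "norm (g (snd q) - g (x n)) \<le> 1"
          using near[of "{(x n, snd q)}"] q2 by (simp add: nonoverlapping_def)
        ultimately have "?v q \<le> B + 1"
          using norm_triangle_ineq[of "g (snd q) - g (x n)" "g (x n) - g (fst q)"] by simp
        then show ?thesis by (simp add: S)
      qed
      finally show ?thesis by simp
    qed
    then show ?case by blast
  qed
  moreover obtain n where "x n = b"
  proof -
    obtain n where "(b - a) / (\<delta> / 2) \<le> real n" using real_arch_simple by blast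
    then have "x n = b" using \<open>\<delta> > 0\<close> by (simp add: x_def field_simps)
    then show ?thesis by (rule that)
  qed
  ultimately show ?thesis using that by metis
qed

text \<open>A monotone function cannot grow at rate \<open>G\<close> near many points: Vitali's theorem extracts from
  the intervals of fast growth a disjoint subfamily that covers \<open>E\<close> up to a null set, and the
  increments over disjoint intervals add up to at most the total increment.\<close>

lemma monotone_growth_outer_measure:
  fixes \<psi> :: "real \<Rightarrow> real"
  assumes mono: "\<And>x y. l \<le> x \<Longrightarrow> x \<le> y \<Longrightarrow> y \<le> u \<Longrightarrow> \<psi> x \<le> \<psi> y"
    and lu: "l \<le> u" and G: "G > 0"
    and E: "\<And>x d. x \<in> E \<Longrightarrow> d > 0 \<Longrightarrow>
      \<exists>s t. l \<le> s \<and> s < t \<and> t \<le> u \<and> s \<le> x \<and> x \<le> t \<and> t - s < d \<and> G * (t - s) \<le> \<psi> t - \<psi> s"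
  obtains T where "E \<subseteq> T" "T \<in> lmeasurable" "measure lebesgue T \<le> (\<psi> u - \<psi> l) / G"
proof -
  define K where "K = {q::real\<times>real. l \<le> fst q \<and> fst q < snd q \<and> snd q \<le> u \<and>
      G * (snd q - fst q) \<le> \<psi> (snd q) - \<psi> (fst q)}"
  define c where "c q = (fst q + snd q) / 2" for q :: "real \<times> real"
  define r where "r q = (snd q - fst q) / 2" for q :: "real \<times> real"
  have cb: "cball (c q) (r q) = {fst q..snd q}" for q
    by (simp add: cball_eq_atLeastAtMost c_def r_def field_simps)
  obtain C where C: "countable C" "C \<subseteq> K"
     "pairwise (\<lambda>i j. disjnt (cball (c i) (r i)) (cball (c j) (r j))) C"
     "negligible (E - (\<Union>i \<in> C. cball (c i) (r i)))"
  proof (rule Vitali_covering_theorem_cballs[where K=K and r=r and S=E and a=c])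
    show "0 < r i" if "i \<in> K" for i using that by (auto simp: K_def r_def)
    show "\<exists>i. i \<in> K \<and> x \<in> cball (c i) (r i) \<and> r i < d" if "x \<in> E" "0 < d" for x d
    proof -
      from E[OF that] obtain s t where "l \<le> s \<and> s < t \<and> t \<le> u \<and> s \<le> x \<and> x \<le> t \<and> t - s < d \<and> G * (t - s) \<le> \<psi>
          t - \<psi> s"
        by blast
      then have "(s, t) \<in> K \<and> x \<in> cball (c (s, t)) (r (s, t)) \<and> r (s, t) < d"
        unfolding cb by (auto simp: K_def r_def)
      then show ?thesis by blast
    qed
  qed
  define T0 where "T0 = (\<Union>i \<in> C. cball (c i) (r i))"
  have fin: "measure lebesgue (\<Union>i\<in>I. cball (c i) (r i)) \<le> (\<psi> u - \<psi> l) / G"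
    if "finite I" "I \<subseteq> C" for I
  proof -
    have I: "nonoverlapping l u I"
      unfolding nonoverlapping_def
    proof (intro conjI ballI)
      show "finite I" by fact
      show "pairwise (\<lambda>p q. {fst p<..<snd p} \<inter> {fst q<..<snd q} = {}) I"
        using pairwise_subset[OF C(3) that(2)] unfolding cb pairwise_def disjnt_def
        by (fastforce dest: greaterThanLessThan_subseteq_atLeastAtMost_iff[THEN iffD2])
    qed (use that C in \<open>auto simp: K_def\<close>)
    have "measure lebesgue (\<Union>i\<in>I. cball (c i) (r i)) \<le> (\<Sum>i\<in>I. measure lebesgue (cball (c i) (r i)))"
      using that by (intro measure_UNION_le) auto
    also have "\<dots> = (\<Sum>q\<in>I. snd q - fst q)"
      using I by (intro sum.cong refl) (auto simp: cb nonoverlapping_def)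
    also have "\<dots> \<le> (\<Sum>q\<in>I. (\<psi> (snd q) - \<psi> (fst q)) / G)"
    proof (intro sum_mono)
      fix q assume "q \<in> I"
      with that C(2) have "q \<in> K" by blast
      then show "snd q - fst q \<le> (\<psi> (snd q) - \<psi> (fst q)) / G"
        using G by (simp add: K_def pos_le_divide_eq mult.commute)
    qed
    also have "\<dots> \<le> (\<psi> u - \<psi> l) / G"
      using sum_increments_le[where \<psi> = \<psi>, OF I lu mono] G by (simp add: sum_divide_distrib[symmetric]
          divide_right_mono)
    finally show ?thesis .
  qed
  have T0: "T0 \<in> lmeasurable" "measure lebesgue T0 \<le> (\<psi> u - \<psi> l) / G"
    unfolding T0_def
    by (rule fmeasurable_UN_bound[OF C(1) lmeasurable_cball] measure_UN_bound[OF C(1) lmeasurable_cball];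
        use fin in blast)+
  show ?thesis
  proof (rule that[of "T0 \<union> (E - T0)"])
    have n: "negligible (E - T0)" using C(4) by (simp add: T0_def)
    then have "E - T0 \<in> lmeasurable" "measure lebesgue (E - T0) = 0"
      by (simp_all add: negligible_imp_measurable negligible_imp_measure0)
    then show "measure lebesgue (T0 \<union> (E - T0)) \<le> (\<psi> u - \<psi> l) / G"
      using T0 measure_Un_le[of T0 lebesgue "E - T0"] by (simp add: fmeasurableD)
    show "T0 \<union> (E - T0) \<in> lmeasurable" by (rule fmeasurable.Un) fact+
  qed auto
qed

section \<open>Absolutely continuous functions are differentiable almost everywhere\<close>

text \<open>This quantifies the strict convexity of arc length: a segment of slope \<open>s\<close> is longer than its
  projection to the direction of slope \<open>m\<close>, by an amount per unit of the parameter that is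
  bounded below once \<open>s\<close> and \<open>m\<close> differ by \<open>c\<close>. The bound comes from Lagrange's identity, which
  gives \<open>|v|\<^sup>2 |w|\<^sup>2 - (v \<bullet> w)\<^sup>2 \<ge> |s - m|\<^sup>2\<close> for \<open>v = (1, s)\<close> and \<open>w = (1, m)\<close>.\<close>

lemma length_excess:
  fixes m s :: complex
  assumes "norm m \<le> M" "c \<ge> 0" "c \<le> norm (s - m)"
  shows "c\<^sup>2 / (2 * (1 + M\<^sup>2) * (1 + M + c))
     \<le> norm (1::real, s) - (1::real, s) \<bullet> ((1, m) /\<^sub>R norm (1::real, m))"
proof -
  define v w where "v = (1::real, s)" and "w = (1::real, m)"
  define x where "x = norm (s - m)"
  have M: "0 \<le> M" using assms(1) norm_ge_zero[of m] by linarith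
  have x: "c \<le> x" "0 \<le> x" using assms by (auto simp: x_def)
  have nv: "(norm v)\<^sup>2 = 1 + (norm s)\<^sup>2" and nw: "(norm w)\<^sup>2 = 1 + (norm m)\<^sup>2"
    by (simp_all add: v_def w_def norm_Pair)
  have vw: "v \<bullet> w = 1 + s \<bullet> m" by (simp add: v_def w_def)
  have pos: "0 < norm v" "0 < norm w" by (auto simp: v_def w_def zero_prod_def)
  have "norm s \<le> M + x"
    using norm_triangle_ineq[of m "s - m"] assms(1) by (simp add: x_def)
  then have v_le: "norm v \<le> 1 + M + x"
    using norm_Pair_le[of "1::real" s] by (simp add: v_def)
  have w_le: "(norm w)\<^sup>2 \<le> 1 + M\<^sup>2"
    using assms(1) by (simp add: nw power_mono)
  have "(s \<bullet> m)\<^sup>2 \<le> (norm s)\<^sup>2 * (norm m)\<^sup>2"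
    by (metis Cauchy_Schwarz_ineq power2_norm_eq_inner)
  moreover have "x\<^sup>2 = (norm s)\<^sup>2 + (norm m)\<^sup>2 - 2 * (s \<bullet> m)"
    by (simp add: x_def power2_norm_eq_inner algebra_simps inner_commute)
  ultimately have "x\<^sup>2 \<le> (norm v)\<^sup>2 * (norm w)\<^sup>2 - (v \<bullet> w)\<^sup>2"
    unfolding nv nw vw by (simp add: algebra_simps power2_eq_square)
  also have "\<dots> = (norm v * norm w - v \<bullet> w) * (norm v * norm w + v \<bullet> w)"
    by (simp add: algebra_simps power2_eq_square)
  also have "\<dots> \<le> (norm v * norm w - v \<bullet> w) * (2 * norm v * norm w)"
    using norm_cauchy_schwarz[of v w] by (intro mult_left_mono) auto
  also have "norm v * norm w - v \<bullet> w = norm w * (norm v - v \<bullet> (w /\<^sub>R norm w))"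
    using pos by (simp add: field_simps)
  finally have *: "x\<^sup>2 \<le> (norm v - v \<bullet> (w /\<^sub>R norm w)) * (2 * (norm w)\<^sup>2 * norm v)"
    by (simp add: power2_eq_square algebra_simps)
  have g0: "0 \<le> norm v - v \<bullet> (w /\<^sub>R norm w)"
    using norm_cauchy_schwarz[of v "w /\<^sub>R norm w"] pos by simp
  have "2 * (norm w)\<^sup>2 * norm v \<le> 2 * (1 + M\<^sup>2) * (1 + M + x)"
    using w_le v_le pos M x by (intro mult_mono) auto
  then have "x\<^sup>2 \<le> (norm v - v \<bullet> (w /\<^sub>R norm w)) * (2 * (1 + M\<^sup>2) * (1 + M + x))"
    using * g0 by (meson mult_left_mono order_trans)
  then have a: "x\<^sup>2 / (2 * (1 + M\<^sup>2) * (1 + M + x)) \<le> norm v - v \<bullet> (w /\<^sub>R norm w)"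
    using M x by (subst pos_divide_le_eq) (auto intro!: mult_pos_pos add_pos_nonneg)
  have "c\<^sup>2 * (1 + M + x) \<le> x\<^sup>2 * (1 + M + c)"
  proof -
    have "c * x * c \<le> c * x * x" using x assms by (intro mult_left_mono) auto
    moreover have "c\<^sup>2 * (1 + M) \<le> x\<^sup>2 * (1 + M)"
      using x assms M by (intro mult_right_mono power_mono) auto
    ultimately show ?thesis by (simp add: algebra_simps power2_eq_square)
  qed
  then have "c\<^sup>2 / (1 + M + c) \<le> x\<^sup>2 / (1 + M + x)"
    using M x assms by (simp add: field_simps)
  then have "c\<^sup>2 / (1 + M + c) / (2 * (1 + M\<^sup>2)) \<le> x\<^sup>2 / (1 + M + x) / (2 * (1 + M\<^sup>2))"
    by (intro divide_right_mono) auto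
  with a show ?thesis by (simp add: v_def w_def mult.commute)
qed

definition slope :: "(real \<Rightarrow> complex) \<Rightarrow> real \<Rightarrow> real \<Rightarrow> complex" where
  "slope g x y = (g y - g x) /\<^sub>R (y - x)"

lemma slope_commute: "slope g x y = slope g y x"
  unfolding slope_def by (metis minus_diff_eq inverse_minus_eq scaleR_minus_left scaleR_minus_right
      minus_minus)

text \<open>\<open>\<l> x\<close> is the supremum of the variations over \<open>[a, x]\<close>; appending an interval to a family
  shows that it grows at least as fast as the curve moves.\<close>

lemma arc_length_function:
  fixes \<gamma> :: "real \<Rightarrow> 'a::real_normed_vector"
  assumes bv: "\<And>I. nonoverlapping a b I \<Longrightarrow> variation \<gamma> I \<le> B"
  obtains \<l> :: "real \<Rightarrow> real" where "\<l> a = 0"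
    "\<And>x y. a \<le> x \<Longrightarrow> x \<le> y \<Longrightarrow> y \<le> b \<Longrightarrow> norm (\<gamma> y - \<gamma> x) \<le> \<l> y - \<l> x"
    "\<And>\<eta>. \<eta> > 0 \<Longrightarrow> \<exists>P. nonoverlapping a b P \<and> \<l> b - \<eta> < variation \<gamma> P"
proof -
  define \<I> where "\<I> x = {I. nonoverlapping a x I}" for x
  define \<l> where "\<l> x = Sup (variation \<gamma> ` \<I> x)" for x
  have emp: "{} \<in> \<I> x" for x by (simp add: \<I>_def nonoverlapping_def)
  have bdd: "bdd_above (variation \<gamma> ` \<I> x)" if "x \<le> b" for x
    using bv nonoverlapping_mono[OF _ order_refl that] by (intro bdd_aboveI2[of _ _ B]) (auto simp: \<I>_def)
  have inc: "norm (\<gamma> y - \<gamma> x) \<le> \<l> y - \<l> x" if xy: "a \<le> x" "x \<le> y" "y \<le> b" for x y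
  proof (cases "x = y")
    case True then show ?thesis by simp
  next
    case False
    with xy have "x < y" by simp
    have "\<l> x \<le> \<l> y - norm (\<gamma> y - \<gamma> x)"
      unfolding \<l>_def
    proof (rule cSUP_least)
      show "\<I> x \<noteq> {}" using emp by blast
      fix I assume "I \<in> \<I> x"
      then have I: "nonoverlapping a x I" by (simp add: \<I>_def)
      note ins = nonoverlapping_insert[OF I xy(1) \<open>x < y\<close>]
      have "variation \<gamma> I + norm (\<gamma> y - \<gamma> x) = variation \<gamma> (insert (x, y) I)"
        using ins(2) nonoverlapping_finite[OF I] by simp
      also have "\<dots> \<le> Sup (variation \<gamma> ` \<I> y)"
        using ins(1) xy by (intro cSUP_upper bdd) (auto simp: \<I>_def)
      finally show "variation \<gamma> I \<le> Sup (variation \<gamma> ` \<I> y) - norm (\<gamma> y - \<gamma> x)" by simp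
    qed
    then show ?thesis by simp
  qed
  have la: "\<l> a = 0"
  proof -
    have "\<I> a = {{}}" by (force simp: \<I>_def nonoverlapping_def)
    then show ?thesis by (simp add: \<l>_def)
  qed
  show ?thesis
  proof (rule that[OF la inc])
    fix \<eta> :: real assume "\<eta> > 0"
    then show "\<exists>P. nonoverlapping a b P \<and> \<l> b - \<eta> < variation \<gamma> P"
      using less_cSUP_iff[of "\<I> b" "variation \<gamma>" "\<l> b - \<eta>"] bdd[of b] emp unfolding \<l>_def \<I>_def by force
  qed
qed

text \<open>At the points of \<open>E\<close> the difference quotients do not settle near any single value \<open>m\<close>. Let
  \<open>\<l>\<close> be the arc length of the graph \<open>\<gamma>\<close>, measured from \<open>a\<close>, and choose a family \<open>P\<close> of
  intervals whose chords almost attain the total length. On an interval of \<open>P\<close> whose chord has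
  direction \<open>w\<close>, the function \<open>\<psi> = \<l> - \<gamma> \<bullet> w\<close> is monotone with small total increment, while by
  \<open>length_excess\<close> it grows fast near each point of \<open>E\<close>. So \<open>E\<close> has small outer measure there.
  The estimate needs a bound on the slope of the chord; the steep chords occupy a small set
  because the variation is finite.\<close>

lemma oscillating_slopes_null:
  fixes g :: "real \<Rightarrow> complex"
  assumes ab: "a < b" and c: "c > 0"
    and bv: "\<And>I. nonoverlapping a b I \<Longrightarrow> variation g I \<le> B"
    and E: "\<And>x. x \<in> E \<Longrightarrow> a < x \<and> x < b"
    and osc: "\<And>x d m. x \<in> E \<Longrightarrow> d > 0 \<Longrightarrow> \<exists>y. y \<noteq> x \<and> \<bar>y - x\<bar> < d \<and> c \<le> norm (slope g x y - m)"
  shows "negligible E"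
proof -
  define \<gamma> where "\<gamma> x = (x, g x)" for x :: real
  define V where "V = variation \<gamma>"
  have V_le: "V I \<le> b - a + B" if I: "nonoverlapping a b I" for I
  proof -
    have "V I \<le> (\<Sum>q\<in>I. (snd q - fst q) + norm (g (snd q) - g (fst q)))"
      unfolding V_def
    proof (intro sum_mono)
      fix q assume "q \<in> I"
      with I have "fst q < snd q" by (simp add: nonoverlapping_def)
      then show "norm (\<gamma> (snd q) - \<gamma> (fst q)) \<le> (snd q - fst q) + norm (g (snd q) - g (fst q))"
        using norm_Pair_le[of "snd q - fst q" "g (snd q) - g (fst q)"] by (simp add: \<gamma>_def)
    qed
    also have "\<dots> \<le> b - a + B"
      using bv[OF I] sum_increments_le[OF I, of "\<lambda>x. x"] ab by (simp add: sum.distrib)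
    finally show ?thesis .
  qed
  have B0: "0 \<le> B" using bv[of "{}"] by (simp add: nonoverlapping_def)
  obtain \<l> where la: "\<l> a = 0"
    and inc: "\<And>x y. a \<le> x \<Longrightarrow> x \<le> y \<Longrightarrow> y \<le> b \<Longrightarrow> norm (\<gamma> y - \<gamma> x) \<le> \<l> y - \<l> x"
    and attain: "\<And>\<eta>. \<eta> > 0 \<Longrightarrow> \<exists>P. nonoverlapping a b P \<and> \<l> b - \<eta> < V P"
    using arc_length_function[of a b \<gamma>, OF V_le[unfolded V_def]] unfolding V_def by blast
  show ?thesis
  proof (rule negligible_outer_le[THEN iffD2], intro allI impI)
    fix \<epsilon> :: real assume \<epsilon>: "\<epsilon> > 0"
    \<comment> \<open>\<open>M\<close> separates steep chords from the others; \<open>G\<close> is the rate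
      from \<open>length_excess\<close> for slopes up to \<open>M\<close>.\<close>
    define M where "M = 4 * (B + 1) / \<epsilon>"
    have M: "M > 0" using \<epsilon> B0 by (simp add: M_def)
    define G where "G = c\<^sup>2 / (2 * (1 + M\<^sup>2) * (1 + M + c))"
    have G: "G > 0" using c M unfolding G_def by (intro divide_pos_pos mult_pos_pos)
        (auto simp: add_pos_nonneg)
    define \<eta> where "\<eta> = min (\<epsilon> / 4) (G * \<epsilon> / 4)"
    have \<eta>: "\<eta> > 0" "\<eta> \<le> \<epsilon> / 4" "\<eta> / G \<le> \<epsilon> / 4"
      using \<epsilon> G by (auto simp: \<eta>_def min_def field_simps)
    obtain P where P: "nonoverlapping a b P" "\<l> b - \<eta> < V P" using attain[OF \<eta>(1)] by blast
    have finP: "finite P" using P(1) by (rule nonoverlapping_finite)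
    have Pq: "a \<le> fst q" "fst q < snd q" "snd q \<le> b" if "q \<in> P" for q
      using P(1) that by (auto simp: nonoverlapping_def)
    define bad where "bad = {q\<in>P. M < norm (slope g (fst q) (snd q))}"
    define T0 where "T0 = {a..b} - (\<Union>q\<in>P. {fst q<..<snd q})"
    define T1 where "T1 = (\<Union>q\<in>bad. {fst q<..<snd q})"
    have excess: "(\<Sum>q\<in>P. \<l> (snd q) - \<l> (fst q) - norm (\<gamma> (snd q) - \<gamma> (fst q))) \<le> \<eta>"
      using sum_increments_le[OF P(1), of \<l>] inc P(2) ab la order_trans[OF norm_ge_zero inc]
      by (simp add: sum_subtractf V_def[symmetric])
    \<comment> \<open>What \<open>P\<close> leaves uncovered is short, because arc length grows at least as
      fast as the parameter.\<close>
    have T0: "T0 \<in> lmeasurable" "measure lebesgue T0 \<le> \<eta>"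
    proof -
      have meas: "(\<Union>q\<in>P. {fst q<..<snd q}) \<in> lmeasurable"
        using finP by (intro fmeasurable.finite_UN) auto
      then show "T0 \<in> lmeasurable" unfolding T0_def by (intro fmeasurable_Diff) (auto simp: fmeasurableD)
      have "measure lebesgue (\<Union>q\<in>P. {fst q<..<snd q}) = (\<Sum>q\<in>P. measure lebesgue {fst q<..<snd q})"
        using finP P(1) by (intro measure_UNION') (auto simp: nonoverlapping_def pairwise_def disjnt_def)
      also have "\<dots> = (\<Sum>q\<in>P. snd q - fst q)"
        using Pq by (intro sum.cong) (auto simp: less_imp_le)
      finally have 1: "measure lebesgue (\<Union>q\<in>P. {fst q<..<snd q}) = (\<Sum>q\<in>P. snd q - fst q)" .
      have "measure lebesgue T0 = measure lebesgue {a..b} - measure lebesgue (\<Union>q\<in>P. {fst q<..<snd q})"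
        unfolding T0_def using meas Pq by (intro measurable_measure_Diff) (fastforce simp: fmeasurableD)+
      also have "\<dots> = (b - a) - (\<Sum>q\<in>P. snd q - fst q)" using 1 ab by simp
      also have "\<dots> \<le> \<l> b - \<l> a - (\<Sum>q\<in>P. \<l> (snd q) - \<l> (fst q))"
      proof -
        have "x - y \<le> \<l> x - \<l> y" if "a \<le> y" "y \<le> x" "x \<le> b" for x y
          using inc[OF that] norm_fst_le[of "x - y" "g x - g y"] by (simp add: \<gamma>_def)
        then have "\<l> x - x \<le> \<l> y - y" if "a \<le> x" "x \<le> y" "y \<le> b" for x y
          using that by fastforce
        then have "(\<Sum>q\<in>P. (\<l> (snd q) - snd q) - (\<l> (fst q) - fst q)) \<le> (\<l> b - b) - (\<l> a - a)"
          using ab by (intro sum_increments_le[OF P(1)]) auto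
        then show ?thesis by (simp add: sum_subtractf sum.distrib algebra_simps)
      qed
      also have "\<dots> \<le> \<l> b - V P"
      proof -
        have "V P \<le> (\<Sum>q\<in>P. \<l> (snd q) - \<l> (fst q))"
          unfolding V_def by (intro sum_mono inc) (use Pq in \<open>auto simp: less_imp_le\<close>)
        then show ?thesis using la by simp
      qed
      finally show "measure lebesgue T0 \<le> \<eta>" using P(2) by linarith
    qed
    \<comment> \<open>Steep chords occupy little room, since the variation is finite.\<close>
    have T1: "T1 \<in> lmeasurable" "measure lebesgue T1 \<le> \<epsilon> / 4"
    proof -
      have fb: "finite bad" using finP by (simp add: bad_def)
      show "T1 \<in> lmeasurable" unfolding T1_def using fb by (intro fmeasurable.finite_UN) auto
      have "measure lebesgue T1 \<le> (\<Sum>q\<in>bad. measure lebesgue {fst q<..<snd q})"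
        unfolding T1_def using fb by (intro measure_UNION_le) auto
      also have "\<dots> \<le> (\<Sum>q\<in>bad. norm (g (snd q) - g (fst q)) / M)"
      proof (intro sum_mono)
        fix q assume q: "q \<in> bad"
        then have "fst q < snd q" using Pq by (auto simp: bad_def)
        moreover have "M < norm (g (snd q) - g (fst q)) / (snd q - fst q)"
          using q \<open>fst q < snd q\<close> by (simp add: bad_def slope_def divide_inverse_commute)
        ultimately show "measure lebesgue {fst q<..<snd q} \<le> norm (g (snd q) - g (fst q)) / M"
          using M by (simp add: field_simps)
      qed
      also have "\<dots> \<le> B / M"
        using bv[OF nonoverlapping_subset[OF P(1), of bad]] M
        by (simp add: sum_divide_distrib[symmetric] bad_def divide_right_mono)
      also have "\<dots> \<le> \<epsilon> / 4" using \<epsilon> B0 by (simp add: M_def field_simps)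
      finally show "measure lebesgue T1 \<le> \<epsilon> / 4" .
    qed
    \<comment> \<open>On the other intervals the excess of arc length over the chord controls the outer measure
      of \<open>E\<close>.\<close>
    have "\<exists>T. E \<inter> {fst q<..<snd q} \<subseteq> T \<and> T \<in> lmeasurable \<and>
       measure lebesgue T \<le> (\<l> (snd q) - \<l> (fst q) - norm (\<gamma> (snd q) - \<gamma> (fst q))) / G"
      if q: "q \<in> P - bad" for q
    proof -
      obtain l u where [simp]: "q = (l, u)" by (cases q)
      have lu: "a \<le> l" "l < u" "u \<le> b" using q Pq[of q] by auto
      define m where "m = slope g l u"
      have m: "norm m \<le> M" using q by (auto simp: bad_def m_def)
      define w where "w = (1::real, m) /\<^sub>R norm (1::real, m)"
      have w1: "norm w = 1" by (simp add: w_def zero_prod_def del: scaleR_Pair)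
      define \<psi> where "\<psi> x = \<l> x - \<gamma> x \<bullet> w" for x
      have graph: "\<gamma> y - \<gamma> x = (y - x) *\<^sub>R (1, slope g x y)" if "x \<noteq> y" for x y
        using that by (simp add: \<gamma>_def slope_def)
      have \<psi>q: "\<psi> u - \<psi> l = \<l> u - \<l> l - norm (\<gamma> u - \<gamma> l)"
      proof -
        have "(\<gamma> u - \<gamma> l) \<bullet> w = norm (\<gamma> u - \<gamma> l)"
        proof -
          define v where "v = (1::real, m)"
          have v: "norm v \<noteq> 0" by (simp add: v_def zero_prod_def)
          have "\<gamma> u - \<gamma> l = (u - l) *\<^sub>R v"
            using graph[of l u] lu by (simp add: v_def m_def)
          moreover have "v \<bullet> w = norm v"
            using v by (simp add: w_def v_def[symmetric] power2_norm_eq_inner[symmetric] power2_eq_square)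
          ultimately show ?thesis using lu by simp
        qed
        then show ?thesis by (simp add: \<psi>_def inner_diff_left)
      qed
      have "\<psi> x \<le> \<psi> y" if "l \<le> x" "x \<le> y" "y \<le> u" for x y
        using inc[of x y] that lu norm_cauchy_schwarz[of "\<gamma> y - \<gamma> x" w] w1
        by (simp add: \<psi>_def inner_diff_left)
      moreover have "\<exists>s t. l \<le> s \<and> s < t \<and> t \<le> u \<and> s \<le> x \<and> x \<le> t \<and> t - s < d \<and> G * (t - s) \<le> \<psi> t - \<psi> s"
        if x: "x \<in> E \<inter> {l<..<u}" and d: "0 < d" for x d
      proof -
        obtain y where y: "y \<noteq> x" "\<bar>y - x\<bar> < min d (min (x - l) (u - x))" "c \<le> norm (slope g x y - m)"
          using osc[of x "min d (min (x - l) (u - x))" m] x d by auto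
        define s t where "s = min x y" and "t = max x y"
        have st: "l \<le> s" "s < t" "t \<le> u" "s \<le> x" "x \<le> t" "t - s < d"
          using y by (auto simp: s_def t_def)
        have "slope g s t = slope g x y" using slope_commute by (auto simp: s_def t_def min_def max_def)
        then have sl: "c \<le> norm (slope g s t - m)" using y(3) by simp
        have "\<psi> t - \<psi> s \<ge> norm (\<gamma> t - \<gamma> s) - (\<gamma> t - \<gamma> s) \<bullet> w"
          using inc[of s t] st lu by (simp add: \<psi>_def inner_diff_left)
        moreover have "norm (\<gamma> t - \<gamma> s) - (\<gamma> t - \<gamma> s) \<bullet> w
            = (t - s) * (norm (1::real, slope g s t) - (1, slope g s t) \<bullet> w)"
          using st(2) unfolding graph[OF less_imp_neq[OF st(2)]] by (simp add: right_diff_distrib del: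
              inner_Pair scaleR_Pair)
        moreover have "G \<le> norm (1::real, slope g s t) - (1, slope g s t) \<bullet> w"
          unfolding G_def w_def using length_excess[OF m _ sl] c by simp
        ultimately have "G * (t - s) \<le> \<psi> t - \<psi> s"
          using st(2) by (smt (verit) mult.commute mult_left_mono)
        with st show ?thesis by blast
      qed
      ultimately obtain T where "E \<inter> {l<..<u} \<subseteq> T" "T \<in> lmeasurable" "measure lebesgue T \<le> (\<psi> u - \<psi> l) / G"
        using monotone_growth_outer_measure[of l u \<psi> G "E \<inter> {l<..<u}"] lu G by (metis less_imp_le)
      then show ?thesis unfolding \<psi>q by auto
    qed
    then obtain T where T: "\<And>q. q \<in> P - bad \<Longrightarrow> E \<inter> {fst q<..<snd q} \<subseteq> T q \<and> T q \<in> lmeasurable \<and>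
       measure lebesgue (T q) \<le> (\<l> (snd q) - \<l> (fst q) - norm (\<gamma> (snd q) - \<gamma> (fst q))) / G" by metis
    define T2 where "T2 = (\<Union>q\<in>P - bad. T q)"
    have T2: "T2 \<in> lmeasurable" "measure lebesgue T2 \<le> \<epsilon> / 4"
    proof -
      have f: "finite (P - bad)" using finP by simp
      show "T2 \<in> lmeasurable" unfolding T2_def using T f by (intro fmeasurable.finite_UN) auto
      have "measure lebesgue T2 \<le> (\<Sum>q\<in>P - bad. measure lebesgue (T q))"
        unfolding T2_def using T f by (intro measure_UNION_le) (auto simp: fmeasurableD)
      also have "\<dots> \<le> (\<Sum>q\<in>P - bad. (\<l> (snd q) - \<l> (fst q) - norm (\<gamma> (snd q) - \<gamma> (fst q))) / G)"
        using T by (intro sum_mono) auto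
      also have "\<dots> \<le> (\<Sum>q\<in>P. (\<l> (snd q) - \<l> (fst q) - norm (\<gamma> (snd q) - \<gamma> (fst q))) / G)"
        using finP G Pq by (intro sum_mono2) (auto intro!: divide_nonneg_pos simp: inc less_imp_le bad_def)
      also have "\<dots> \<le> \<eta> / G"
        using excess G by (simp add: sum_divide_distrib[symmetric] divide_right_mono)
      finally show "measure lebesgue T2 \<le> \<epsilon> / 4" using \<eta>(3) by linarith
    qed
    show "\<exists>T. E \<subseteq> T \<and> T \<in> lmeasurable \<and> measure lebesgue T \<le> \<epsilon>"
    proof (intro exI conjI)
      show "E \<subseteq> (T0 \<union> T1) \<union> T2"
      proof
        fix x assume x: "x \<in> E"
        then have "x \<in> {a..b}" using E by force
        then consider "x \<in> T0" | q where "q \<in> P" "x \<in> {fst q<..<snd q}" unfolding T0_def by blast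
        then show "x \<in> (T0 \<union> T1) \<union> T2"
        proof cases
          case 2
          then show ?thesis
            using T[of q] x by (cases "q \<in> bad") (auto simp: T1_def T2_def)
        qed simp
      qed
      show "(T0 \<union> T1) \<union> T2 \<in> lmeasurable" using T0 T1 T2 by (intro fmeasurable.Un)
      have "measure lebesgue ((T0 \<union> T1) \<union> T2) \<le> measure lebesgue T0 + measure lebesgue T1 + measure lebesgue
          T2"
        using T0 T1 T2 measure_Un_le[of T0 lebesgue T1] measure_Un_le[of "T0 \<union> T1" lebesgue T2]
        by (auto simp: fmeasurableD)
      then show "measure lebesgue ((T0 \<union> T1) \<union> T2) \<le> \<epsilon>" using T0 T1 T2 \<eta> \<epsilon> by linarith
    qed
  qed
qed

lemma has_vector_derivative_iff_slope:
  "(g has_vector_derivative v) (at x) \<longleftrightarrow> (slope g x \<longlongrightarrow> v) (at x)"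
proof -
  have "(g has_vector_derivative v) (at x) \<longleftrightarrow>
    ((\<lambda>y. (g y - (g x + (y - x) *\<^sub>R v)) /\<^sub>R norm (y - x)) \<longlongrightarrow> 0) (at x)"
    by (simp add: has_vector_derivative_def has_derivative_within bounded_linear_scaleR_left divide_inverse)
  also have "\<dots> \<longleftrightarrow> ((\<lambda>y. norm ((g y - (g x + (y - x) *\<^sub>R v)) /\<^sub>R norm (y - x))) \<longlongrightarrow> 0) (at x)"
    by (simp only: tendsto_norm_zero_iff)
  also have "\<dots> \<longleftrightarrow> ((\<lambda>y. norm (slope g x y - v)) \<longlongrightarrow> 0) (at x)"
  proof (rule filterlim_cong[OF refl refl])
    have "norm ((g y - (g x + (y - x) *\<^sub>R v)) /\<^sub>R norm (y - x)) = norm (slope g x y - v)" if "y \<noteq> x" for y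
    proof -
      have "slope g x y - v = (g y - (g x + (y - x) *\<^sub>R v)) /\<^sub>R (y - x)"
      proof -
        have "((y - x) *\<^sub>R v) /\<^sub>R (y - x) = v" using that by simp
        then show ?thesis unfolding slope_def diff_diff_eq[symmetric] by (simp only: scaleR_diff_right)
      qed
      then show ?thesis by simp
    qed
    then show "\<forall>\<^sub>F y in at x. norm ((g y - (g x + (y - x) *\<^sub>R v)) /\<^sub>R norm (y - x)) = norm (slope g x y - v)"
      by (simp add: eventually_at_filter)
  qed
  also have "\<dots> \<longleftrightarrow> (slope g x \<longlongrightarrow> v) (at x)"
    by (simp only: tendsto_norm_zero_iff LIM_zero_iff)
  finally show ?thesis .
qed

text \<open>At a point outside all the sets of \<open>oscillating_slopes_null\<close> with \<open>c = 1/(n+1)\<close>, the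
  difference quotients form a Cauchy filter.\<close>

theorem abs_cont_on_differentiable_ae:
  assumes ac: "abs_cont_on g a b" and ab: "a < b"
  obtains N where "negligible N"
    "\<And>x. x \<in> {a<..<b} - N \<Longrightarrow> \<exists>v. (g has_vector_derivative v) (at x)"
proof -
  obtain B where B: "\<And>I. nonoverlapping a b I \<Longrightarrow> variation g I \<le> B"
    using abs_cont_on_bounded_variation[OF ac] ab by auto
  define E where "E n = {x\<in>{a<..<b}. \<forall>d>0. \<forall>m. \<exists>y. y \<noteq> x \<and> \<bar>y - x\<bar> < d \<and>
      inverse (real (Suc n)) \<le> norm (slope g x y - m)}" for n
  have "negligible (E n)" for n
    by (rule oscillating_slopes_null[OF ab _ B, of "inverse (real (Suc n))"]) (auto simp: E_def)
  then have neg: "negligible (\<Union>n. E n)" by (intro negligible_countable_Union) auto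
  show ?thesis
  proof (rule that[OF neg])
    fix x assume x: "x \<in> {a<..<b} - (\<Union>n. E n)"
    have "cauchy_filter (filtermap (slope g x) (at x))"
      unfolding cauchy_filter_metric_filtermap
    proof (intro allI impI)
      fix e :: real assume "e > 0"
      then obtain n where n: "inverse (real (Suc n)) < e / 2"
        using reals_Archimedean[of "e / 2"] by auto
      from x have "x \<notin> E n" "x \<in> {a<..<b}" by auto
      then have "\<exists>d>0. \<exists>m. \<forall>y. \<not> (y \<noteq> x \<and> \<bar>y - x\<bar> < d \<and>
          inverse (real (Suc n)) \<le> norm (slope g x y - m))"
        unfolding E_def mem_Collect_eq by blast
      then obtain d m where dm: "d > 0" "\<And>y. y \<noteq> x \<Longrightarrow> \<bar>y - x\<bar> < d \<Longrightarrow>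
          norm (slope g x y - m) < inverse (real (Suc n))"
        unfolding not_le[symmetric] by blast
      show "\<exists>P. eventually P (at x) \<and> (\<forall>y z. P y \<and> P z \<longrightarrow> dist (slope g x y) (slope g x z) < e)"
      proof (intro exI conjI allI impI)
        show "\<forall>\<^sub>F y in at x. y \<noteq> x \<and> \<bar>y - x\<bar> < d"
          using dm(1) by (auto simp: eventually_at dist_real_def)
        fix y z assume "(y \<noteq> x \<and> \<bar>y - x\<bar> < d) \<and> (z \<noteq> x \<and> \<bar>z - x\<bar> < d)"
        then have "dist (slope g x y) m < inverse (real (Suc n))" "dist (slope g x z) m < inverse
            (real (Suc n))"
          using dm(2) by (auto simp: dist_norm)
        then show "dist (slope g x y) (slope g x z) < e"
          using n dist_triangle_half_l[of "slope g x y" m e "slope g x z"] by (simp add: dist_commute)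
      qed
    qed
    then obtain v where "filtermap (slope g x) (at x) \<le> nhds v"
      using cauchy_filter_complete_converges[of _ UNIV] complete_UNIV
      by (metis UNIV_I filtermap_bot_iff principal_eq_bot_iff at_neq_bot top_greatest principal_le_iff
          top_eq_principal_UNIV)
    then show "\<exists>v. (g has_vector_derivative v) (at x)"
      unfolding has_vector_derivative_iff_slope filterlim_def by blast
  qed
qed

section \<open>The fundamental theorem of calculus for absolutely continuous functions\<close>

text \<open>At tags where \<open>g'\<close> is the derivative, the gauge makes \<open>g'\<close> times the length of the interval
  approximate the increment. The remaining tags lie in a null set; the gauge confines their
  intervals to an open set of small measure, and absolute continuity makes the increments over
  them small in total.\<close>

theorem abs_cont_on_fundamental_theorem:
  assumes ac: "abs_cont_on g a b" and ab: "a < b" and N: "negligible N"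
    and g': "\<And>x. x \<in> {a<..<b} - N \<Longrightarrow> (g has_vector_derivative g' x) (at x)"
  shows "(g' has_integral (g b - g a)) {a..b}"
proof -
  define N' where "N' = N \<union> {a, b}"
  have N': "negligible N'" using N by (simp add: N'_def negligible_Un)
  define h where "h x = (if x \<in> N' then 0 else g' x)" for x
  have "(h has_integral (g b - g a)) {a..b}"
    unfolding has_integral_factor_content_real
  proof (intro allI impI)
    fix e :: real assume e: "e > 0"
    define \<epsilon> where "\<epsilon> = e * (b - a) / 2"
    have "\<epsilon> > 0" using e ab by (simp add: \<epsilon>_def)
    from abs_cont_onD[OF ac this] obtain \<delta> where \<delta>: "\<delta> > 0"
      "\<And>I. nonoverlapping a b I \<Longrightarrow> (\<Sum>q\<in>I. snd q - fst q) < \<delta> \<Longrightarrow>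
       variation g I < \<epsilon>" by blast
    obtain U where U: "open U" "N' \<subseteq> U" "U \<in> lmeasurable" "measure lebesgue U < \<delta>"
    proof -
      have m: "N' \<in> lmeasurable" "measure lebesgue N' = 0"
        using N' by (simp_all add: negligible_imp_measurable negligible_imp_measure0)
      obtain U where U: "open U" "N' \<subseteq> U" "U - N' \<in> lmeasurable" "emeasure lebesgue (U - N') < ennreal \<delta>"
        using sets_lebesgue_outer_open[of N' \<delta>] m(1) \<delta>(1) by (auto simp: fmeasurableD)
      have eq: "(U - N') \<union> N' = U" using U(2) by auto
      have "U \<in> lmeasurable" using fmeasurable.Un[OF U(3) m(1)] by (simp only: eq)
      moreover have "measure lebesgue U \<le> measure lebesgue (U - N') + measure lebesgue N'"
        using measure_Un_le[of "U - N'" lebesgue N', unfolded eq] U(3) m(1) by (simp add: fmeasurableD)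
      moreover have "measure lebesgue (U - N') < \<delta>"
        using U(3,4) \<delta>(1) by (simp add: emeasure_eq_measure2 ennreal_less_iff)
      ultimately show ?thesis using that[of U] U(1,2) m(2) by linarith
    qed
    have "\<exists>r>0. if x \<in> N' then ball x r \<subseteq> U else x \<in> {a..b} \<longrightarrow>
        (\<forall>y. \<bar>y - x\<bar> < r \<longrightarrow> norm (g y - g x - (y - x) *\<^sub>R g' x) \<le> e / 2 * \<bar>y - x\<bar>)" for x
    proof (cases "x \<in> N'")
      case True
      then obtain r where "r > 0" "ball x r \<subseteq> U" using U openE[of U x] by blast
      then show ?thesis using True by auto
    next
      case False
      show ?thesis
      proof (cases "x \<in> {a..b}")
        case True
        with False have "x \<in> {a<..<b} - N" by (force simp: N'_def)
        from g'[OF this] have "(g has_derivative (\<lambda>h. h *\<^sub>R g' x)) (at x)"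
          by (simp add: has_vector_derivative_def)
        then obtain r where "r > 0" "\<And>y. norm (y - x) < r \<Longrightarrow> norm (g y - g x - (y - x) *\<^sub>R g' x) \<le> e / 2 *
            norm (y - x)"
          using has_derivative_at_alt[of g] e by (meson half_gt_zero)
        then show ?thesis using False by (intro exI[of _ r]) auto
      next
        case F: False
        show ?thesis using False F by (intro exI[of _ 1]) auto
      qed
    qed
    then obtain r where r: "\<And>x. r x > 0"
      "\<And>x. x \<in> N' \<Longrightarrow> ball x (r x) \<subseteq> U"
      "\<And>x y. x \<notin> N' \<Longrightarrow> x \<in> {a..b} \<Longrightarrow> \<bar>y - x\<bar> < r x \<Longrightarrow> norm (g y - g x - (y - x) *\<^sub>R g' x) \<le> e / 2 * \<bar>y - x\<bar>"
      by metis
    show "\<exists>d. gauge d \<and> (\<forall>p. p tagged_division_of {a..b} \<and> d fine p \<longrightarrow>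
        norm ((\<Sum>(x, k)\<in>p. measure lborel k *\<^sub>R h x) - (g b - g a)) \<le> e * measure lborel {a..b})"
    proof (intro exI[of _ "\<lambda>x. ball x (r x)"] conjI allI impI)
      show "gauge (\<lambda>x. ball x (r x))" using r(1) by (auto intro: gauge_ball_dependent)
      fix p assume "p tagged_division_of {a..b} \<and> (\<lambda>x. ball x (r x)) fine p"
      then have p: "p tagged_division_of {a..b}" and fine: "(\<lambda>x. ball x (r x)) fine p" by auto
      have finp: "finite p" using p by blast
      have int: "\<exists>u v. k = {u..v} \<and> u \<le> v \<and> x \<in> {u..v} \<and> a \<le> u \<and> v \<le> b \<and> {u..v} \<subseteq> ball x (r x)"
        if xk: "(x, k) \<in> p" for x k
      proof -
        obtain u v where "k = cbox u v" using tagged_division_ofD(4)[OF p xk] by blast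
        moreover have "x \<in> k" "k \<subseteq> {a..b}" using tagged_division_ofD(2,3)[OF p xk] by auto
        moreover have "k \<subseteq> ball x (r x)" using fine xk by (auto simp: fine_def)
        ultimately show ?thesis by (intro exI[of _ u] exI[of _ v]) auto
      qed
      define D where "D k = g (Sup k) - g (Inf k)" for k
      have tele: "(\<Sum>(x, k)\<in>p. D k) = g b - g a"
        using additive_tagged_division_1[of a b p g] ab p by (simp add: D_def)
      define p1 where "p1 = {z\<in>p. fst z \<in> N'}"
      define p2 where "p2 = {z\<in>p. fst z \<notin> N'}"
      have fin12: "finite p1" "finite p2" using finp by (auto simp: p1_def p2_def)
      have "norm ((\<Sum>(x, k)\<in>p. measure lborel k *\<^sub>R h x) - (g b - g a)) =
          norm (\<Sum>z\<in>p. measure lborel (snd z) *\<^sub>R h (fst z) - D (snd z))"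
        unfolding tele[symmetric] by (simp add: sum_subtractf case_prod_beta)
      also have "\<dots> \<le> (\<Sum>z\<in>p. norm (measure lborel (snd z) *\<^sub>R h (fst z) - D (snd z)))"
        by (rule norm_sum)
      also have "\<dots> = (\<Sum>z\<in>p1. norm (measure lborel (snd z) *\<^sub>R h (fst z) - D (snd z))) +
          (\<Sum>z\<in>p2. norm (measure lborel (snd z) *\<^sub>R h (fst z) - D (snd z)))"
        using finp by (subst sum.union_disjoint[symmetric]) (auto simp: p1_def p2_def intro!: sum.cong)
      also have "(\<Sum>z\<in>p2. norm (measure lborel (snd z) *\<^sub>R h (fst z) - D (snd z))) \<le> (\<Sum>z\<in>p2. e / 2 * measure
          lborel (snd z))"
      proof (intro sum_mono)
        fix z assume z: "z \<in> p2"
        obtain x k where [simp]: "z = (x, k)" by (cases z)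
        have xk: "(x, k) \<in> p" "x \<notin> N'" using z by (auto simp: p2_def)
        from int[OF xk(1)] obtain u v where uv: "k = {u..v}" "u \<le> v" "x \<in> {u..v}" "a \<le> u" "v \<le> b" "{u..v} \<subseteq>
            ball x (r x)"
          by blast
        have "u \<in> ball x (r x)" "v \<in> ball x (r x)"
          using uv(2,6) by (meson atLeastAtMost_iff order_refl subsetD)+
        then have "norm (g u - g x - (u - x) *\<^sub>R g' x) \<le> e / 2 * (x - u)"
          "norm (g v - g x - (v - x) *\<^sub>R g' x) \<le> e / 2 * (v - x)"
          using r(3)[OF xk(2), of u] r(3)[OF xk(2), of v] uv by (auto simp: dist_real_def)
        then have "norm ((g u - g x - (u - x) *\<^sub>R g' x) - (g v - g x - (v - x) *\<^sub>R g' x)) \<le> e / 2 * (x - u)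
            + e / 2 * (v - x)"
          by (meson add_mono norm_triangle_ineq4 order_trans)
        moreover have "(g u - g x - (u - x) *\<^sub>R g' x) - (g v - g x - (v - x) *\<^sub>R g' x) = measure lborel k
            *\<^sub>R h x - D k"
          using uv xk(2) by (simp add: h_def D_def algebra_simps)
        moreover have "e / 2 * (x - u) + e / 2 * (v - x) = e / 2 * measure lborel k"
          using uv by (simp add: field_simps)
        ultimately show "norm (measure lborel (snd z) *\<^sub>R h (fst z) - D (snd z)) \<le> e / 2 * measure lborel
            (snd z)"
          by simp
      qed
      also have "\<dots> \<le> (\<Sum>z\<in>p. e / 2 * measure lborel (snd z))"
        using finp e by (intro sum_mono2) (auto simp: p2_def)
      also have "\<dots> = e / 2 * (b - a)"
      proof -
        have "(\<Sum>z\<in>p. measure lborel (snd z)) = b - a"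
          using additive_content_tagged_division[of p a b] p ab by (simp add: case_prod_beta)
        then show ?thesis by (simp only: sum_distrib_left[symmetric])
      qed
      also have "(\<Sum>z\<in>p1. norm (measure lborel (snd z) *\<^sub>R h (fst z) - D (snd z))) \<le> \<epsilon>"
      proof -
        define p3 where "p3 = {z\<in>p1. Inf (snd z) < Sup (snd z)}"
        define e' where "e' z = (Inf (snd z), Sup (snd z))" for z :: "real \<times> real set"
        have p3: "\<exists>u v. snd z = {u..v} \<and> e' z = (u, v) \<and> u < v \<and> a \<le> u \<and> v \<le> b \<and> {u..v} \<subseteq> U" if "z \<in> p3" for z
        proof -
          obtain x k where [simp]: "z = (x, k)" by (cases z)
          have "(x, k) \<in> p" "x \<in> N'" using that by (auto simp: p3_def p1_def)
          from int[OF this(1)] r(2)[OF this(2)] that show ?thesis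
            by (fastforce simp: p3_def e'_def)
        qed
        have disj: "{fst (e' z)<..<snd (e' z)} \<inter> {fst (e' w)<..<snd (e' w)} = {}"
          if "z \<in> p3" "w \<in> p3" "z \<noteq> w" for z w
        proof -
          obtain x k y l where [simp]: "z = (x, k)" "w = (y, l)" by (cases z, cases w)
          have "(x, k) \<in> p" "(y, l) \<in> p" using that by (auto simp: p3_def p1_def)
          with that have "interior k \<inter> interior l = {}"
            using tagged_division_ofD(5)[OF p, of x k y l] by auto
          then show ?thesis using p3[OF that(1)] p3[OF that(2)] by auto
        qed
        have inj: "inj_on e' p3"
        proof (rule inj_onI, rule ccontr)
          fix z w assume "z \<in> p3" "w \<in> p3" "e' z = e' w" "z \<noteq> w"
          with disj[of z w] p3[of z] show False by auto
        qed
        have fin3: "finite p3" using fin12 by (simp add: p3_def)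
        have no: "nonoverlapping a b (e' ` p3)"
          unfolding nonoverlapping_def
        proof (intro conjI ballI)
          show "pairwise (\<lambda>p q. {fst p<..<snd p} \<inter> {fst q<..<snd q} = {}) (e' ` p3)"
            unfolding pairwise_def using disj by blast
        qed (use p3 fin3 in fastforce)+
        have "(\<Sum>q\<in>e' ` p3. snd q - fst q) = (\<Sum>q\<in>e' ` p3. measure lebesgue {fst q<..<snd q})"
          using no by (intro sum.cong) (auto simp: nonoverlapping_def less_imp_le)
        also have "\<dots> = measure lebesgue (\<Union>q\<in>e' ` p3. {fst q<..<snd q})"
          using no fin3 by (intro measure_UNION'[symmetric]) (auto simp: nonoverlapping_def pairwise_def
              disjnt_def)
        also have "\<dots> \<le> measure lebesgue U"
          using p3 fin3 U by (intro measure_mono_fmeasurable sets.finite_UN) fastforce+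
        finally have "(\<Sum>q\<in>e' ` p3. norm (g (snd q) - g (fst q))) < \<epsilon>"
          using \<delta>(2)[OF no] U(4) by linarith
        then have "(\<Sum>z\<in>p3. norm (D (snd z))) < \<epsilon>"
          using sum.reindex[OF inj, of "\<lambda>q. norm (g (snd q) - g (fst q))"] by (simp add: e'_def D_def o_def)
        moreover have "(\<Sum>z\<in>p1. norm (measure lborel (snd z) *\<^sub>R h (fst z) - D (snd z))) =
            (\<Sum>z\<in>p3. norm (D (snd z)))"
        proof (rule sum.mono_neutral_cong_right)
          show "\<forall>z\<in>p1 - p3. norm (measure lborel (snd z) *\<^sub>R h (fst z) - D (snd z)) = 0"
          proof
            fix z assume z: "z \<in> p1 - p3"
            obtain x k where [simp]: "z = (x, k)" by (cases z)
            have "(x, k) \<in> p" using z by (auto simp: p1_def)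
            from int[OF this] obtain u v where "k = {u..v}" "u \<le> v" by blast
            moreover from this z have "u = v" by (auto simp: p3_def)
            ultimately show "norm (measure lborel (snd z) *\<^sub>R h (fst z) - D (snd z)) = 0" by (simp add: D_def)
          qed
        qed (use fin12 in \<open>auto simp: p3_def p1_def h_def\<close>)
        ultimately show ?thesis by linarith
      qed
      finally show "norm ((\<Sum>(x, k)\<in>p. measure lborel k *\<^sub>R h x) - (g b - g a)) \<le> e * measure lborel {a..b}"
        using ab by (simp add: \<epsilon>_def field_simps)
    qed
  qed
  then show ?thesis
    by (rule has_integral_spike[OF N', rotated]) (auto simp: h_def)
qed

lemma abs_cont_on_mult_C1:
  fixes k k' :: "real \<Rightarrow> real"
  assumes ac: "abs_cont_on g a b" and ab: "a \<le> b"
    and k: "\<And>t. t \<in> {a..b} \<Longrightarrow> (k has_real_derivative k' t) (at t)" and k': "continuous_on {a..b} k'"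
  shows "abs_cont_on (\<lambda>t. k t *\<^sub>R g t) a b"
proof (rule abs_cont_onI)
  fix \<epsilon> :: real assume \<epsilon>: "\<epsilon> > 0"
  have "continuous_on {a..b} k"
    using k by (meson DERIV_continuous_on has_field_derivative_at_within)
  then have "bounded (k ` {a..b})" "bounded (k' ` {a..b})"
    using k' by (auto intro!: compact_imp_bounded compact_continuous_image)
  then obtain C1 C2 where "\<And>t. t \<in> {a..b} \<Longrightarrow> norm (k t) \<le> C1" "\<And>t. t \<in> {a..b} \<Longrightarrow> norm (k' t) \<le> C2"
    unfolding bounded_iff by blast
  moreover define C where "C = max 1 (max C1 C2)"
  ultimately have C: "C > 0" "\<And>t. t \<in> {a..b} \<Longrightarrow> \<bar>k t\<bar> \<le> C" "\<And>t. t \<in> {a..b} \<Longrightarrow> \<bar>k' t\<bar> \<le> C"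
    by (auto simp: C_def max_def) (smt (verit))+
  have lip: "\<bar>k u - k l\<bar> \<le> C * (u - l)" if "a \<le> l" "l < u" "u \<le> b" for l u
    using field_differentiable_bound[of "{a..b}" k k' C u l] k C that
    by (auto intro: has_field_derivative_at_within simp: dist_norm)
  obtain B where B: "\<And>I. nonoverlapping a b I \<Longrightarrow> variation g I \<le> B"
    using abs_cont_on_bounded_variation[OF ac ab] by blast
  define M where "M = norm (g a) + \<bar>B\<bar> + 1"
  have M: "M > 0" by (simp add: M_def add_nonneg_pos)
  have gM: "norm (g t) \<le> M" if "t \<in> {a..b}" for t
  proof (cases "t = a")
    case False
    with B[of "{(a, t)}"] that have "norm (g t - g a) \<le> B" by (simp add: nonoverlapping_def)
    then show ?thesis using norm_triangle_ineq2[of "g t" "g a"] by (simp add: M_def)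
  qed (simp add: M_def)
  obtain \<delta> where \<delta>: "\<delta> > 0" "\<And>I. nonoverlapping a b I \<Longrightarrow> (\<Sum>q\<in>I. snd q - fst q) < \<delta> \<Longrightarrow>
       variation g I < \<epsilon> / (2 * C)"
    using abs_cont_onD[OF ac, of "\<epsilon> / (2 * C)"] \<epsilon> C(1) by auto
  show "\<exists>\<delta>>0. \<forall>I. nonoverlapping a b I \<longrightarrow> (\<Sum>q\<in>I. snd q - fst q) < \<delta> \<longrightarrow>
       (\<Sum>q\<in>I. norm (k (snd q) *\<^sub>R g (snd q) - k (fst q) *\<^sub>R g (fst q))) < \<epsilon>"
  proof (intro exI[of _ "min \<delta> (\<epsilon> / (2 * C * M))"] conjI allI impI)
    show "min \<delta> (\<epsilon> / (2 * C * M)) > 0" using \<delta> \<epsilon> C M by simp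
    fix I assume I: "nonoverlapping a b I" and small: "(\<Sum>q\<in>I. snd q - fst q) < min \<delta> (\<epsilon> / (2 * C * M))"
    have "(\<Sum>q\<in>I. norm (k (snd q) *\<^sub>R g (snd q) - k (fst q) *\<^sub>R g (fst q))) \<le>
      (\<Sum>q\<in>I. C * norm (g (snd q) - g (fst q)) + C * M * (snd q - fst q))"
    proof (intro sum_mono)
      fix q assume "q \<in> I"
      then have q: "a \<le> fst q" "fst q < snd q" "snd q \<le> b" using I by (auto simp: nonoverlapping_def)
      have "k (snd q) *\<^sub>R g (snd q) - k (fst q) *\<^sub>R g (fst q) =
        k (snd q) *\<^sub>R (g (snd q) - g (fst q)) + (k (snd q) - k (fst q)) *\<^sub>R g (fst q)"
        by (simp add: algebra_simps)
      also have "norm \<dots> \<le> \<bar>k (snd q)\<bar> * norm (g (snd q) - g (fst q)) + \<bar>k (snd q) - k (fst q)\<bar> * norm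
          (g (fst q))"
        by (rule order_trans[OF norm_triangle_ineq]) simp
      also have "\<dots> \<le> C * norm (g (snd q) - g (fst q)) + (C * (snd q - fst q)) * M"
        using q C lip[of "fst q" "snd q"] gM[of "fst q"]
        by (intro add_mono mult_mono) auto
      finally show "norm (k (snd q) *\<^sub>R g (snd q) - k (fst q) *\<^sub>R g (fst q)) \<le>
         C * norm (g (snd q) - g (fst q)) + C * M * (snd q - fst q)" by (simp add: algebra_simps)
    qed
    also have "\<dots> = C * variation g I + C * M * (\<Sum>q\<in>I. snd q - fst q)"
      by (simp add: sum.distrib sum_distrib_left)
    also have "\<dots> < C * (\<epsilon> / (2 * C)) + C * M * (\<epsilon> / (2 * C * M))"
      using small \<delta>(2)[OF I] C M by (intro add_strict_mono mult_strict_left_mono) auto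
    also have "\<dots> = \<epsilon>" using C M by simp
    finally show "(\<Sum>q\<in>I. norm (k (snd q) *\<^sub>R g (snd q) - k (fst q) *\<^sub>R g (fst q))) < \<epsilon>" .
  qed
qed

lemma abs_cont_on_continuous:
  assumes "abs_cont_on g a b"
  shows "continuous_on {a..b} g"
  unfolding continuous_on_iff
proof (intro ballI allI impI)
  fix x e :: real assume x: "x \<in> {a..b}" and "e > 0"
  from abs_cont_onD[OF assms this(2)] obtain \<delta> where "\<delta> > 0" and
    \<delta>: "\<And>I. nonoverlapping a b I \<Longrightarrow> (\<Sum>q\<in>I. snd q - fst q) < \<delta> \<Longrightarrow>
       variation g I < e" by blast
  have d: "dist (g y) (g z) < e" if "y < z" "z - y < \<delta>" "y \<in> {a..b}" "z \<in> {a..b}" for y z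
    using \<delta>[of "{(y, z)}"] that by (simp add: nonoverlapping_def dist_norm norm_minus_commute)
  show "\<exists>d>0. \<forall>x'\<in>{a..b}. dist x' x < d \<longrightarrow> dist (g x') (g x) < e"
  proof (intro exI[of _ \<delta>] conjI ballI impI)
    fix y assume "y \<in> {a..b}" "dist y x < \<delta>"
    then show "dist (g y) (g x) < e"
      using d[of x y] d[of y x] x \<open>e > 0\<close>
      by (cases x y rule: linorder_cases) (auto simp: dist_commute dist_real_def)
  qed fact
qed

lemma integrable_continuous_scaleR:
  fixes f :: "real \<Rightarrow> 'b::{banach, second_countable_topology}"
  assumes k: "continuous_on {a..b} k" and f: "integrable (lebesgue_on {a..b}) f"
  shows "integrable (lebesgue_on {a..b}) (\<lambda>t. k t *\<^sub>R f t)"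
proof -
  have "bounded (k ` {a..b})"
    using k by (auto intro!: compact_imp_bounded compact_continuous_image)
  then obtain C where C: "\<And>t. t \<in> {a..b} \<Longrightarrow> \<bar>k t\<bar> \<le> C" unfolding bounded_iff by (metis imageI real_norm_def)
  have "k \<in> borel_measurable (lebesgue_on {a..b})"
    by (rule continuous_imp_measurable_on_sets_lebesgue[OF k]) auto
  then have m: "(\<lambda>t. k t *\<^sub>R f t) \<in> borel_measurable (lebesgue_on {a..b})"
    using f by (intro borel_measurable_scaleR) auto
  show ?thesis
  proof (rule Bochner_Integration.integrable_bound[OF _ m])
    show "integrable (lebesgue_on {a..b}) (\<lambda>t. C * norm (f t))" using f by simp
    show "AE t in lebesgue_on {a..b}. norm (k t *\<^sub>R f t) \<le> norm (C * norm (f t))"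
    proof (intro AE_I2)
      fix t assume "t \<in> space (lebesgue_on {a..b})"
      then have "\<bar>k t\<bar> \<le> \<bar>C\<bar>" using C[of t] by auto
      then show "norm (k t *\<^sub>R f t) \<le> norm (C * norm (f t))"
        by (simp add: abs_mult mult_right_mono)
    qed
  qed
qed

text \<open>The hypothesis on \<open>g'\<close> prescribes its values only where \<open>g\<close> is differentiable, which is
  almost everywhere; in this form it applies to a derivative given by \<open>vector_derivative\<close>.\<close>

theorem abs_cont_on_integration_by_parts:
  fixes k k' :: "real \<Rightarrow> real"
  assumes ac: "abs_cont_on g a b" and ab: "a < b"
    and g': "\<And>t v. t \<in> {a<..<b} \<Longrightarrow> (g has_vector_derivative v) (at t) \<Longrightarrow> g' t = v"
    and int: "integrable (lebesgue_on {a..b}) g'"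
    and k: "\<And>t. t \<in> {a..b} \<Longrightarrow> (k has_real_derivative k' t) (at t)" and k': "continuous_on {a..b} k'"
  shows "(LINT t|lebesgue_on {a..b}. k t *\<^sub>R g' t) =
    k b *\<^sub>R g b - k a *\<^sub>R g a - (LINT t|lebesgue_on {a..b}. k' t *\<^sub>R g t)"
proof -
  have ck: "continuous_on {a..b} k"
    using k by (meson DERIV_continuous_on has_field_derivative_at_within)
  obtain N where N: "negligible N"
    "\<And>x. x \<in> {a<..<b} - N \<Longrightarrow> \<exists>v. (g has_vector_derivative v) (at x)"
    using abs_cont_on_differentiable_ae[OF ac ab] by blast
  have d: "((\<lambda>t. k t *\<^sub>R g t) has_vector_derivative (k t *\<^sub>R g' t + k' t *\<^sub>R g t)) (at t)"
    if "t \<in> {a<..<b} - N" for t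
  proof -
    from N(2)[OF that] g'[of t] that have "(g has_vector_derivative g' t) (at t)" by auto
    with k[of t] that show ?thesis by (auto intro: has_vector_derivative_scaleR)
  qed
  have hk: "((\<lambda>t. k t *\<^sub>R g' t + k' t *\<^sub>R g t) has_integral (k b *\<^sub>R g b - k a *\<^sub>R g a)) {a..b}"
    by (rule abs_cont_on_fundamental_theorem[OF abs_cont_on_mult_C1[OF ac less_imp_le[OF ab] k k'] ab N(1) d])
  have i2: "integrable (lebesgue_on {a..b}) (\<lambda>t. k' t *\<^sub>R g t)"
    by (intro continuous_imp_integrable_real continuous_intros k' abs_cont_on_continuous[OF ac])
  have i1: "integrable (lebesgue_on {a..b}) (\<lambda>t. k t *\<^sub>R g' t)"
    by (rule integrable_continuous_scaleR[OF ck int])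
  have "((\<lambda>t. k t *\<^sub>R g' t + k' t *\<^sub>R g t) has_integral
      (LINT t|lebesgue_on {a..b}. k t *\<^sub>R g' t + k' t *\<^sub>R g t)) {a..b}"
    by (intro has_integral_integral_lebesgue_on Bochner_Integration.integrable_add i1 i2) auto
  from has_integral_unique[OF this hk]
  have "(LINT t|lebesgue_on {a..b}. k t *\<^sub>R g' t + k' t *\<^sub>R g t) = k b *\<^sub>R g b - k a *\<^sub>R g a" .
  then show "(LINT t|lebesgue_on {a..b}. k t *\<^sub>R g' t) =
    k b *\<^sub>R g b - k a *\<^sub>R g a - (LINT t|lebesgue_on {a..b}. k' t *\<^sub>R g t)"
    using i1 i2 by (simp add: algebra_simps)
qed

section \<open>Poisson type kernels and their derivatives\<close>

definition sqdist :: "complex \<Rightarrow> real \<Rightarrow> real" where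
  "sqdist z t = (cos t - Re z)\<^sup>2 + (sin t - Im z)\<^sup>2"

lemma sqdist_eq_norm: "sqdist z t = (norm (cis t - z))\<^sup>2"
  by (simp add: sqdist_def cmod_power2)

lemma sqdist_pos: "norm z < 1 \<Longrightarrow> 0 < sqdist z t"
proof -
  assume "norm z < 1"
  then have "cis t \<noteq> z" using norm_cis[of t] by auto
  then show ?thesis by (simp add: sqdist_eq_norm)
qed

text \<open>Up to a constant factor, the Poisson type kernel is the case \<open>\<beta> = \<alpha> + 1\<close>, \<open>\<gamma> = \<alpha>/2 + 1\<close>. The
  family with two free exponents is closed under differentiation up to trigonometric factors.\<close>

definition ker :: "real \<Rightarrow> real \<Rightarrow> complex \<Rightarrow> real \<Rightarrow> real" where
  "ker \<beta> \<gamma> z t = (1 - (norm z)\<^sup>2) powr \<beta> * sqdist z t powr - \<gamma>"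

lemma defect_pos: "norm (z::complex) < 1 \<Longrightarrow> 0 < 1 - (norm z)\<^sup>2"
  by (simp add: abs_square_less_1)

lemma ker_nonneg: "0 \<le> ker \<beta> \<gamma> z t" by (simp add: ker_def)

lemma ker_raise_right:
  assumes "norm z < 1"
  shows "ker \<beta> \<gamma> z t = sqdist z t * ker \<beta> (\<gamma> + 1) z t"
  using sqdist_pos[OF assms, of t] powr_add[of "sqdist z t" 1 "- (\<gamma> + 1)"] by (simp add: ker_def)

lemma ker_lower_left:
  assumes "norm z < 1"
  shows "ker (\<beta> + 1) \<gamma> z t = (1 - (norm z)\<^sup>2) * ker \<beta> \<gamma> z t"
  using defect_pos[OF assms] powr_add[of "1 - (norm z)\<^sup>2" \<beta> 1] by (simp add: ker_def)

lemma continuous_on_ker: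
  "continuous_on (ball 0 1 \<times> UNIV) (\<lambda>(z, t). ker \<beta> \<gamma> z t)"
proof -
  have "1 - (norm z)\<^sup>2 \<noteq> 0" "sqdist z t \<noteq> 0" if "(z, t) \<in> ball (0::complex) 1 \<times> (UNIV::real set)" for z t
    using that defect_pos[of z] sqdist_pos[of z t] by auto
  then show ?thesis
    unfolding ker_def case_prod_beta by (intro continuous_intros) (force simp: sqdist_def intro!:
        continuous_intros)+
qed

lemma poisson_kernel_eq_ker:
  "poisson_kernel \<alpha> (z * cis (- t)) = poisson_const \<alpha> * ker (\<alpha> + 1) (\<alpha> / 2 + 1) z t" if "norm z < 1"
proof -
  have "norm (1 - z * cis (- t)) = norm (cis t * (1 - z * cis (- t)))" by (simp add: norm_mult)
  also have "cis t * (1 - z * cis (- t)) = cis t - z" by (simp add: algebra_simps cis_mult)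
  finally have "norm (1 - z * cis (- t)) = sqrt (sqdist z t)" by (simp add: sqdist_eq_norm)
  then have "norm (1 - z * cis (- t)) powr (\<alpha> + 2) = sqdist z t powr (\<alpha> / 2 + 1)"
    using sqdist_pos[OF that, of t] by (simp add: powr_half_sqrt[symmetric] powr_powr field_simps)
  then show ?thesis
    using powr_minus_divide[of "sqdist z t" "\<alpha> / 2 + 1"]
    by (simp add: poisson_kernel_def ker_def norm_mult)
qed

text \<open>The derivative of \<open>ker \<beta> \<gamma>\<close> in \<open>z\<close> along the vector \<open>e\<close> of the plane; the partial derivatives
  in \<open>x\<close> and \<open>y\<close> are the cases \<open>e = 1\<close> and \<open>e = \<i>\<close>.\<close>

definition ker_dir :: "real \<Rightarrow> real \<Rightarrow> complex \<Rightarrow> complex \<Rightarrow> real \<Rightarrow> real" where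
  "ker_dir \<beta> \<gamma> e z t =
     2 * \<gamma> * ((cos t - Re z) * Re e + (sin t - Im z) * Im e) * ker \<beta> (\<gamma> + 1) z t
     - 2 * \<beta> * (Re z * Re e + Im z * Im e) * ker (\<beta> - 1) \<gamma> z t"

lemma continuous_on_ker_dir: "continuous_on (ball 0 1 \<times> UNIV) (\<lambda>(z, t). ker_dir \<beta> \<gamma> e z t)"
  using continuous_on_ker[of \<beta> "\<gamma> + 1"] continuous_on_ker[of "\<beta> - 1" \<gamma>]
  unfolding ker_dir_def case_prod_beta by (intro continuous_intros)

lemma has_real_derivative_powr_prod:
  fixes P Q :: "real \<Rightarrow> real"
  assumes "(P has_real_derivative P') (at u)" "(Q has_real_derivative Q') (at u)" "0 < P u" "0 < Q u"
  shows "((\<lambda>u. P u powr \<beta> * Q u powr - \<gamma>) has_real_derivative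
     (\<beta> * P') * (P u powr (\<beta> - 1) * Q u powr - \<gamma>) - (\<gamma> * Q') * (P u powr \<beta> * Q u powr - (\<gamma> + 1))) (at u)"
proof -
  have "((\<lambda>u. P u powr \<beta>) has_real_derivative \<beta> * P u powr (\<beta> - 1) * P') (at u)"
    by (rule DERIV_chain2[of "\<lambda>x. x powr \<beta>", OF has_real_derivative_powr[OF assms(3)] assms(1)])
  moreover have "((\<lambda>u. Q u powr - \<gamma>) has_real_derivative - \<gamma> * Q u powr (- \<gamma> - 1) * Q') (at u)"
    by (rule DERIV_chain2[of "\<lambda>x. x powr - \<gamma>", OF has_real_derivative_powr[OF assms(4)] assms(2)])
  ultimately have "((\<lambda>u. P u powr \<beta> * Q u powr - \<gamma>) has_real_derivative
      \<beta> * P u powr (\<beta> - 1) * P' * Q u powr - \<gamma> + - \<gamma> * Q u powr (- \<gamma> - 1) * Q' * P u powr \<beta>) (at u)"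
    by (rule DERIV_mult)
  then show ?thesis by (simp add: mult_ac)
qed

lemma ker_has_directional_derivative:
  assumes "norm (z + e * of_real u) < 1"
  shows "((\<lambda>u. ker \<beta> \<gamma> (z + e * of_real u) t) has_real_derivative
    ker_dir \<beta> \<gamma> e (z + e * of_real u) t) (at u)"
proof -
  let ?w = "\<lambda>u. z + e * of_real u"
  have "((\<lambda>u. (1 - (norm (?w u))\<^sup>2) powr \<beta> * sqdist (?w u) t powr - \<gamma>) has_real_derivative
      (\<beta> * (- 2 * (Re (?w u) * Re e + Im (?w u) * Im e))) *
        ((1 - (norm (?w u))\<^sup>2) powr (\<beta> - 1) * sqdist (?w u) t powr - \<gamma>)
      - (\<gamma> * (- 2 * ((cos t - Re (?w u)) * Re e + (sin t - Im (?w u)) * Im e))) *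
        ((1 - (norm (?w u))\<^sup>2) powr \<beta> * sqdist (?w u) t powr - (\<gamma> + 1))) (at u)"
    by (rule has_real_derivative_powr_prod[where P = "\<lambda>u. 1 - (norm (?w u))\<^sup>2" and Q = "\<lambda>u. sqdist (?w u) t"])
      (use defect_pos[OF assms] sqdist_pos[OF assms, of t] in
        \<open>auto simp: sqdist_def cmod_power2 algebra_simps intro!: derivative_eq_intros\<close>)
  then show ?thesis
    by (simp add: ker_def ker_dir_def algebra_simps)
qed

lemma ker_has_derivative_t:
  assumes "norm z < 1"
  shows "(ker \<beta> \<gamma> z has_real_derivative - (2 * \<gamma> * (Re z * sin t - Im z * cos t) * ker \<beta> (\<gamma> + 1) z t)) (at t)"
proof -
  have "((\<lambda>t. (1 - (norm z)\<^sup>2) powr \<beta> * sqdist z t powr - \<gamma>) has_real_derivative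
      (\<beta> * 0) * ((1 - (norm z)\<^sup>2) powr (\<beta> - 1) * sqdist z t powr - \<gamma>)
      - (\<gamma> * (2 * (Re z * sin t - Im z * cos t))) * ((1 - (norm z)\<^sup>2) powr \<beta> * sqdist z t powr - (\<gamma> + 1)))
          (at t)"
    by (rule has_real_derivative_powr_prod)
      (use defect_pos[OF assms] sqdist_pos[OF assms] in \<open>auto simp: sqdist_def cmod_power2 algebra_simps
          intro!: derivative_eq_intros\<close>)
  then show ?thesis
    by (simp add: ker_def[abs_def] algebra_simps)
qed

text \<open>The left-hand side is the derivative of the kernel in the angle of \<open>z\<close>, and the right-hand
  side is minus its derivative in \<open>t\<close> (\<open>ker_has_derivative_t\<close>): the kernel depends only on the
  difference of the two angles.\<close>

lemma ker_angular_identity: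
  "Re z * ker_dir \<beta> \<gamma> \<i> z t - Im z * ker_dir \<beta> \<gamma> 1 z t
    = 2 * \<gamma> * (Re z * sin t - Im z * cos t) * ker \<beta> (\<gamma> + 1) z t"
  by (simp add: ker_dir_def algebra_simps)

text \<open>For \<open>\<alpha> = 0\<close> this is the conjugate Poisson kernel \<open>Im ((cis t + z) / (cis t - z))\<close>.\<close>

definition conj_ker :: "real \<Rightarrow> complex \<Rightarrow> real \<Rightarrow> real" where
  "conj_ker \<alpha> z t = 2 * (Im z * cos t - Re z * sin t) * ker \<alpha> (\<alpha> / 2 + 1) z t"

definition conj_ker_t :: "real \<Rightarrow> complex \<Rightarrow> real \<Rightarrow> real" where
  "conj_ker_t \<alpha> z t = 4 * (\<alpha> / 2 + 1) * (Im z * cos t - Re z * sin t)\<^sup>2 * ker \<alpha> (\<alpha> / 2 + 2) z t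
     - 2 * (Re z * cos t + Im z * sin t) * ker \<alpha> (\<alpha> / 2 + 1) z t"

lemma conj_ker_has_derivative_t:
  assumes "norm z < 1"
  shows "(conj_ker \<alpha> z has_real_derivative conj_ker_t \<alpha> z t) (at t)"
  unfolding conj_ker_def[abs_def] conj_ker_t_def
  by (rule derivative_eq_intros ker_has_derivative_t[OF assms] refl)+
    (simp add: algebra_simps power2_eq_square)

text \<open>The radial derivative of the kernel is a total derivative in \<open>t\<close> up to less singular terms.
  After division by \<open>k\<close> this is a polynomial identity in the real and imaginary parts \<open>X\<close> and
  \<open>Y\<close> of \<open>z / cis t\<close>, because \<open>|z|\<^sup>2 = X\<^sup>2 + Y\<^sup>2\<close> and \<open>|cis t - z|\<^sup>2 = 1 - 2 X + X\<^sup>2 + Y\<^sup>2\<close>.\<close>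

lemma ker_radial_identity:
  assumes z: "norm z < 1"
  shows "Re z * ker_dir (\<alpha> + 1) (\<alpha> / 2 + 1) 1 z t + Im z * ker_dir (\<alpha> + 1) (\<alpha> / 2 + 1) \<i> z t =
    - conj_ker_t \<alpha> z t + \<alpha> / 2 * (ker (\<alpha> + 1) (\<alpha> / 2 + 1) z t - ker \<alpha> (\<alpha> / 2) z t)"
proof -
  define x y c s where "x = Re z" and "y = Im z" and "c = cos t" and "s = sin t"
  define k where "k = ker \<alpha> (\<alpha> / 2 + 2) z t"
  have cs: "c\<^sup>2 + s\<^sup>2 = 1" by (simp add: c_def s_def)
  define X Y \<rho> where "X = x * c + y * s" and "Y = y * c - x * s" and "\<rho> = X\<^sup>2 + Y\<^sup>2"
  have "\<rho> = (x\<^sup>2 + y\<^sup>2) * (c\<^sup>2 + s\<^sup>2)" by (simp add: \<rho>_def X_def Y_def power2_eq_square algebra_simps)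
  then have \<rho>: "x\<^sup>2 + y\<^sup>2 = \<rho>" by (simp add: cs)
  have d: "1 - (norm z)\<^sup>2 = 1 - \<rho>" by (simp add: cmod_power2 x_def[symmetric] y_def[symmetric] \<rho>)
  have "sqdist z t = (c\<^sup>2 + s\<^sup>2) - 2 * X + (x\<^sup>2 + y\<^sup>2)"
    by (simp add: sqdist_def X_def x_def y_def c_def s_def power2_eq_square algebra_simps)
  then have D: "sqdist z t = 1 - 2 * X + \<rho>" by (simp add: cs \<rho>)
  have k1: "ker \<alpha> (\<alpha> / 2 + 1) z t = (1 - 2 * X + \<rho>) * k"
    using ker_raise_right[OF z, of \<alpha> "\<alpha> / 2 + 1" t] by (simp add: k_def D add.assoc)
  have k2: "ker \<alpha> (\<alpha> / 2) z t = (1 - 2 * X + \<rho>)\<^sup>2 * k"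
    using ker_raise_right[OF z, of \<alpha> "\<alpha> / 2" t] by (simp add: k1 D power2_eq_square)
  have k3: "ker (\<alpha> + 1) (\<alpha> / 2 + 1) z t = (1 - \<rho>) * (1 - 2 * X + \<rho>) * k"
    using ker_lower_left[OF z, of \<alpha> "\<alpha> / 2 + 1" t] by (simp add: k1 d)
  have k4: "ker (\<alpha> + 1) (\<alpha> / 2 + 2) z t = (1 - \<rho>) * k"
    using ker_lower_left[OF z, of \<alpha> "\<alpha> / 2 + 2" t] by (simp add: k_def d)
  have "Re z * ker_dir (\<alpha> + 1) (\<alpha> / 2 + 1) 1 z t + Im z * ker_dir (\<alpha> + 1) (\<alpha> / 2 + 1) \<i> z t =
      2 * (\<alpha> / 2 + 1) * (X - (x\<^sup>2 + y\<^sup>2)) * ((1 - \<rho>) * k) - 2 * (\<alpha> + 1) * (x\<^sup>2 + y\<^sup>2) * ((1 - 2 * X + \<rho>) * k)"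
    unfolding ker_dir_def
    by (simp add: k1 k4 add.assoc x_def[symmetric] y_def[symmetric] c_def[symmetric] s_def[symmetric])
       (simp add: X_def algebra_simps power2_eq_square)
  also have "\<dots> = - (4 * (\<alpha> / 2 + 1) * Y\<^sup>2 * k - 2 * X * ((1 - 2 * X + \<rho>) * k))
      + \<alpha> / 2 * ((1 - \<rho>) * (1 - 2 * X + \<rho>) * k - (1 - 2 * X + \<rho>)\<^sup>2 * k)"
    unfolding \<rho> by (simp add: \<rho>_def algebra_simps power2_eq_square)
  also have "\<dots> = - conj_ker_t \<alpha> z t + \<alpha> / 2 * (ker (\<alpha> + 1) (\<alpha> / 2 + 1) z t - ker \<alpha> (\<alpha> / 2) z t)"
    unfolding conj_ker_t_def k1 k2 k3 k_def[symmetric] by (simp add: X_def Y_def x_def y_def c_def s_def)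
  finally show ?thesis .
qed

section \<open>Derivatives of the Poisson type integral\<close>

abbreviation circ :: "real measure" where
  "circ \<equiv> lebesgue_on {0..2*pi}"

abbreviation polar :: "real \<Rightarrow> real \<Rightarrow> complex" where
  "polar r \<theta> \<equiv> of_real r * cis \<theta>"

definition circ_transform :: "(complex \<Rightarrow> real \<Rightarrow> real) \<Rightarrow> (real \<Rightarrow> complex) \<Rightarrow> complex \<Rightarrow> complex" where
  "circ_transform k G z = (LINT t|circ. k z t *\<^sub>R G t)"

abbreviation disc_kernel :: "(complex \<Rightarrow> real \<Rightarrow> real) \<Rightarrow> bool" where
  "disc_kernel k \<equiv> continuous_on (ball 0 1 \<times> UNIV) (\<lambda>(z, t). k z t)"

lemma disc_kernel_compose:
  assumes "disc_kernel k" "continuous_on S f" "continuous_on S h" "\<And>x. x \<in> S \<Longrightarrow> norm (f x) < 1"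
  shows "continuous_on S (\<lambda>x. k (f x) (h x))"
proof -
  have "(\<lambda>x. (f x, h x)) ` S \<subseteq> ball 0 1 \<times> UNIV" using assms(4) by auto
  from continuous_on_compose2[OF assms(1) continuous_on_Pair[OF assms(2,3)] this] show ?thesis by simp
qed

lemma circ_transform_integrable:
  fixes g :: "real \<Rightarrow> complex"
  assumes "disc_kernel k" "continuous_on {0..2*pi} g" "norm z < 1"
  shows "integrable circ (\<lambda>t. k z t *\<^sub>R g t)"
proof (rule continuous_imp_integrable_real)
  have "continuous_on {0..2*pi} (\<lambda>t. k z t)"
    by (rule disc_kernel_compose[OF assms(1)]) (use assms(3) in \<open>auto intro: continuous_intros\<close>)
  then show "continuous_on {0..2*pi} (\<lambda>t. k z t *\<^sub>R g t)" by (intro continuous_intros assms(2))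
qed

lemma circ_transform_eq_integral:
  assumes "disc_kernel k" "continuous_on {0..2*pi} g" "norm z < 1"
  shows "circ_transform k g z = integral (cbox 0 (2*pi)) (\<lambda>t. k z t *\<^sub>R g t)"
  unfolding circ_transform_def
  using lebesgue_integral_eq_integral[OF circ_transform_integrable[OF assms]] by simp

lemma circ_transform_continuous:
  assumes k: "disc_kernel k" and G: "integrable circ G"
  shows "continuous_on (ball 0 1) (circ_transform k G)"
proof (rule continuous_on_sequentiallyI)
  fix u a assume u: "\<forall>n. u n \<in> ball (0::complex) 1" "a \<in> ball 0 1" "u \<longlonglongrightarrow> a"
  define S where "S = insert a (range u)"
  have S: "S \<subseteq> ball 0 1" "compact S" using u compact_sequence_with_limit[OF u(3)] by (auto simp: S_def)
  have "bounded ((\<lambda>(z, t). k z t) ` (S \<times> {0..2*pi}))"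
    using S by (intro compact_imp_bounded compact_continuous_image compact_Times continuous_on_subset[OF k])
        auto
  then obtain C where C: "\<And>z t. z \<in> S \<Longrightarrow> t \<in> {0..2*pi} \<Longrightarrow> \<bar>k z t\<bar> \<le> C"
    unfolding bounded_iff by fastforce
  have meas: "(\<lambda>t. k z t *\<^sub>R G t) \<in> borel_measurable circ" if "z \<in> ball 0 1" for z
  proof (rule borel_measurable_integrable[OF integrable_continuous_scaleR[OF _ G]])
    show "continuous_on {0..2*pi} (k z)"
      using that by (intro disc_kernel_compose[OF k] continuous_intros) auto
  qed
  show "(\<lambda>n. circ_transform k G (u n)) \<longlonglongrightarrow> circ_transform k G a"
    unfolding circ_transform_def
  proof (rule integral_dominated_convergence[where w="\<lambda>t. C * norm (G t)"])
    show "integrable circ (\<lambda>t. C * norm (G t))" using G by simp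
    show "(\<lambda>t. k a t *\<^sub>R G t) \<in> borel_measurable circ" by (rule meas[OF u(2)])
    show "(\<lambda>t. k (u n) t *\<^sub>R G t) \<in> borel_measurable circ" for n using u(1) by (intro meas) blast
    show "AE t in circ. (\<lambda>n. k (u n) t *\<^sub>R G t) \<longlonglongrightarrow> k a t *\<^sub>R G t"
    proof (intro AE_I2 tendsto_scaleR tendsto_const)
      fix t
      have "continuous_on (ball 0 1) (\<lambda>z. k z t)"
        by (intro disc_kernel_compose[OF k] continuous_intros) auto
      then show "(\<lambda>n. k (u n) t) \<longlonglongrightarrow> k a t"
        by (rule continuous_on_tendsto_compose[OF _ u(3,2)]) (use u(1) in auto)
    qed
    show "AE t in circ. norm (k (u n) t *\<^sub>R G t) \<le> C * norm (G t)" for n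
      using C[of "u n"] by (intro AE_I2) (auto simp: S_def intro!: mult_right_mono)
  qed
qed

lemma circ_transform_has_vector_derivative:
  assumes k: "disc_kernel k" and k': "disc_kernel k'" and g: "continuous_on {0..2*pi} g"
    and d: "\<And>z u t. norm (z + e * of_real u) < 1 \<Longrightarrow>
      ((\<lambda>u. k (z + e * of_real u) t) has_real_derivative k' (z + e * of_real u) t) (at u)"
    and z: "norm z < 1"
  shows "((\<lambda>u. circ_transform k g (z + e * of_real u)) has_vector_derivative circ_transform k' g z) (at 0)"
proof -
  have "open ((\<lambda>u::real. z + e * of_real u) -` ball 0 1)"
    by (intro open_vimage continuous_intros open_ball)
  moreover have "0 \<in> (\<lambda>u::real. z + e * of_real u) -` ball 0 1" using z by simp
  ultimately obtain r where r: "r > 0" "ball 0 r \<subseteq> (\<lambda>u::real. z + e * of_real u) -` ball 0 1"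
    by (meson openE)
  then have zr: "norm (z + e * of_real u) < 1" if "u \<in> ball 0 r" for u :: real using that by auto
  have "((\<lambda>u. integral (cbox 0 (2*pi)) (\<lambda>t. k (z + e * of_real u) t *\<^sub>R g t)) has_vector_derivative
      integral (cbox 0 (2*pi)) (\<lambda>t. k' (z + e * of_real 0) t *\<^sub>R g t)) (at 0 within ball 0 r)"
  proof (rule leibniz_rule_vector_derivative)
    fix u t assume u: "u \<in> ball (0::real) r"
    show "((\<lambda>u. k (z + e * of_real u) t *\<^sub>R g t) has_vector_derivative k' (z + e * of_real u) t *\<^sub>R g t)
        (at u within ball 0 r)"
      using has_vector_derivative_scaleR[OF d[OF zr[OF u], THEN has_field_derivative_at_within]
          has_vector_derivative_const[of "g t"]] by simp
  next
    fix u assume "u \<in> ball (0::real) r"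
    then show "(\<lambda>t. k (z + e * of_real u) t *\<^sub>R g t) integrable_on cbox 0 (2*pi)"
      by (intro integrable_continuous continuous_intros disc_kernel_compose[OF k])
        (use g zr in auto)
  next
    show "continuous_on (ball 0 r \<times> cbox 0 (2*pi)) (\<lambda>(u, t). k' (z + e * of_real u) t *\<^sub>R g t)"
      unfolding case_prod_beta
      by (intro continuous_intros disc_kernel_compose[OF k'] continuous_on_compose2[OF g]) (use zr in auto)
  qed (use r in auto)
  then have "((\<lambda>u. integral (cbox 0 (2*pi)) (\<lambda>t. k (z + e * of_real u) t *\<^sub>R g t)) has_vector_derivative
      circ_transform k' g z) (at 0)"
    using r at_within_open[of 0 "ball (0::real) r"] by (simp add: circ_transform_eq_integral[OF k' g z]
        mem_ball)
  then show ?thesis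
  proof (rule has_vector_derivative_transform_within_open[where S="ball 0 r"])
    fix u assume "u \<in> ball (0::real) r"
    then show "integral (cbox 0 (2*pi)) (\<lambda>t. k (z + e * of_real u) t *\<^sub>R g t) = circ_transform k g
        (z + e * of_real u)"
      using circ_transform_eq_integral[OF k g zr] by simp
  qed (use r in auto)
qed

lemma poisson_integral_eq_circ_transform:
  assumes "norm z < 1"
  shows "poisson_integral \<alpha> F z = (poisson_const \<alpha> / (2 * pi)) *\<^sub>R
    circ_transform (ker (\<alpha> + 1) (\<alpha> / 2 + 1)) (\<lambda>t. F (cis t)) z"
proof -
  have "(LINT t|circ. complex_of_real (poisson_kernel \<alpha> (z * cis (- t))) * F (cis t)) =
    (LINT t|circ. poisson_const \<alpha> *\<^sub>R (ker (\<alpha> + 1) (\<alpha> / 2 + 1) z t *\<^sub>R F (cis t)))"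
    unfolding poisson_kernel_eq_ker[OF assms] by (simp add: scaleR_conv_of_real mult.assoc)
  then show ?thesis
    unfolding poisson_integral_def circ_transform_def by (simp add: scaleR_conv_of_real)
qed

locale poisson_extension =
  fixes \<alpha> :: real and F f :: "complex \<Rightarrow> complex"
  assumes ac: "abs_cont_circle F"
    and int: "integrable circ (\<lambda>t. circle_deriv F (cis t))"
    and f: "\<And>z. norm z < 1 \<Longrightarrow> f z = poisson_integral \<alpha> F z"
begin

abbreviation g :: "real \<Rightarrow> complex" where "g t \<equiv> F (cis t)"
abbreviation g' :: "real \<Rightarrow> complex" where "g' t \<equiv> circle_deriv F (cis t)"
abbreviation cc :: real where "cc \<equiv> poisson_const \<alpha> / (2 * pi)"
abbreviation P :: "complex \<Rightarrow> real \<Rightarrow> real" where "P \<equiv> ker (\<alpha> + 1) (\<alpha> / 2 + 1)"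

lemma g_cont: "continuous_on {0..2*pi} g"
  using ac abs_cont_on_continuous unfolding abs_cont_circle_def by blast

lemma g_int: "integrable circ g"
  by (rule continuous_imp_integrable_real[OF g_cont])

abbreviation P_dir :: "complex \<Rightarrow> complex \<Rightarrow> real \<Rightarrow> real" where
  "P_dir \<equiv> ker_dir (\<alpha> + 1) (\<alpha> / 2 + 1)"

lemma has_directional_derivative:
  assumes z: "norm z < 1"
  shows "((\<lambda>u. f (z + e * of_real u)) has_vector_derivative cc *\<^sub>R circ_transform (P_dir e) g z) (at 0)"
proof -
  have "((\<lambda>u. cc *\<^sub>R circ_transform P g (z + e * of_real u)) has_vector_derivative
      cc *\<^sub>R circ_transform (P_dir e) g z) (at 0)"
    using bounded_linear.has_vector_derivative[OF bounded_linear_scaleR_right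
        circ_transform_has_vector_derivative[OF continuous_on_ker continuous_on_ker_dir g_cont
          ker_has_directional_derivative z]] by simp
  then show ?thesis
  proof (rule has_vector_derivative_transform_within_open[where S="(\<lambda>u::real. z + e * of_real u) -` ball 0
      1"])
    show "open ((\<lambda>u::real. z + e * of_real u) -` ball 0 1)"
      by (intro open_vimage continuous_intros open_ball)
  qed (use z f poisson_integral_eq_circ_transform in auto)
qed

lemma partial_eq:
  assumes "norm z < 1"
  shows "partial_x f z = cc *\<^sub>R circ_transform (P_dir 1) g z"
    and "partial_y f z = cc *\<^sub>R circ_transform (P_dir \<i>) g z"
  using has_directional_derivative[OF assms, of 1] has_directional_derivative[OF assms, of \<i>]
  unfolding partial_x_def partial_y_def by (simp_all add: vector_derivative_at)

lemma partial_continuous: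
  "continuous_on (ball 0 1) (partial_x f)" "continuous_on (ball 0 1) (partial_y f)"
proof -
  have "continuous_on (ball 0 1) (\<lambda>z. cc *\<^sub>R circ_transform (P_dir e) g z)" for e
    by (intro continuous_intros circ_transform_continuous[OF continuous_on_ker_dir g_int])
  from continuous_on_eq[OF this[of 1]] continuous_on_eq[OF this[of \<i>]]
  show "continuous_on (ball 0 1) (partial_x f)" "continuous_on (ball 0 1) (partial_y f)"
    by (simp_all add: partial_eq)
qed

lemma partial_z_continuous: "continuous_on (ball 0 1) (partial_z f)" "continuous_on (ball 0 1) (partial_zbar
    f)"
  unfolding partial_z_def partial_zbar_def by (intro continuous_intros partial_continuous; simp)+

lemma integrate_by_parts:
  assumes k: "\<And>t. (k z has_real_derivative k' z t) (at t)" and k': "disc_kernel k'" and z: "norm z < 1"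
    and per: "k z (2 * pi) = k z 0"
  shows "circ_transform (\<lambda>z t. - k' z t) g z = circ_transform k g' z"
proof -
  have "(LINT t|circ. k z t *\<^sub>R g' t) = k z (2*pi) *\<^sub>R g (2*pi) - k z 0 *\<^sub>R g 0 - (LINT t|circ. k' z t *\<^sub>R g
      t)"
  proof (rule abs_cont_on_integration_by_parts[OF _ _ _ int])
    show "abs_cont_on g 0 (2*pi)" using ac unfolding abs_cont_circle_def .
    fix t v assume "(g has_vector_derivative v) (at t)"
    then have "((\<lambda>h. g (t + h)) has_vector_derivative v) (at 0)"
      using vector_diff_chain_at[of "\<lambda>h. t + h" 1 0 g v] has_vector_derivative_shift[of "\<lambda>h. h" "\<lambda>_. 1" 0 t]
      by (simp add: o_def has_vector_derivative_id)
    then show "g' t = v"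
      unfolding circle_deriv_def cis_mult by (rule vector_derivative_at)
  next
    show "continuous_on {0..2 * pi} (k' z)"
      using z by (intro disc_kernel_compose[OF k'] continuous_intros) auto
  qed (use k in auto)
  moreover have "g (2 * pi) = g 0" by simp
  ultimately have "(LINT t|circ. k z t *\<^sub>R g' t) = - (LINT t|circ. k' z t *\<^sub>R g t)"
    by (simp only: per) simp
  then show ?thesis unfolding circ_transform_def by simp
qed

text \<open>The angular derivative \<open>x \<partial>\<^sub>y - y \<partial>\<^sub>x\<close> falls on the kernel, turns into minus the derivative
  in \<open>t\<close>, and is then moved to the boundary function.\<close>

lemma partial_theta_eq:
  assumes z: "norm z < 1"
  shows "partial_theta f z = cc *\<^sub>R circ_transform P g' z"
proof -
  let ?kx = "P_dir 1" and ?ky = "P_dir \<i>"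
  let ?kt = "\<lambda>z t. - (2 * (\<alpha> / 2 + 1) * (Re z * sin t - Im z * cos t) * ker (\<alpha> + 1) (\<alpha> / 2 + 1 + 1) z t)"
  have "partial_theta f z = of_real (Re z) * partial_y f z - of_real (Im z) * partial_x f z"
    by (simp add: partial_theta_def partial_z_def partial_zbar_def complex_eq_iff field_simps)
  also have "\<dots> = cc *\<^sub>R (Re z *\<^sub>R circ_transform ?ky g z - Im z *\<^sub>R circ_transform ?kx g z)"
    by (simp add: partial_eq z scaleR_conv_of_real algebra_simps)
  also have "Re z *\<^sub>R circ_transform ?ky g z - Im z *\<^sub>R circ_transform ?kx g z =
      (LINT t|circ. Re z *\<^sub>R (?ky z t *\<^sub>R g t) - Im z *\<^sub>R (?kx z t *\<^sub>R g t))"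
    unfolding circ_transform_def
    using circ_transform_integrable[OF continuous_on_ker_dir g_cont z]
    by (subst Bochner_Integration.integral_diff) (auto intro: integrable_scaleR_right simp del: scaleR_scaleR)
  also have "\<dots> = circ_transform (\<lambda>z t. - ?kt z t) g z"
    unfolding circ_transform_def
  proof (intro Bochner_Integration.integral_cong refl)
    fix t
    have "Re z *\<^sub>R (?ky z t *\<^sub>R g t) - Im z *\<^sub>R (?kx z t *\<^sub>R g t) = (Re z * ?ky z t - Im z * ?kx z t) *\<^sub>R g t"
      by (simp add: scaleR_diff_left)
    then show "Re z *\<^sub>R (?ky z t *\<^sub>R g t) - Im z *\<^sub>R (?kx z t *\<^sub>R g t) = (- ?kt z t) *\<^sub>R g t"
      unfolding ker_angular_identity by simp
  qed
  also have "\<dots> = circ_transform P g' z"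
  proof (rule integrate_by_parts[OF _ _ z])
    show "(P z has_real_derivative ?kt z t) (at t)" for t by (rule ker_has_derivative_t[OF z])
    show "disc_kernel ?kt"
      using continuous_on_ker[of "\<alpha> + 1" "\<alpha> / 2 + 1 + 1"]
      unfolding case_prod_beta by (intro continuous_intros)
  qed (simp add: ker_def sqdist_def)
  finally show ?thesis .
qed

text \<open>The left-hand side is \<open>x \<partial>\<^sub>x f + y \<partial>\<^sub>y f = r \<partial>\<^sub>r f\<close>. In \<open>ker_radial_identity\<close> the derivative
  in \<open>t\<close> is integrated by parts.\<close>

lemma radial_eq:
  assumes z: "norm z < 1"
  shows "z * partial_z f z + cnj z * partial_zbar f z =
    cc *\<^sub>R (circ_transform (conj_ker \<alpha>) g' z + (\<alpha> / 2) *\<^sub>R (circ_transform P g z - circ_transform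
        (ker \<alpha> (\<alpha> / 2)) g z))"
proof -
  let ?kx = "P_dir 1" and ?ky = "P_dir \<i>"
  let ?E = "ker \<alpha> (\<alpha> / 2)"
  have kt: "disc_kernel (conj_ker_t \<alpha>)"
    using continuous_on_ker[of \<alpha> "\<alpha> / 2 + 1"] continuous_on_ker[of \<alpha> "\<alpha> / 2 + 2"]
    unfolding case_prod_beta conj_ker_t_def by (intro continuous_intros)
  then have kt': "disc_kernel (\<lambda>z t. - conj_ker_t \<alpha> z t)"
    unfolding case_prod_beta by (intro continuous_intros)
  note I = circ_transform_integrable[OF _ g_cont z]
  have "z * partial_z f z + cnj z * partial_zbar f z = of_real (Re z) * partial_x f z + of_real (Im z) *
      partial_y f z"
    by (simp add: partial_z_def partial_zbar_def complex_eq_iff field_simps)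
  also have "\<dots> = cc *\<^sub>R (Re z *\<^sub>R circ_transform ?kx g z + Im z *\<^sub>R circ_transform ?ky g z)"
    by (simp add: partial_eq z scaleR_conv_of_real algebra_simps)
  also have "Re z *\<^sub>R circ_transform ?kx g z + Im z *\<^sub>R circ_transform ?ky g z =
      (LINT t|circ. Re z *\<^sub>R (?kx z t *\<^sub>R g t) + Im z *\<^sub>R (?ky z t *\<^sub>R g t))"
    unfolding circ_transform_def
    using I[OF continuous_on_ker_dir]
    by (subst Bochner_Integration.integral_add) (auto intro: integrable_scaleR_right simp del: scaleR_scaleR)
  also have "\<dots> = (LINT t|circ. (- conj_ker_t \<alpha> z t) *\<^sub>R g t + (\<alpha> / 2) *\<^sub>R (P z t *\<^sub>R g t - ?E z t *\<^sub>R g t))"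
  proof (intro Bochner_Integration.integral_cong refl)
    fix t
    have "Re z *\<^sub>R (?kx z t *\<^sub>R g t) + Im z *\<^sub>R (?ky z t *\<^sub>R g t) = (Re z * ?kx z t + Im z * ?ky z t) *\<^sub>R g t"
      by (simp add: scaleR_add_left)
    also have "\<dots> = (- conj_ker_t \<alpha> z t) *\<^sub>R g t + (\<alpha> / 2) *\<^sub>R (P z t *\<^sub>R g t - ?E z t *\<^sub>R g t)"
      unfolding ker_radial_identity[OF z] by (simp add: scaleR_add_left scaleR_diff_left right_diff_distrib
          scaleR_diff_right)
    finally show "Re z *\<^sub>R (?kx z t *\<^sub>R g t) + Im z *\<^sub>R (?ky z t *\<^sub>R g t) =
      (- conj_ker_t \<alpha> z t) *\<^sub>R g t + (\<alpha> / 2) *\<^sub>R (P z t *\<^sub>R g t - ?E z t *\<^sub>R g t)" .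
  qed
  also have "\<dots> = circ_transform (\<lambda>z t. - conj_ker_t \<alpha> z t) g z + (\<alpha> / 2) *\<^sub>R (circ_transform P g z -
      circ_transform ?E g z)"
    unfolding circ_transform_def using I[OF kt'] I[OF continuous_on_ker] 
    by (subst Bochner_Integration.integral_add) (auto intro!: integrable_scaleR_right
        Bochner_Integration.integrable_diff)
  also have "circ_transform (\<lambda>z t. - conj_ker_t \<alpha> z t) g z = circ_transform (conj_ker \<alpha>) g' z"
    by (rule integrate_by_parts[where k="conj_ker \<alpha>", OF conj_ker_has_derivative_t[OF z] kt z])
        (simp add: conj_ker_def ker_def sqdist_def)
  finally show ?thesis .
qed

end

section \<open>Integral bounds for the kernels\<close>

text \<open>A crude form of Jordan's inequality, from the third-order Taylor bound.\<close>

lemma sin_ge_third: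
  fixes x :: real
  assumes "\<bar>x\<bar> \<le> 2"
  shows "\<bar>x\<bar> / 3 \<le> \<bar>sin x\<bar>"
proof -
  have "\<bar>sin x - (\<Sum>m<3. sin_coeff m * x ^ m)\<bar> \<le> inverse (fact 3) * \<bar>x\<bar> ^ 3"
    by (rule Maclaurin_sin_bound)
  moreover have "(\<Sum>m<3. sin_coeff m * x ^ m) = x"
    by (simp add: sin_coeff_def eval_nat_numeral)
  moreover have "\<bar>x\<bar> ^ 3 \<le> 4 * \<bar>x\<bar>"
    using assms mult_mono[of "\<bar>x\<bar>" 2 "\<bar>x\<bar>" 2] mult_right_mono[of "\<bar>x\<bar> * \<bar>x\<bar>" 4 "\<bar>x\<bar>"]
    by (simp add: power3_eq_cube)
  moreover have "\<bar>x\<bar> \<le> \<bar>sin x\<bar> + \<bar>sin x - x\<bar>" by linarith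
  ultimately show ?thesis by (simp add: fact_numeral)
qed

text \<open>The distance is at least \<open>1 - \<rho>\<close>, and at least \<open>|1 - cis s| - (1 - \<rho>)\<close>, where
  \<open>|1 - cis s| = 2 |sin (s/2)|\<close>.\<close>

lemma dist_one_cis_ge:
  assumes "0 \<le> \<rho>" "\<rho> \<le> 1" "\<bar>s\<bar> \<le> pi"
  shows "(1 - \<rho> + \<bar>s\<bar>) / 7 \<le> norm (1 - polar \<rho> s)"
proof -
  define X where "X = norm (1 - polar \<rho> s)"
  have 1: "1 - \<rho> \<le> X"
    using norm_triangle_ineq2[of 1 "polar \<rho> s"] assms by (simp add: X_def norm_mult)
  have "(norm (1 - cis s))\<^sup>2 = (2 * sin (s / 2))\<^sup>2"
  proof -
    have "cos s = 1 - 2 * (sin (s / 2))\<^sup>2" using cos_double_sin[of "s / 2"] by simp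
    moreover have "(norm (1 - cis s))\<^sup>2 = 2 - 2 * cos s"
      by (simp add: cmod_power2 sin_squared_eq power2_diff)
    ultimately show ?thesis by (simp add: power_mult_distrib)
  qed
  then have "norm (1 - cis s) = \<bar>2 * sin (s / 2)\<bar>"
    by (metis abs_norm_cancel power2_abs real_sqrt_abs)
  moreover have "\<bar>s / 2\<bar> / 3 \<le> \<bar>sin (s / 2)\<bar>"
    using assms pi_less_4 by (intro sin_ge_third) auto
  ultimately have "\<bar>s\<bar> / 3 \<le> norm (1 - cis s)" by (simp add: abs_mult)
  also have "1 - cis s = (1 - polar \<rho> s) - of_real (1 - \<rho>) * cis s" by (simp add: algebra_simps)
  also have "norm \<dots> \<le> X + (1 - \<rho>)"
    unfolding X_def using assms by (intro norm_triangle_le_diff) (simp add: norm_mult del: of_real_diff)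
  finally show ?thesis using 1 by (simp add: X_def)
qed

lemma sqdist_polar:
  "sqdist (polar \<rho> \<phi>) t = (norm (1 - polar \<rho> (\<phi> - t)))\<^sup>2"
proof -
  have "norm (cis t - polar \<rho> \<phi>) = norm (cis (- t) * (cis t - polar \<rho> \<phi>))"
    by (simp add: norm_mult)
  also have "cis (- t) * (cis t - polar \<rho> \<phi>) = 1 - polar \<rho> (\<phi> - t)"
    by (simp add: algebra_simps cis_mult)
  finally show ?thesis by (simp add: sqdist_eq_norm)
qed

lemma sqdist_swap: "sqdist (polar r \<theta>) t = sqdist (polar r t) \<theta>"
  by (simp add: sqdist_def power2_diff power_mult_distrib sin_squared_eq algebra_simps)

lemma integral_inverse_power_peak:
  assumes \<epsilon>: "\<epsilon> > 0" and b: "b > 1"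
  shows "integral {0..2*pi} (\<lambda>t. (\<epsilon> + \<bar>t - c\<bar>) powr - b) \<le> 2 * \<epsilon> powr (1 - b) / (b - 1)"
proof -
  \<comment> \<open>\<open>h\<close> is the antiderivative to the right of the peak that vanishes at the peak;
    \<open>H\<close> is its odd extension.\<close>
  define h where "h s = (\<epsilon> powr (1 - b) - (\<epsilon> + s) powr (1 - b)) / (b - 1)" for s
  define H where "H t = h (max (t - c) 0) - h (max (c - t) 0)" for t
  have dh: "(h has_real_derivative (\<epsilon> + s) powr - b) (at s)" if "s \<ge> 0" for s
    unfolding h_def using that \<epsilon> b
    by (auto intro!: derivative_eq_intros simp: divide_simps) (simp add: algebra_simps)
  have h0: "0 \<le> h s" "h s \<le> \<epsilon> powr (1 - b) / (b - 1)" if "s \<ge> 0" for s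
    using that \<epsilon> b unfolding h_def by (auto intro!: divide_right_mono divide_nonneg_pos powr_mono2')
  have "((\<lambda>t. (\<epsilon> + \<bar>t - c\<bar>) powr - b) has_integral (H (2*pi) - H 0)) {0..2*pi}"
  proof (rule fundamental_theorem_of_calculus_interior_strong[where S="{c}"])
    fix t assume "t \<in> {0<..<2*pi} - {c}"
    then consider "c < t" | "t < c" by force
    then show "(H has_vector_derivative (\<epsilon> + \<bar>t - c\<bar>) powr - b) (at t)"
    proof cases
      case 1
      have "((\<lambda>t. h (t - c)) has_real_derivative (\<epsilon> + (t - c)) powr - b * 1) (at t)"
        by (rule DERIV_chain2[OF dh]) (use 1 in \<open>auto intro!: derivative_eq_intros\<close>)
      then have "((\<lambda>t. h (t - c)) has_vector_derivative (\<epsilon> + \<bar>t - c\<bar>) powr - b) (at t)"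
        using 1 by (simp add: has_real_derivative_iff_has_vector_derivative)
      then show ?thesis
        by (rule has_vector_derivative_transform_within_open[where S="{c<..}"]) (use 1 in \<open>auto simp: H_def
            max_def h_def\<close>)
    next
      case 2
      have "((\<lambda>t. h (c - t)) has_real_derivative (\<epsilon> + (c - t)) powr - b * (- 1)) (at t)"
        by (rule DERIV_chain2[OF dh]) (use 2 in \<open>auto intro!: derivative_eq_intros\<close>)
      from DERIV_minus[OF this]
      have "((\<lambda>t. - h (c - t)) has_vector_derivative (\<epsilon> + \<bar>t - c\<bar>) powr - b) (at t)"
        using 2 by (simp add: has_real_derivative_iff_has_vector_derivative)
      then show ?thesis
        by (rule has_vector_derivative_transform_within_open[where S="{..<c}"]) (use 2 in \<open>auto simp: H_def
            max_def h_def\<close>)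
    qed
  next
    have "continuous_on {0..} h"
      using dh by (intro continuous_at_imp_continuous_on) (auto intro: DERIV_isCont)
    note hc = continuous_on_compose2[OF this]
    have "continuous_on {0..2*pi} (\<lambda>t. h (max (t - c) 0))"
      by (rule hc) (auto intro!: continuous_intros)
    moreover have "continuous_on {0..2*pi} (\<lambda>t. h (max (c - t) 0))"
      by (rule hc) (auto intro!: continuous_intros)
    ultimately show "continuous_on {0..2*pi} H"
      unfolding H_def by (rule continuous_on_diff)
  qed auto
  then have "integral {0..2*pi} (\<lambda>t. (\<epsilon> + \<bar>t - c\<bar>) powr - b) = H (2*pi) - H 0" by (rule integral_unique)
  also have "\<dots> \<le> 2 * (\<epsilon> powr (1 - b) / (b - 1))"
    unfolding H_def using h0[of "max (2*pi - c) 0"] h0[of "max (c - 2*pi) 0"] h0[of "max (0 - c) 0"]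
        h0[of "max (c - 0) 0"]
    by linarith
  finally show ?thesis by simp
qed

text \<open>The distance of \<open>z\<close> from \<open>cis t\<close> is at least a constant times \<open>\<epsilon> + |t - Arg z|\<close> with
  \<open>\<epsilon> = 1 - |z|\<close> and angles modulo \<open>2 \<pi>\<close>. Hence the second factor of the kernel has an integral
  of order at most \<open>\<epsilon> powr (1 - 2 \<gamma>)\<close>, and the first factor is of order \<open>\<epsilon> powr (2 \<gamma> - 1)\<close>.\<close>

lemma ker_critical_integral_bound:
  assumes \<gamma>: "\<gamma> > 1 / 2"
  obtains m where "\<And>z. norm z < 1 \<Longrightarrow> (LINT t|circ. ker (2 * \<gamma> - 1) \<gamma> z t) \<le> m"
proof -
  define m where "m = 2 powr (2 * \<gamma> - 1) * (7 powr (2 * \<gamma>) * (4 / (2 * \<gamma> - 1)))"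
  have "(LINT t|circ. ker (2 * \<gamma> - 1) \<gamma> z t) \<le> m" if z: "norm z < 1" for z
  proof -
    define \<epsilon> where "\<epsilon> = 1 - norm z"
    have \<epsilon>: "\<epsilon> > 0" using z by (simp add: \<epsilon>_def)
    define u where "u c t = (\<epsilon> + \<bar>t - c\<bar>) powr - (2 * \<gamma>)" for c t :: real
    have uc: "continuous_on {0..2*pi} (u c)" for c
      unfolding u_def using \<epsilon> by (intro continuous_intros) (auto simp: add_pos_nonneg less_imp_neq[symmetric])
    have zp: "z = of_real (norm z) * cis (Arg z)" using rcis_cmod_Arg[of z] by (simp add: rcis_def)
    have pt: "sqdist z t powr - \<gamma> \<le> 7 powr (2 * \<gamma>) * (u (Arg z) t + u (Arg z + 2 * pi) t)"
      if t: "t \<in> {0..2*pi}" for t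
    proof -
      have key: "sqdist z t powr - \<gamma> \<le> 7 powr (2 * \<gamma>) * (\<epsilon> + \<bar>s\<bar>) powr - (2 * \<gamma>)"
        if s: "\<bar>s\<bar> \<le> pi" "cis s = cis (Arg z - t)" for s
      proof -
        define X where "X = norm (1 - of_real (norm z) * cis s)"
        have X: "(\<epsilon> + \<bar>s\<bar>) / 7 \<le> X"
          unfolding X_def \<epsilon>_def using z s(1) by (intro dist_one_cis_ge) auto
        have "0 < (\<epsilon> + \<bar>s\<bar>) / 7" using \<epsilon> by simp
        with X have "X > 0" by linarith
        moreover have "sqdist z t = X\<^sup>2"
          using sqdist_polar[of "norm z" "Arg z" t] unfolding X_def s(2) zp[symmetric] .
        ultimately have D: "sqdist z t = X powr 2" by simp
        have "sqdist z t powr - \<gamma> = X powr - (2 * \<gamma>)" unfolding D powr_powr by simp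
        also have "\<dots> \<le> ((\<epsilon> + \<bar>s\<bar>) / 7) powr - (2 * \<gamma>)"
          using X \<gamma> \<epsilon> by (intro powr_mono2') (auto simp: add_pos_nonneg)
        also have "\<dots> = 7 powr (2 * \<gamma>) * (\<epsilon> + \<bar>s\<bar>) powr - (2 * \<gamma>)"
          using \<epsilon> by (simp add: powr_divide powr_minus divide_simps)
        finally show ?thesis .
      qed
      \<comment> \<open>\<open>Arg z - t\<close> lies between \<open>- 3 \<pi>\<close> and
        \<open>\<pi>\<close>, so it is within \<open>\<pi>\<close> of \<open>0\<close> or of
        \<open>- 2 \<pi>\<close>.\<close>
      have A: "- pi < Arg z" "Arg z \<le> pi" using Arg_bounded[of z] by auto
      have nn: "0 \<le> u c t" for c by (simp add: u_def)
      show ?thesis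
      proof (cases "t \<le> Arg z + pi")
        case True
        have "sqdist z t powr - \<gamma> \<le> 7 powr (2 * \<gamma>) * u (Arg z) t"
          unfolding u_def abs_minus_commute[of t] using True A t by (intro key) auto
        then show ?thesis using nn[of "Arg z + 2 * pi"]
          by (smt (verit) distrib_left mult_nonneg_nonneg powr_ge_zero)
      next
        case False
        have "sqdist z t powr - \<gamma> \<le> 7 powr (2 * \<gamma>) * u (Arg z + 2 * pi) t"
          unfolding u_def abs_minus_commute[of t]
        proof (intro key)
          have "Arg z + 2 * pi - t = (Arg z - t) + 2 * pi" by simp
          then show "cis (Arg z + 2 * pi - t) = cis (Arg z - t)" by (simp only: cis_mult[symmetric] cis_2pi)
              simp
        qed (use False A t in auto)
        then show ?thesis using nn[of "Arg z"]
          by (smt (verit) distrib_left mult_nonneg_nonneg powr_ge_zero)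
      qed
    qed
    have ki: "integrable circ (\<lambda>t. sqdist z t powr - \<gamma>)"
    proof (intro continuous_imp_integrable_real continuous_intros)
      show "continuous_on {0..2*pi} (sqdist z)" unfolding sqdist_def by (intro continuous_intros)
    qed (use sqdist_pos[OF z] in \<open>auto simp: less_imp_neq[symmetric]\<close>)
    have ui: "integrable circ (u c)" for c by (intro continuous_imp_integrable_real uc)
    have uI: "(LINT t|circ. u c t) \<le> 2 * \<epsilon> powr (1 - 2 * \<gamma>) / (2 * \<gamma> - 1)" for c
      using integral_inverse_power_peak[OF \<epsilon>, of "2 * \<gamma>" c] \<gamma> lebesgue_integral_eq_integral[OF ui[of c]]
      by (simp add: u_def[abs_def])
    have "(LINT t|circ. sqdist z t powr - \<gamma>) \<le> (LINT t|circ. 7 powr (2 * \<gamma>) * (u (Arg z) t + u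
        (Arg z + 2 * pi) t))"
      using pt by (intro integral_mono ki) (auto intro!: ui)
    also have "\<dots> = 7 powr (2 * \<gamma>) * ((LINT t|circ. u (Arg z) t) + (LINT t|circ. u (Arg z + 2 * pi) t))"
      using ui by simp
    also have "\<dots> \<le> 7 powr (2 * \<gamma>) * (2 * \<epsilon> powr (1 - 2 * \<gamma>) / (2 * \<gamma> - 1) + 2 * \<epsilon> powr (1 - 2 * \<gamma>) /
        (2 * \<gamma> - 1))"
      by (intro mult_left_mono add_mono uI) auto
    also have "\<dots> = 7 powr (2 * \<gamma>) * (4 / (2 * \<gamma> - 1)) * \<epsilon> powr (1 - 2 * \<gamma>)" by (simp add: field_simps)
    finally have I: "(LINT t|circ. sqdist z t powr - \<gamma>) \<le> 7 powr (2 * \<gamma>) * (4 / (2 * \<gamma> - 1)) * \<epsilon> powr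
        (1 - 2 * \<gamma>)" .
    have "1 - (norm z)\<^sup>2 = \<epsilon> * (1 + norm z)" by (simp add: \<epsilon>_def power2_eq_square algebra_simps)
    then have "(1 - (norm z)\<^sup>2) powr (2 * \<gamma> - 1) = \<epsilon> powr (2 * \<gamma> - 1) * (1 + norm z) powr (2 * \<gamma> - 1)"
      using \<epsilon> by (simp add: powr_mult)
    also have "\<dots> \<le> \<epsilon> powr (2 * \<gamma> - 1) * 2 powr (2 * \<gamma> - 1)"
      using z \<gamma> by (intro mult_left_mono powr_mono2) auto
    finally have "(1 - (norm z)\<^sup>2) powr (2 * \<gamma> - 1) \<le> 2 powr (2 * \<gamma> - 1) * \<epsilon> powr (2 * \<gamma> - 1)" by
        (simp add: mult.commute)
    then have "(1 - (norm z)\<^sup>2) powr (2 * \<gamma> - 1) * (LINT t|circ. sqdist z t powr - \<gamma>)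
       \<le> (2 powr (2 * \<gamma> - 1) * \<epsilon> powr (2 * \<gamma> - 1)) * (7 powr (2 * \<gamma>) * (4 / (2 * \<gamma> - 1)) * \<epsilon> powr
           (1 - 2 * \<gamma>))"
      using I by (intro mult_mono) (auto intro!: integral_nonneg_AE)
    also have "\<dots> = m * (\<epsilon> powr (2 * \<gamma> - 1) * \<epsilon> powr (1 - 2 * \<gamma>))" by (simp add: m_def)
    also have "\<epsilon> powr (2 * \<gamma> - 1) * \<epsilon> powr (1 - 2 * \<gamma>) = 1" using \<epsilon> by (simp add: powr_add[symmetric])
    finally show ?thesis by (simp add: ker_def)
  qed
  then show ?thesis by (rule that)
qed

section \<open>Integral means of kernel transforms\<close>

lemma convex_power_tangent:
  fixes x y q :: real
  assumes "q \<ge> 1" "x \<ge> 0" "y > 0"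
  shows "q * y powr (q - 1) * x - (q - 1) * y powr q \<le> x powr q"
proof (cases "q = 1")
  case True then show ?thesis using assms by simp
next
  case False
  define q' where "q' = q / (q - 1)"
  have q: "q > 1" "q' > 1" "1 / q + 1 / q' = 1" using False assms by (auto simp: q'_def field_simps)
  have "x * y powr (q - 1) \<le> x powr q / q + (y powr (q - 1)) powr q' / q'"
    by (rule Youngs_inequality) (use q assms in auto)
  also have "(y powr (q - 1)) powr q' = y powr q" using q by (simp add: powr_powr q'_def)
  also have "y powr q / q' = (q - 1) * y powr q / q" using q by (simp add: q'_def)
  finally show ?thesis using q by (simp add: field_simps)
qed

text \<open>Jensen's inequality for \<open>x powr q\<close> and a weight of total mass at most \<open>m\<close>: integrate the
  tangent inequality at \<open>y = (LINT x|M. w x * h x) / m\<close> against \<open>w\<close>.\<close>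

lemma weighted_power_mean:
  fixes w h :: "'a \<Rightarrow> real"
  assumes q: "q \<ge> 1" and w: "\<And>x. w x \<ge> 0" and h: "\<And>x. h x \<ge> 0"
    and i: "integrable M w" "integrable M (\<lambda>x. w x * h x)" "integrable M (\<lambda>x. w x * h x powr q)"
    and m: "integral\<^sup>L M w \<le> m" "m > 0"
  shows "(LINT x|M. w x * h x) powr q \<le> m powr (q - 1) * (LINT x|M. w x * h x powr q)"
proof (cases "(LINT x|M. w x * h x) = 0")
  case True
  then show ?thesis using q w by (auto intro!: mult_nonneg_nonneg integral_nonneg_AE)
next
  case False
  define S where "S = (LINT x|M. w x * h x)"
  have "S \<ge> 0" unfolding S_def using w h by (intro integral_nonneg_AE) auto
  with False have S: "S > 0" by (simp add: S_def)
  define y where "y = S / m"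
  have y: "y > 0" using S m by (simp add: y_def)
  have "(q * y powr (q - 1)) * S - ((q - 1) * y powr q) * integral\<^sup>L M w =
      (LINT x|M. (q * y powr (q - 1)) * (w x * h x) - ((q - 1) * y powr q) * w x)"
    using i by (simp add: S_def)
  also have "\<dots> \<le> (LINT x|M. w x * h x powr q)"
  proof (intro integral_mono Bochner_Integration.integrable_diff integrable_mult_right i)
    fix x
    have "w x * (q * y powr (q - 1) * h x - (q - 1) * y powr q) \<le> w x * h x powr q"
      using convex_power_tangent[OF q h y] w by (intro mult_left_mono) auto
    then show "(q * y powr (q - 1)) * (w x * h x) - ((q - 1) * y powr q) * w x \<le> w x * h x powr q"
      by (simp add: algebra_simps)
  qed
  finally have 1: "(q * y powr (q - 1)) * S - ((q - 1) * y powr q) * integral\<^sup>L M w \<le> (LINT x|M. w x * h x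
      powr q)" .
  have Sm: "S = y * m" using m by (simp add: y_def)
  have yy: "y powr (q - 1) * y = y powr q" using y by (simp add: powr_mult_base powr_diff)
  have "((q - 1) * y powr q) * integral\<^sup>L M w \<le> ((q - 1) * y powr q) * m"
    using q m by (intro mult_left_mono) auto
  with 1 have "q * (y powr (q - 1) * y) * m - ((q - 1) * y powr q) * m \<le> (LINT x|M. w x * h x powr q)"
    by (simp add: Sm mult_ac)
  then have "y powr q * m \<le> (LINT x|M. w x * h x powr q)" unfolding yy by (simp add: algebra_simps)
  then have "m powr (q - 1) * (y powr q * m) \<le> m powr (q - 1) * (LINT x|M. w x * h x powr q)"
    by (intro mult_left_mono) auto
  moreover have "m powr (q - 1) * (y powr q * m) = S powr q"
    using m y by (simp add: Sm powr_mult powr_diff)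
  ultimately show ?thesis by (simp add: S_def)
qed

lemma circ_finite_measure: "finite_measure circ" by (intro finite_measure_lebesgue_on) auto

lemma measurable_circ_continuous:
  fixes f :: "real \<Rightarrow> 'b::euclidean_space"
  shows "continuous_on {0..2*pi} f \<Longrightarrow> f \<in> borel_measurable circ"
  by (rule continuous_imp_measurable_on_sets_lebesgue) auto

lemma measurable_circ_pair_continuous:
  fixes h :: "real \<times> real \<Rightarrow> 'b::topological_space"
  assumes "continuous_on UNIV h"
  shows "h \<in> borel_measurable (circ \<Otimes>\<^sub>M circ)"
proof -
  have id: "(\<lambda>x. x) \<in> measurable circ borel" using measurable_circ_continuous[of "\<lambda>x. x"] by simp
  have "(\<lambda>p. (fst p, snd p)) \<in> measurable (circ \<Otimes>\<^sub>M circ) (borel \<Otimes>\<^sub>M borel)"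
    by (intro measurable_Pair measurable_compose[OF measurable_fst id] measurable_compose[OF measurable_snd
        id])
  then have "(\<lambda>p. p) \<in> measurable (circ \<Otimes>\<^sub>M circ) (borel :: (real \<times> real) measure)"
    by (simp add: borel_prod)
  from measurable_compose[OF this borel_measurable_continuous_onI[OF assms]] show ?thesis by simp
qed

lemma disc_kernel_polar_continuous:
  assumes "disc_kernel k" "0 \<le> r" "r < 1"
  shows "continuous_on UNIV (\<lambda>(\<theta>, t). k (polar r \<theta>) t)"
  unfolding case_prod_beta
  by (intro disc_kernel_compose[OF assms(1)] continuous_intros) (use assms in \<open>auto simp: norm_mult\<close>)

lemma norm_polar: "0 \<le> r \<Longrightarrow> norm (polar r \<theta>) = r"
  by (simp add: norm_mult)

definition Lp_arc :: "ereal \<Rightarrow> (real \<Rightarrow> complex) \<Rightarrow> bool" where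
  "Lp_arc p G \<longleftrightarrow> G \<in> borel_measurable circ \<and>
     (if p = \<infinity> then \<exists>C::real. AE t in circ. norm (G t) \<le> C
      else integrable circ (\<lambda>t. norm (G t) powr real_of_ereal p))"

lemma Lp_circle_eq: "Lp_circle p H \<longleftrightarrow> Lp_arc p (\<lambda>t. H (cis t))"
  by (simp add: Lp_circle_def Lp_arc_def)

lemma power_integrable_imp_integrable:
  fixes G :: "real \<Rightarrow> complex"
  assumes G: "G \<in> borel_measurable circ" and q: "q \<ge> 1" and i: "integrable circ (\<lambda>t. norm (G t) powr q)"
  shows "integrable circ G"
proof (rule Bochner_Integration.integrable_bound[OF _ G])
  interpret finite_measure circ by (rule circ_finite_measure)
  show "integrable circ (\<lambda>t. 1 + norm (G t) powr q)" using i by simp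
  show "AE t in circ. norm (G t) \<le> norm (1 + norm (G t) powr q)"
  proof (intro AE_I2)
    fix t
    have "norm (G t) \<le> 1 + norm (G t) powr q"
    proof (cases "norm (G t) \<le> 1")
      case False
      then have "norm (G t) powr 1 \<le> norm (G t) powr q" using q by (intro powr_mono) auto
      with False show ?thesis by simp
    qed (simp add: add.commute add_increasing2)
    then show "norm (G t) \<le> norm (1 + norm (G t) powr q)" by simp
  qed
qed

lemma real_exponent:
  fixes p :: ereal
  assumes "1 \<le> p" "p \<noteq> \<infinity>"
  shows "1 \<le> real_of_ereal p"
  using assms by (cases p) auto

lemma Lp_arc_integrable:
  assumes "Lp_arc p G" "1 \<le> p"
  shows "integrable circ G"
proof (cases "p = \<infinity>")
  case True
  then obtain C where "G \<in> borel_measurable circ" "AE t in circ. norm (G t) \<le> C"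
    using assms by (auto simp: Lp_arc_def)
  then show ?thesis by (intro finite_measure.integrable_const_bound[OF circ_finite_measure])
next
  case False
  then have "G \<in> borel_measurable circ" "integrable circ (\<lambda>t. norm (G t) powr real_of_ereal p)"
    using assms(1) by (simp_all add: Lp_arc_def)
  then show ?thesis by (rule power_integrable_imp_integrable[OF _ real_exponent[OF assms(2) False]])
qed

lemma Lp_arc_continuous:
  assumes "continuous_on {0..2*pi} G" "1 \<le> p"
  shows "Lp_arc p G"
proof -
  have "bounded (G ` {0..2*pi})"
    using assms by (auto intro!: compact_imp_bounded compact_continuous_image)
  then obtain C where C: "\<And>t. t \<in> {0..2*pi} \<Longrightarrow> norm (G t) \<le> C" unfolding bounded_iff by (metis imageI)
  have "continuous_on {0..2*pi} (\<lambda>t. norm (G t) powr real_of_ereal p)" if "p \<noteq> \<infinity>"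
    using real_exponent[OF assms(2) that] assms(1)
    by (intro continuous_on_powr' continuous_intros) auto
  then show ?thesis
    unfolding Lp_arc_def using C measurable_circ_continuous[OF assms(1)]
    by (auto intro!: continuous_imp_integrable_real exI[of _ C] AE_I2)
qed

text \<open>The hypotheses of the Schur test. By \<open>swap\<close>, the bound \<open>m\<close> on the integrals in \<open>t\<close> also
  bounds the integrals over every circle with centre \<open>0\<close>.\<close>

locale schur_kernel =
  fixes k :: "complex \<Rightarrow> real \<Rightarrow> real" and m :: real
  assumes k: "disc_kernel k"
    and swap: "\<And>r \<theta> t. 0 \<le> r \<Longrightarrow> r < 1 \<Longrightarrow> \<bar>k (polar r \<theta>) t\<bar> = \<bar>k (polar r t) \<theta>\<bar>"
    and m: "\<And>z. norm z < 1 \<Longrightarrow> (LINT t|circ. \<bar>k z t\<bar>) \<le> m"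
    and m0: "m > 0"
begin

lemma k_cont: "norm z < 1 \<Longrightarrow> continuous_on {0..2*pi} (\<lambda>t. \<bar>k z t\<bar>)"
  by (intro continuous_intros disc_kernel_compose[OF k]) auto

lemma k_integrable: "norm z < 1 \<Longrightarrow> integrable circ (\<lambda>t. \<bar>k z t\<bar>)"
  by (intro continuous_imp_integrable_real k_cont)

lemma times_k_integrable:
  fixes h :: "real \<Rightarrow> real"
  shows "norm z < 1 \<Longrightarrow> integrable circ h \<Longrightarrow> integrable circ (\<lambda>t. \<bar>k z t\<bar> * h t)"
  using integrable_continuous_scaleR[OF k_cont, of z h] by simp

lemma norm_transform_le: "norm (circ_transform k G z) \<le> (LINT t|circ. \<bar>k z t\<bar> * norm (G t))"
  unfolding circ_transform_def using integral_norm_bound[of circ "\<lambda>t. k z t *\<^sub>R G t"] by simp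

lemma transform_power_bound:
  assumes G: "G \<in> borel_measurable circ" and q: "q \<ge> 1" and i: "integrable circ (\<lambda>t. norm (G t) powr q)"
    and r: "0 \<le> r" "r < 1"
  shows "(\<integral>\<^sup>+\<theta>. ennreal (norm (circ_transform k G (polar r \<theta>)) powr q) \<partial>circ)
    \<le> ennreal (m powr q * (LINT t|circ. norm (G t) powr q))"
proof -
  interpret finite_measure circ by (rule circ_finite_measure)
  interpret pair_sigma_finite circ circ ..
  let ?w = "\<lambda>\<theta> t. \<bar>k (polar r \<theta>) t\<bar>"
  have z: "norm (polar r \<theta>) < 1" for \<theta> using r by (simp add: norm_polar)
  have iG: "integrable circ (\<lambda>t. norm (G t))" using power_integrable_imp_integrable[OF G q i] by simp
  have wm: "(\<lambda>p. ?w (fst p) (snd p)) \<in> borel_measurable (circ \<Otimes>\<^sub>M circ)"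
    using disc_kernel_polar_continuous[OF k r]
    by (intro measurable_circ_pair_continuous continuous_intros) (simp add: case_prod_beta)
  have wm1: "(\<lambda>\<theta>. ?w \<theta> t) \<in> borel_measurable circ" for t
    by (intro measurable_circ_continuous continuous_intros disc_kernel_compose[OF k] z)
  have hm: "(\<lambda>t. norm (G t) powr q) \<in> borel_measurable circ" using G by measurable
  have "(\<integral>\<^sup>+\<theta>. ennreal (norm (circ_transform k G (polar r \<theta>)) powr q) \<partial>circ)
     \<le> (\<integral>\<^sup>+\<theta>. ennreal (m powr (q - 1)) * (\<integral>\<^sup>+t. ennreal (?w \<theta> t * norm (G t) powr q) \<partial>circ) \<partial>circ)"
  proof (intro nn_integral_mono)
    fix \<theta>
    have "norm (circ_transform k G (polar r \<theta>)) powr q \<le> (LINT t|circ. ?w \<theta> t * norm (G t)) powr q"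
      using norm_transform_le q by (intro powr_mono2) auto
    also have "\<dots> \<le> m powr (q - 1) * (LINT t|circ. ?w \<theta> t * norm (G t) powr q)"
      by (rule weighted_power_mean[OF q]) (use times_k_integrable[OF z] k_integrable[OF z] iG i m[OF z] m0
          in auto)
    finally have "ennreal (norm (circ_transform k G (polar r \<theta>)) powr q)
       \<le> ennreal (m powr (q - 1) * (LINT t|circ. ?w \<theta> t * norm (G t) powr q))" by (rule ennreal_leI)
    also have "\<dots> = ennreal (m powr (q - 1)) * ennreal (LINT t|circ. ?w \<theta> t * norm (G t) powr q)"
      by (rule ennreal_mult) (auto intro!: integral_nonneg_AE)
    also have "ennreal (LINT t|circ. ?w \<theta> t * norm (G t) powr q) = (\<integral>\<^sup>+t. ennreal (?w \<theta> t * norm (G t) powr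
        q) \<partial>circ)"
      by (rule nn_integral_eq_integral[symmetric]) (use times_k_integrable[OF z i] in auto)
    finally show "ennreal (norm (circ_transform k G (polar r \<theta>)) powr q)
       \<le> ennreal (m powr (q - 1)) * (\<integral>\<^sup>+t. ennreal (?w \<theta> t * norm (G t) powr q) \<partial>circ)" .
  qed
  also have "\<dots> = ennreal (m powr (q - 1)) * (\<integral>\<^sup>+\<theta>. \<integral>\<^sup>+t. ennreal (?w \<theta> t * norm (G t) powr q) \<partial>circ \<partial>circ)"
    using wm hm by (intro nn_integral_cmult borel_measurable_nn_integral) (simp add: case_prod_beta)
  also have "(\<integral>\<^sup>+\<theta>. \<integral>\<^sup>+t. ennreal (?w \<theta> t * norm (G t) powr q) \<partial>circ \<partial>circ) =
      (\<integral>\<^sup>+t. \<integral>\<^sup>+\<theta>. ennreal (?w \<theta> t * norm (G t) powr q) \<partial>circ \<partial>circ)"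
    using wm hm by (intro Fubini'[symmetric]) (simp add: case_prod_beta)
  also have "\<dots> \<le> (\<integral>\<^sup>+t. ennreal m * ennreal (norm (G t) powr q) \<partial>circ)"
  proof (intro nn_integral_mono)
    fix t
    have "(\<integral>\<^sup>+\<theta>. ennreal (?w \<theta> t * norm (G t) powr q) \<partial>circ) = (\<integral>\<^sup>+\<theta>. ennreal (?w \<theta> t) * ennreal
        (norm (G t) powr q) \<partial>circ)"
      by (simp add: ennreal_mult)
    also have "\<dots> = (\<integral>\<^sup>+\<theta>. ennreal (?w \<theta> t) \<partial>circ) * ennreal (norm (G t) powr q)"
      using wm1 by (intro nn_integral_multc) auto
    also have "(\<integral>\<^sup>+\<theta>. ennreal (?w \<theta> t) \<partial>circ) = (\<integral>\<^sup>+\<theta>. ennreal \<bar>k (polar r t) \<theta>\<bar> \<partial>circ)"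
      using swap[OF r] by simp
    also have "\<dots> = ennreal (LINT \<theta>|circ. \<bar>k (polar r t) \<theta>\<bar>)"
      by (rule nn_integral_eq_integral) (use k_integrable[OF z] in auto)
    also have "\<dots> * ennreal (norm (G t) powr q) \<le> ennreal m * ennreal (norm (G t) powr q)"
      using m[OF z] by (intro mult_right_mono ennreal_leI) auto
    finally show "(\<integral>\<^sup>+\<theta>. ennreal (?w \<theta> t * norm (G t) powr q) \<partial>circ) \<le> ennreal m * ennreal (norm (G t) powr
        q)" .
  qed
  also have "\<dots> = ennreal m * ennreal (LINT t|circ. norm (G t) powr q)"
    using hm by (simp add: nn_integral_cmult nn_integral_eq_integral[OF i])
  finally have "(\<integral>\<^sup>+\<theta>. ennreal (norm (circ_transform k G (polar r \<theta>)) powr q) \<partial>circ)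
     \<le> ennreal (m powr (q - 1)) * (ennreal m * ennreal (LINT t|circ. norm (G t) powr q))"
    by (simp add: mult_left_mono)
  also have "\<dots> = ennreal (m powr (q - 1) * m * (LINT t|circ. norm (G t) powr q))"
    using m0 by (simp add: ennreal_mult[symmetric] mult.assoc)
  also have "m powr (q - 1) * m = m powr q" using m0 by (simp add: powr_diff)
  finally show ?thesis .
qed

end

text \<open>The condition on the supremum in the Hardy type space by itself. The outer power \<open>1/p\<close> is
  dropped, as it does not affect finiteness.\<close>

definition mean_bounded :: "ereal \<Rightarrow> (complex \<Rightarrow> complex) \<Rightarrow> bool" where
  "mean_bounded p g \<longleftrightarrow>
     (if p = \<infinity> then \<exists>C. \<forall>z\<in>ball 0 1. norm (g z) \<le> C
      else \<exists>C::real. \<forall>r\<in>{0..<1}. (\<integral>\<^sup>+\<theta>. ennreal (norm (g (polar r \<theta>)) powr real_of_ereal p) \<partial>circ) \<le> ennreal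
          C)"

lemma (in schur_kernel) mean_bounded_transform:
  assumes p: "1 \<le> p" and G: "Lp_arc p G"
  shows "mean_bounded p (circ_transform k G)"
proof (cases "p = \<infinity>")
  case False
  then show ?thesis
    using transform_power_bound[of G "real_of_ereal p"] G real_exponent[OF p False]
    unfolding mean_bounded_def Lp_arc_def
    by (simp, intro exI[of _ "m powr real_of_ereal p * (LINT t|circ. norm (G t) powr real_of_ereal p)"]) auto
next
  case True
  then obtain C where C: "AE t in circ. norm (G t) \<le> C" using G by (auto simp: Lp_arc_def)
  have iG: "integrable circ (\<lambda>t. norm (G t))" using Lp_arc_integrable[OF G p] by simp
  have "norm (circ_transform k G z) \<le> m * \<bar>C\<bar>" if z: "norm z < 1" for z
  proof -
    have "norm (circ_transform k G z) \<le> (LINT t|circ. \<bar>k z t\<bar> * norm (G t))" by (rule norm_transform_le)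
    also have "\<dots> \<le> (LINT t|circ. \<bar>k z t\<bar> * \<bar>C\<bar>)"
      using C by (intro integral_mono_AE times_k_integrable z iG integrable_mult_left k_integrable)
        (auto elim!: eventually_mono intro!: mult_left_mono)
    also have "\<dots> = (LINT t|circ. \<bar>k z t\<bar>) * \<bar>C\<bar>" by simp
    also have "\<dots> \<le> m * \<bar>C\<bar>" by (intro mult_right_mono m z) auto
    finally show ?thesis .
  qed
  then have "\<forall>z\<in>ball 0 1. norm (circ_transform k G z) \<le> m * \<bar>C\<bar>" by simp
  with True show ?thesis unfolding mean_bounded_def by metis
qed

lemma mean_bounded_dominated:
  assumes p: "1 \<le> p" and h: "mean_bounded p h1" "mean_bounded p h2"
    and c: "continuous_on (ball 0 1) h1" "continuous_on (ball 0 1) h2"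
    and le: "\<And>z. norm z < 1 \<Longrightarrow> norm (g z) \<le> A * (norm (h1 z) + norm (h2 z) + 1)"
  shows "mean_bounded p g"
proof (cases "p = \<infinity>")
  case True
  with h obtain C1 C2 where C: "\<And>z. norm z < 1 \<Longrightarrow> norm (h1 z) \<le> C1" "\<And>z. norm z < 1 \<Longrightarrow> norm (h2 z) \<le> C2"
    using True unfolding mean_bounded_def by (metis dist_0_norm mem_ball)
  have "norm (g z) \<le> \<bar>A\<bar> * (C1 + C2 + 1)" if "norm z < 1" for z
  proof -
    have "norm (g z) \<le> \<bar>A\<bar> * (norm (h1 z) + norm (h2 z) + 1)"
      using le[OF that] by (rule order_trans) (intro mult_right_mono, auto)
    also have "\<dots> \<le> \<bar>A\<bar> * (C1 + C2 + 1)" using C[OF that] by (intro mult_left_mono) auto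
    finally show ?thesis .
  qed
  then have "\<forall>z\<in>ball 0 1. norm (g z) \<le> \<bar>A\<bar> * (C1 + C2 + 1)" by simp
  with True show ?thesis unfolding mean_bounded_def by metis
next
  case False
  define q where "q = real_of_ereal p"
  have q: "q \<ge> 1" using real_exponent[OF p False] by (simp add: q_def)
  from h False obtain C1 C2 :: real where
    C: "\<And>r. r \<in> {0..<1} \<Longrightarrow> (\<integral>\<^sup>+\<theta>. ennreal (norm (h1 (polar r \<theta>)) powr q) \<partial>circ) \<le> ennreal C1"
       "\<And>r. r \<in> {0..<1} \<Longrightarrow> (\<integral>\<^sup>+\<theta>. ennreal (norm (h2 (polar r \<theta>)) powr q) \<partial>circ) \<le> ennreal C2"
    unfolding mean_bounded_def q_def by metis
  define A3 where "A3 = (3 * \<bar>A\<bar>) powr q"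
  have pt: "norm (g z) powr q \<le> A3 * (norm (h1 z) powr q + norm (h2 z) powr q + 1)" if z: "norm z < 1" for z
  proof -
    define M where "M = max (norm (h1 z)) (max (norm (h2 z)) 1)"
    have "norm (g z) \<le> \<bar>A\<bar> * (norm (h1 z) + norm (h2 z) + 1)"
      using le[OF z] by (rule order_trans) (intro mult_right_mono, auto)
    also have "\<dots> \<le> \<bar>A\<bar> * (3 * M)" by (intro mult_left_mono) (auto simp: M_def)
    finally have "norm (g z) powr q \<le> (3 * \<bar>A\<bar> * M) powr q" using q by (intro powr_mono2) (auto simp: mult_ac)
    also have "\<dots> = A3 * M powr q" by (simp add: A3_def powr_mult)
    also have "M powr q \<le> norm (h1 z) powr q + norm (h2 z) powr q + 1"
      by (auto simp: M_def max_def add_nonneg_nonneg add_increasing add_increasing2)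
    finally show ?thesis by (simp add: A3_def mult_left_mono)
  qed
  have "(\<integral>\<^sup>+\<theta>. ennreal (norm (g (polar r \<theta>)) powr q) \<partial>circ) \<le> ennreal (A3 * (\<bar>C1\<bar> + \<bar>C2\<bar> + 2 * pi))"
    if r: "r \<in> {0..<1}" for r
  proof -
    let ?z = "polar r"
    have z: "norm (?z \<theta>) < 1" for \<theta> using r by (simp add: norm_polar)
    have "continuous_on {0..2*pi} (\<lambda>\<theta>. h1 (?z \<theta>))"
      by (rule continuous_on_compose2[OF c(1)]) (use z in \<open>auto intro!: continuous_intros\<close>)
    then have [measurable]: "(\<lambda>\<theta>. h1 (?z \<theta>)) \<in> borel_measurable circ" by (rule measurable_circ_continuous)
    have "continuous_on {0..2*pi} (\<lambda>\<theta>. h2 (?z \<theta>))"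
      by (rule continuous_on_compose2[OF c(2)]) (use z in \<open>auto intro!: continuous_intros\<close>)
    then have [measurable]: "(\<lambda>\<theta>. h2 (?z \<theta>)) \<in> borel_measurable circ" by (rule measurable_circ_continuous)
    have meas: "(\<lambda>\<theta>. norm (h1 (?z \<theta>)) powr q) \<in> borel_measurable circ" "(\<lambda>\<theta>. norm (h2 (?z \<theta>)) powr q) \<in>
        borel_measurable circ"
      by measurable
    have "(\<integral>\<^sup>+\<theta>. ennreal (norm (g (?z \<theta>)) powr q) \<partial>circ) \<le>
      (\<integral>\<^sup>+\<theta>. ennreal A3 * (ennreal (norm (h1 (?z \<theta>)) powr q) + ennreal (norm (h2 (?z \<theta>)) powr q) + 1) \<partial>circ)"
    proof (intro nn_integral_mono)
      fix \<theta>
      have "ennreal (norm (g (?z \<theta>)) powr q) \<le> ennreal (A3 * (norm (h1 (?z \<theta>)) powr q + norm (h2 (?z \<theta>))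
          powr q + 1))"
        by (intro ennreal_leI pt z)
      also have "\<dots> = ennreal A3 * (ennreal (norm (h1 (?z \<theta>)) powr q) + ennreal (norm (h2 (?z \<theta>)) powr q) + 1)"
        by (simp add: A3_def ennreal_mult ennreal_plus)
      finally show "ennreal (norm (g (?z \<theta>)) powr q) \<le> ennreal A3 * (ennreal (norm (h1 (?z \<theta>)) powr q) +
          ennreal (norm (h2 (?z \<theta>)) powr q) + 1)" .
    qed
    also have "\<dots> = ennreal A3 * ((\<integral>\<^sup>+\<theta>. ennreal (norm (h1 (?z \<theta>)) powr q) \<partial>circ)
        + (\<integral>\<^sup>+\<theta>. ennreal (norm (h2 (?z \<theta>)) powr q) \<partial>circ) + emeasure circ (space circ))"
      using meas by (simp add: nn_integral_cmult nn_integral_add)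
    also have "\<dots> \<le> ennreal A3 * (ennreal \<bar>C1\<bar> + ennreal \<bar>C2\<bar> + ennreal (2 * pi))"
      using C[OF r]
      by (intro mult_left_mono add_mono order_trans[OF C(1)[OF r]] order_trans[OF C(2)[OF r]] ennreal_leI)
        (auto simp: emeasure_restrict_space)
    also have "\<dots> = ennreal (A3 * (\<bar>C1\<bar> + \<bar>C2\<bar> + 2 * pi))"
      by (simp add: A3_def ennreal_mult ennreal_plus)
    finally show ?thesis .
  qed
  with False show ?thesis unfolding mean_bounded_def q_def by metis
qed

lemma hardy_spaceI:
  assumes p: "1 \<le> p" and m: "g \<in> borel_measurable (restrict_space borel (ball 0 1))" and b: "mean_bounded p g"
  shows "g \<in> hardy_space p"
proof -
  have lm: "g \<in> borel_measurable (lebesgue_on unit_disc)"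
  proof -
    have "(\<lambda>x. x) \<in> measurable (lebesgue_on unit_disc) (restrict_space borel unit_disc)"
      using id_borel_measurable_lebesgue_on[of unit_disc]
      by (intro measurable_restrict_space2) (auto simp: id_def)
    from measurable_compose[OF this m] show ?thesis by simp
  qed
  have cm: "(\<lambda>\<theta>. g (polar r \<theta>)) \<in> borel_measurable circ" if "r \<in> {0..<1}" for r
  proof -
    have "(\<lambda>\<theta>. polar r \<theta>) \<in> measurable circ (restrict_space borel (ball 0 1))"
      using that by (intro measurable_restrict_space2 measurable_circ_continuous continuous_intros)
          (auto simp: norm_mult)
    from measurable_compose[OF this m] show ?thesis by simp
  qed
  have "(SUP r\<in>{0..<1}. integral_mean p r g) < \<infinity>"
  proof (cases "p = \<infinity>")
    case True
    then obtain C where C: "\<And>z. norm z < 1 \<Longrightarrow> norm (g z) \<le> C"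
      using b True unfolding mean_bounded_def by (metis dist_0_norm mem_ball)
    have "(SUP r\<in>{0..<1}. integral_mean p r g) \<le> ennreal C"
      unfolding integral_mean_def using True
      by (auto intro!: SUP_least ennreal_leI C simp: norm_mult)
    then show ?thesis by (simp add: le_less_trans)
  next
    case False
    define q where "q = real_of_ereal p"
    have q: "q \<ge> 1" using real_exponent[OF p False] by (simp add: q_def)
    from b False obtain C where
      C: "\<And>r. r \<in> {0..<1} \<Longrightarrow> (\<integral>\<^sup>+\<theta>. ennreal (norm (g (polar r \<theta>)) powr q) \<partial>circ) \<le> ennreal C"
      unfolding mean_bounded_def q_def by metis
    have "integral_mean p r g \<le> ennreal ((1 / (2 * pi) * \<bar>C\<bar>) powr (1 / q))" if r: "r \<in> {0..<1}" for r
    proof -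
      let ?I = "ennreal (1 / (2 * pi)) * (\<integral>\<^sup>+\<theta>. ennreal (norm (g (polar r \<theta>)) powr q) \<partial>circ)"
      have "?I \<le> ennreal (1 / (2 * pi)) * ennreal \<bar>C\<bar>"
        by (intro mult_left_mono order_trans[OF C[OF r]] ennreal_leI) auto
      also have "\<dots> = ennreal (1 / (2 * pi) * \<bar>C\<bar>)" by (rule ennreal_mult[symmetric]) auto
      finally have I: "?I \<le> ennreal (1 / (2 * pi) * \<bar>C\<bar>)" .
      then have "?I \<noteq> \<infinity>" by (auto simp: top_unique)
      moreover have "enn2real ?I \<le> 1 / (2 * pi) * \<bar>C\<bar>" using I by (intro enn2real_leI) auto
      ultimately show ?thesis
        using False q unfolding integral_mean_def ennreal_powr_def q_def[symmetric]
        by (auto intro!: ennreal_leI powr_mono2)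
    qed
    then have "(SUP r\<in>{0..<1}. integral_mean p r g) \<le> ennreal ((1 / (2 * pi) * \<bar>C\<bar>) powr (1 / q))"
      by (intro SUP_least)
    then show ?thesis by (simp add: le_less_trans)
  qed
  with lm cm show ?thesis unfolding hardy_space_def by auto
qed

section \<open>Conjugate Poisson integrals\<close>

text \<open>With \<open>\<phi>\<close> the argument of \<open>w\<close>, the claim reads
  \<open>|sin \<phi>| powr q \<le> A * cos \<phi> powr q - B * cos (q * \<phi>)\<close> for \<open>|\<phi>| < \<pi>/2\<close>. Near \<open>|\<phi>| = \<pi>/2\<close> the
  angle \<open>q |\<phi>|\<close> lies beyond \<open>\<pi>/2\<close> but not beyond \<open>\<pi>\<close>, so \<open>- cos (q * \<phi>)\<close> is bounded below by a
  positive number; elsewhere \<open>cos \<phi>\<close> is. The gain is that the last term is harmonic if \<open>w\<close>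
  depends holomorphically on a parameter.\<close>

lemma riesz_pointwise:
  fixes q :: real
  assumes q: "1 < q" "q \<le> 2"
  obtains A B where "A \<ge> 0" "B \<ge> 0" "\<And>w. 0 < Re w \<Longrightarrow>
      \<bar>Im w\<bar> powr q \<le> A * Re w powr q - B * Re (w powr of_real q)"
proof -
  \<comment> \<open>The midpoint of \<open>\<pi>/(2 q)\<close> and \<open>\<pi>/2\<close>.\<close>
  define \<phi>0 where "\<phi>0 = pi * (q + 1) / (4 * q)"
  have \<phi>0: "0 < \<phi>0" "\<phi>0 < pi / 2" "pi / 2 < q * \<phi>0" "q * \<phi>0 < pi"
  proof -
    show "0 < \<phi>0" unfolding \<phi>0_def using q by (intro divide_pos_pos mult_pos_pos) auto
  qed (use q pi_gt_zero in \<open>auto simp: \<phi>0_def field_simps\<close>)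
  define \<kappa> where "\<kappa> = - cos (q * \<phi>0)"
  have "cos (q * \<phi>0) < cos (pi / 2)" using \<phi>0 by (intro cos_monotone_0_pi) auto
  then have \<kappa>: "\<kappa> > 0" by (simp add: \<kappa>_def)
  define B where "B = 1 / \<kappa>"
  define A where "A = (1 + B) / cos \<phi>0 powr q"
  have cp: "0 < cos \<phi>0" using \<phi>0 by (intro cos_gt_zero_pi) auto
  have B: "B > 0" using \<kappa> by (simp add: B_def)
  have A: "A > 0" using B cp by (simp add: A_def)
  have angle: "\<bar>sin \<phi>\<bar> powr q \<le> A * cos \<phi> powr q - B * cos (q * \<phi>)" if \<phi>: "\<bar>\<phi>\<bar> < pi / 2" for \<phi>
  proof -
    have "\<bar>sin \<phi>\<bar> powr q \<le> 1 powr q" using q by (intro powr_mono2) auto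
    then have s: "\<bar>sin \<phi>\<bar> powr q \<le> 1" by simp
    show ?thesis
    proof (cases "\<bar>\<phi>\<bar> \<le> \<phi>0")
      case True
      have "cos \<phi>0 \<le> cos \<bar>\<phi>\<bar>" using True \<phi>0 by (intro cos_monotone_0_pi_le) auto
      then have "cos \<phi>0 powr q \<le> cos \<phi> powr q" using cp q by (intro powr_mono2) auto
      then have "A * cos \<phi>0 powr q \<le> A * cos \<phi> powr q" using A by (intro mult_left_mono) auto
      moreover have "A * cos \<phi>0 powr q = 1 + B" using cp by (simp add: A_def)
      moreover have "B * cos (q * \<phi>) \<le> B * 1" using B by (intro mult_left_mono) auto
      ultimately show ?thesis using s by simp
    next
      case False
      have "q * \<bar>\<phi>\<bar> \<le> 2 * \<bar>\<phi>\<bar>" using q by (intro mult_right_mono) auto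
      then have "q * \<bar>\<phi>\<bar> \<le> pi" using \<phi> by linarith
      moreover have "q * \<phi>0 \<le> q * \<bar>\<phi>\<bar>" using False q by (intro mult_left_mono) auto
      ultimately have "cos (q * \<bar>\<phi>\<bar>) \<le> cos (q * \<phi>0)" using \<phi>0 by (intro cos_monotone_0_pi_le) auto
      moreover have "cos (q * \<bar>\<phi>\<bar>) = cos (q * \<phi>)" by (cases "\<phi> \<ge> 0") auto
      ultimately have "\<kappa> \<le> - cos (q * \<phi>)" by (simp add: \<kappa>_def)
      then have "B * \<kappa> \<le> B * (- cos (q * \<phi>))" using B by (intro mult_left_mono) auto
      moreover have "B * \<kappa> = 1" using \<kappa> by (simp add: B_def)
      moreover have "0 \<le> A * cos \<phi> powr q" using A by simp
      ultimately show ?thesis using s by simp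
    qed
  qed
  show ?thesis
  proof (rule that)
    fix w :: complex assume w: "0 < Re w"
    then have w0: "w \<noteq> 0" by auto
    define \<rho> \<phi> where "\<rho> = norm w" and "\<phi> = Im (Ln w)"
    have \<rho>: "\<rho> > 0" using w0 by (simp add: \<rho>_def)
    have \<phi>: "\<bar>\<phi>\<bar> < pi / 2" using w w0 Re_Ln_pos_lt[of w] by (simp add: \<phi>_def)
    have "w = exp (Ln w)" using w0 by simp
    then have "w = polar \<rho> \<phi>"
      using w0 by (metis Re_Ln \<phi>_def \<rho>_def exp_eq_polar exp_ln exp_of_real norm_eq_zero of_real_def
          zero_less_norm_iff)
    then have ReIm: "Re w = \<rho> * cos \<phi>" "Im w = \<rho> * sin \<phi>" by auto
    have pw: "Re (w powr of_real q) = \<rho> powr q * cos (q * \<phi>)"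
      using w0 by (simp add: powr_def Re_exp Re_Ln \<rho>_def \<phi>_def)
    have c: "0 < cos \<phi>" using \<phi> by (intro cos_gt_zero_pi) auto
    have "\<bar>Im w\<bar> powr q = \<rho> powr q * \<bar>sin \<phi>\<bar> powr q"
      using \<rho> by (simp add: ReIm abs_mult powr_mult)
    also have "\<dots> \<le> \<rho> powr q * (A * cos \<phi> powr q - B * cos (q * \<phi>))"
      by (intro mult_left_mono angle \<phi>) auto
    also have "\<dots> = A * Re w powr q - B * Re (w powr of_real q)"
      using \<rho> c unfolding pw by (simp add: ReIm powr_mult algebra_simps)
    finally show "\<bar>Im w\<bar> powr q \<le> A * Re w powr q - B * Re (w powr of_real q)" .
  qed (use A B in auto)
qed

lemma holomorphic_circle_mean:
  fixes h :: "complex \<Rightarrow> complex"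
  assumes h: "h holomorphic_on ball 0 1" and r: "0 \<le> r" "r < 1"
  shows "((\<lambda>t. h (polar r t)) has_integral (2 * pi * h 0)) {0..2*pi}"
proof (cases "r = 0")
  case True
  then show ?thesis using has_integral_const_real[of "h 0" 0 "2*pi"] by (simp add: scaleR_conv_of_real)
next
  case False
  with r have r0: "r > 0" by simp
  have "h holomorphic_on cball 0 r" using h by (rule holomorphic_on_subset) (use r in auto)
  from Cauchy_integral_circlepath_simple[OF this, of 0] r0
  have "((\<lambda>u. h u / (u - 0)) has_contour_integral (2 * of_real pi * \<i> * h 0)) (circlepath 0 r)" by simp
  then have "((\<lambda>t. h (0 + r * cis t) / (0 + r * cis t - 0) * r * \<i> * cis t) has_integral (2 * of_real pi * \<i>
      * h 0)) {0..2*pi}"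
    unfolding circlepath_def by (subst (asm) has_contour_integral_part_circlepath_iff) auto
  then have "((\<lambda>t. \<i> * h (r * cis t)) has_integral (2 * of_real pi * \<i> * h 0)) {0..2*pi}"
    by (rule has_integral_eq[rotated]) (use r0 in \<open>auto simp: field_simps\<close>)
  from has_integral_mult_right[OF this, of "- \<i>"]
  have "((\<lambda>t. h (r * cis t)) has_integral (- \<i> * (2 * of_real pi * \<i> * h 0))) {0..2*pi}"
    by (simp add: mult.assoc[symmetric])
  moreover have "- \<i> * (2 * of_real pi * \<i> * h 0) = 2 * pi * h 0" by (simp add: complex_eq_iff algebra_simps)
  ultimately show ?thesis by (simp only:)
qed

abbreviation poisson_ker :: "complex \<Rightarrow> real \<Rightarrow> real" where "poisson_ker \<equiv> ker 1 1"

lemma herglotz_kernel: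
  assumes z: "norm z < 1"
  shows "(cis t + z) / (cis t - z) = Complex (poisson_ker z t) (conj_ker 0 z t)"
proof -
  have d: "sqdist z t > 0" by (rule sqdist_pos[OF z])
  have nz: "cis t - z \<noteq> 0" using d by (auto simp: sqdist_eq_norm)
  have p: "1 - (norm z)\<^sup>2 > 0" by (rule defect_pos[OF z])
  have "(cis t + z) / (cis t - z) = ((cis t + z) * cnj (cis t - z)) / of_real (sqdist z t)"
  proof -
    have sq: "of_real (sqdist z t) = (cis t - z) * cnj (cis t - z)"
      by (simp only: sqdist_eq_norm complex_norm_square)
    have "cnj (cis t - z) \<noteq> 0" using nz by (simp del: complex_cnj_diff)
    then show ?thesis unfolding sq by (simp del: complex_cnj_diff)
  qed
  also have "(cis t + z) * cnj (cis t - z) = Complex (1 - (norm z)\<^sup>2) (2 * (Im z * cos t - Re z * sin t))"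
    by (simp add: complex_eq_iff cmod_power2 sin_squared_eq power2_eq_square[symmetric] algebra_simps)
  finally show ?thesis
    using d p by (simp add: ker_def conj_ker_def complex_eq_iff powr_minus_divide Re_divide_of_real
        Im_divide_of_real)
qed

lemma disc_kernel_conj_ker: "disc_kernel (conj_ker \<alpha>)"
  using continuous_on_ker[of \<alpha> "\<alpha> / 2 + 1"]
  unfolding case_prod_beta conj_ker_def by (intro continuous_intros)

lemma ker_swap: "ker \<beta> \<gamma> (polar r \<theta>) t = ker \<beta> \<gamma> (polar r t) \<theta>"
  by (simp add: ker_def norm_mult sqdist_swap[of r \<theta> t])

lemma conj_ker_antisym: "conj_ker \<alpha> (polar r \<theta>) t = - conj_ker \<alpha> (polar r t) \<theta>"
  unfolding conj_ker_def ker_swap[of _ _ r \<theta> t] by (simp add: algebra_simps)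

lemma schur_kernel_critical:
  assumes "\<gamma> > 1 / 2"
  obtains m where "schur_kernel (ker (2 * \<gamma> - 1) \<gamma>) m"
proof -
  from ker_critical_integral_bound[OF assms] obtain m where
    m: "\<And>z. norm z < 1 \<Longrightarrow> (LINT t|circ. ker (2 * \<gamma> - 1) \<gamma> z t) \<le> m" by blast
  have "schur_kernel (ker (2 * \<gamma> - 1) \<gamma>) (max m 1)"
  proof
    show "(LINT t|circ. \<bar>ker (2 * \<gamma> - 1) \<gamma> z t\<bar>) \<le> max m 1" if "norm z < 1" for z
      using m[OF that] by (simp add: ker_nonneg)
  qed (auto simp: continuous_on_ker ker_swap)
  then show ?thesis by (rule that)
qed

lemma circ_transform_polar_continuous:
  assumes k: "disc_kernel k" and G: "integrable circ G" and r: "0 \<le> r" "r < 1"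
  shows "continuous_on {0..2*pi} (\<lambda>\<theta>. circ_transform k G (polar r \<theta>))"
  by (rule continuous_on_compose2[OF circ_transform_continuous[OF k G]])
    (use r in \<open>auto simp: norm_mult intro!: continuous_intros\<close>)

lemma circ_power_integrable:
  assumes "continuous_on {0..2*pi} v" "q > (0::real)"
  shows "integrable circ (\<lambda>\<theta>. norm (v \<theta>) powr q)"
  by (intro continuous_imp_integrable_real continuous_on_powr' continuous_intros assms) (use assms in auto)

text \<open>The transforms of a real density by the Poisson kernel and its conjugate are the real and
  imaginary parts of one holomorphic function, because the kernels are those of one kernel that
  is holomorphic in \<open>z\<close>.\<close>

lemma herglotz_transform:
  assumes G: "continuous_on {0..2*pi} (G :: real \<Rightarrow> real)"
  obtains H where "H holomorphic_on ball 0 1"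
    "\<And>z. norm z < 1 \<Longrightarrow> H z = Complex (LINT t|circ. poisson_ker z t * G t) (LINT t|circ. conj_ker 0 z t * G t)"
proof -
  define u v where "u z = (LINT t|circ. poisson_ker z t * G t)" and "v z = (LINT t|circ. conj_ker 0 z t * G
      t)" for z
  have Gc: "continuous_on {0..2*pi} (\<lambda>t. complex_of_real (G t))" by (intro continuous_intros G)
  have tr: "circ_transform poisson_ker (\<lambda>t. of_real (G t)) z = of_real (u z)"
    "circ_transform (conj_ker 0) (\<lambda>t. of_real (G t)) z = of_real (v z)" for z
    by (simp_all add: circ_transform_def u_def v_def scaleR_conv_of_real flip: of_real_mult)
  define H where "H z = integral (cbox 0 (2*pi)) (\<lambda>t. (cis t + z) / (cis t - z) * of_real (G t))" for z
  have nz: "cis t - z \<noteq> 0" if "norm z < 1" for t z using norm_cis[of t] that by auto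
  have Hh: "H holomorphic_on ball 0 1"
    unfolding H_def
  proof (rule leibniz_rule_holomorphic[where fx="\<lambda>z t. 2 * cis t / (cis t - z)\<^sup>2 * of_real (G t)"])
    fix z t assume "z \<in> ball (0::complex) 1"
    then have "((\<lambda>z. (cis t + z) / (cis t - z)) has_field_derivative 2 * cis t / (cis t - z)\<^sup>2) (at z)"
      using nz[of z t] by (auto intro!: derivative_eq_intros simp: power2_eq_square)
    then show "((\<lambda>z. (cis t + z) / (cis t - z) * of_real (G t)) has_field_derivative 2 * cis t /
        (cis t - z)\<^sup>2 * of_real (G t)) (at z within ball 0 1)"
      by (intro DERIV_cmult_right) (rule has_field_derivative_at_within)
  next
    fix z assume "z \<in> ball (0::complex) 1"
    then show "(\<lambda>t. (cis t + z) / (cis t - z) * of_real (G t)) integrable_on cbox 0 (2*pi)"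
      using nz[of z] Gc by (intro integrable_continuous continuous_intros) auto
  next
    have "continuous_on (ball 0 1 \<times> cbox 0 (2*pi)) (\<lambda>x. complex_of_real (G (snd x)))"
      by (rule continuous_on_compose2[OF Gc]) (auto intro!: continuous_intros)
    then show "continuous_on (ball 0 1 \<times> cbox 0 (2*pi)) (\<lambda>(z, t). 2 * cis t / (cis t - z)\<^sup>2 * of_real (G t))"
      unfolding case_prod_beta using nz by (intro continuous_intros) auto
  qed auto
  have Hz: "H z = Complex (u z) (v z)" if "norm z < 1" for z
  proof -
    have i: "integrable circ (\<lambda>t. poisson_ker z t *\<^sub>R complex_of_real (G t))" "integrable circ (\<lambda>t. conj_ker
        0 z t *\<^sub>R complex_of_real (G t))"
      by (intro circ_transform_integrable continuous_on_ker disc_kernel_conj_ker Gc that)+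
    have eq: "(\<lambda>t. (cis t + z) / (cis t - z) * of_real (G t)) =
        (\<lambda>t. poisson_ker z t *\<^sub>R complex_of_real (G t) + \<i> * (conj_ker 0 z t *\<^sub>R complex_of_real (G t)))"
      unfolding herglotz_kernel[OF that] by (auto simp: complex_eq_iff)
    have "integrable circ (\<lambda>t. poisson_ker z t *\<^sub>R complex_of_real (G t) + \<i> * (conj_ker 0 z t *\<^sub>R
        complex_of_real (G t)))"
      by (intro Bochner_Integration.integrable_add integrable_mult_right i)
    then have "H z = (LINT t|circ. poisson_ker z t *\<^sub>R complex_of_real (G t) + \<i> * (conj_ker 0 z t *\<^sub>R
        complex_of_real (G t)))"
      unfolding H_def eq interval_cbox by (rule lebesgue_integral_eq_integral[symmetric]) simp
    also have "\<dots> = (LINT t|circ. poisson_ker z t *\<^sub>R complex_of_real (G t)) + \<i> * (LINT t|circ. conj_ker 0 z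
        t *\<^sub>R complex_of_real (G t))"
      unfolding integral_mult_right_zero[symmetric]
      by (intro Bochner_Integration.integral_add i integrable_mult_right)
    also have "\<dots> = of_real (u z) + \<i> * of_real (v z)"
      using tr[of z] unfolding circ_transform_def by simp
    finally show ?thesis by (simp add: complex_eq_iff)
  qed
  show ?thesis by (rule that[OF Hh Hz[unfolded u_def v_def]])
qed

text \<open>For a nonnegative density, \<open>H = u + \<i> v\<close> maps the disc into the closed right half-plane. When
  \<open>riesz_pointwise\<close> for \<open>H + \<eta>\<close> is integrated over a circle, the harmonic term contributes a
  multiple of its value at the origin, which is nonnegative since \<open>v\<close> vanishes there. So the
  integral of \<open>|v| powr q\<close> is at most \<open>A\<close> times that of \<open>(u + \<eta>) powr q\<close>; the Poisson kernel
  passes the Schur test, and \<open>\<eta>\<close> tends to \<open>0\<close>.\<close>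

lemma riesz_positive:
  assumes q: "1 < q" "q \<le> 2"
  obtains A where "\<And>G r. continuous_on {0..2*pi} G \<Longrightarrow> (\<And>t. G t \<ge> (0::real)) \<Longrightarrow> 0 \<le> r \<Longrightarrow> r < 1 \<Longrightarrow>
    (LINT \<theta>|circ. norm (circ_transform (conj_ker 0) (\<lambda>t. of_real (G t)) (polar r \<theta>)) powr q)
      \<le> A * (LINT t|circ. G t powr q)"
proof -
  obtain A B where AB: "A \<ge> 0" "B \<ge> 0" "\<And>w. 0 < Re w \<Longrightarrow>
      \<bar>Im w\<bar> powr q \<le> A * Re w powr q - B * Re (w powr of_real q)"
    using riesz_pointwise[OF q] by blast
  obtain m where "schur_kernel poisson_ker m" using schur_kernel_critical[of 1] by auto
  then interpret P: schur_kernel poisson_ker m .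
  have main: "(LINT \<theta>|circ. norm (circ_transform (conj_ker 0) (\<lambda>t. of_real (G t)) (polar r \<theta>)) powr q)
      \<le> (A * 2 powr q * m powr q) * (LINT t|circ. G t powr q)"
    if G: "continuous_on {0..2*pi} G" "\<And>t. G t \<ge> (0::real)" and r: "0 \<le> r" "r < 1" for G r
  proof -
    define z where "z \<theta> = polar r \<theta>" for \<theta> :: real
    have z: "norm (z \<theta>) < 1" for \<theta> using r by (simp add: z_def norm_polar)
    define u v where "u z = (LINT t|circ. poisson_ker z t * G t)" and "v z = (LINT t|circ. conj_ker 0 z t *
        G t)" for z
    have Gc: "continuous_on {0..2*pi} (\<lambda>t. complex_of_real (G t))" by (intro continuous_intros G)
    have tr: "circ_transform poisson_ker (\<lambda>t. of_real (G t)) z = of_real (u z)"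
      "circ_transform (conj_ker 0) (\<lambda>t. of_real (G t)) z = of_real (v z)" for z
      by (simp_all add: circ_transform_def u_def v_def scaleR_conv_of_real flip: of_real_mult)
    have u0: "u z \<ge> 0" for z unfolding u_def by (intro integral_nonneg_AE AE_I2 mult_nonneg_nonneg
        ker_nonneg G)
    obtain H where Hh: "H holomorphic_on ball 0 1" and Hz: "\<And>z. norm z < 1 \<Longrightarrow> H z = Complex (u z) (v z)"
      using herglotz_transform[OF G(1)] unfolding u_def v_def by blast
    have uc: "continuous_on {0..2*pi} (\<lambda>\<theta>. u (z \<theta>))" and vc: "continuous_on {0..2*pi} (\<lambda>\<theta>. v (z \<theta>))"
    proof -
      have "continuous_on {0..2*pi} (\<lambda>\<theta>. H (z \<theta>))"
        by (rule continuous_on_compose2[OF holomorphic_on_imp_continuous_on[OF Hh]])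
          (use z in \<open>auto simp: z_def intro!: continuous_intros\<close>)
      from continuous_on_Re[OF this] continuous_on_Im[OF this]
      show "continuous_on {0..2*pi} (\<lambda>\<theta>. u (z \<theta>))" "continuous_on {0..2*pi} (\<lambda>\<theta>. v (z \<theta>))"
        by (simp_all add: Hz z)
    qed
    have vI: "integrable circ (\<lambda>\<theta>. \<bar>v (z \<theta>)\<bar> powr q)" and uI: "integrable circ (\<lambda>\<theta>. u (z \<theta>) powr q)"
      using circ_power_integrable[OF vc, of q] circ_power_integrable[OF uc, of q] q u0 by simp_all
    have step: "(LINT \<theta>|circ. \<bar>v (z \<theta>)\<bar> powr q) \<le> A * (LINT \<theta>|circ. (u (z \<theta>) + \<eta>) powr q)" if \<eta>: "\<eta> > 0" for \<eta>
    proof -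
      define h where "h z = (H z + of_real \<eta>) powr of_real q" for z
      have pos: "Re (H z + of_real \<eta>) > 0" if "norm z < 1" for z using u0[of z] \<eta> by (simp add: Hz[OF that]
          add_nonneg_pos)
      have "H z + of_real \<eta> \<notin> \<real>\<^sub>\<le>\<^sub>0" if "norm z < 1" for z
        using pos[OF that] by (auto simp: complex_nonpos_Reals_iff)
      then have hh: "h holomorphic_on ball 0 1"
        unfolding h_def by (intro holomorphic_intros Hh) auto
      have hi: "((\<lambda>\<theta>. Re (h (z \<theta>))) has_integral 2 * pi * Re (h 0)) {0..2*pi}"
        using has_integral_Re[OF holomorphic_circle_mean[OF hh r]] by (simp add: z_def)
      have "v 0 = 0" by (simp add: v_def conj_ker_def)
      then have "H 0 + of_real \<eta> = of_real (u 0 + \<eta>)" by (simp add: Hz complex_eq_iff)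
      then have "h 0 = of_real ((u 0 + \<eta>) powr q)" unfolding h_def using u0[of 0] \<eta> by
          (simp add: powr_of_real del: of_real_add)
      then have h0: "Re (h 0) \<ge> 0" by simp
      have hc: "continuous_on {0..2*pi} (\<lambda>\<theta>. Re (h (z \<theta>)))"
        by (intro continuous_on_Re continuous_on_compose2[OF holomorphic_on_imp_continuous_on[OF hh]])
          (use z in \<open>auto simp: z_def intro!: continuous_intros\<close>)
      then have hI: "integrable circ (\<lambda>\<theta>. Re (h (z \<theta>)))" by (rule continuous_imp_integrable_real)
      have hL: "(LINT \<theta>|circ. Re (h (z \<theta>))) = 2 * pi * Re (h 0)"
        using lebesgue_integral_eq_integral[OF hI] integral_unique[OF hi] by simp
      have wI: "integrable circ (\<lambda>\<theta>. (u (z \<theta>) + \<eta>) powr q)"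
        by (intro continuous_imp_integrable_real continuous_on_powr' continuous_intros uc) (use u0 \<eta> q in
            \<open>auto intro: add_nonneg_nonneg\<close>)
      have "(LINT \<theta>|circ. \<bar>v (z \<theta>)\<bar> powr q) \<le> (LINT \<theta>|circ. A * (u (z \<theta>) + \<eta>) powr q - B * Re (h (z \<theta>)))"
      proof (intro integral_mono vI Bochner_Integration.integrable_diff integrable_mult_right wI hI)
        fix \<theta>
        show "\<bar>v (z \<theta>)\<bar> powr q \<le> A * (u (z \<theta>) + \<eta>) powr q - B * Re (h (z \<theta>))"
          using AB(3)[OF pos[OF z[of \<theta>]]] by (simp add: h_def Hz[OF z])
      qed
      also have "\<dots> = A * (LINT \<theta>|circ. (u (z \<theta>) + \<eta>) powr q) - B * (2 * pi * Re (h 0))"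
        using wI hI by (simp add: hL)
      also have "\<dots> \<le> A * (LINT \<theta>|circ. (u (z \<theta>) + \<eta>) powr q)"
        using AB h0 by simp
      finally show ?thesis .
    qed
    have uP: "(LINT \<theta>|circ. u (z \<theta>) powr q) \<le> m powr q * (LINT t|circ. G t powr q)"
    proof -
      have "integrable circ (\<lambda>t. norm (complex_of_real (G t)) powr q)" by (rule circ_power_integrable[OF
          Gc]) (use q in auto)
      from P.transform_power_bound[OF measurable_circ_continuous[OF Gc] _ this r] q
      have "(\<integral>\<^sup>+\<theta>. ennreal (u (z \<theta>) powr q) \<partial>circ) \<le> ennreal (m powr q * (LINT t|circ. G t powr q))"
        using u0 G(2) by (simp add: tr z_def)
      moreover have "(\<integral>\<^sup>+\<theta>. ennreal (u (z \<theta>) powr q) \<partial>circ) = ennreal (LINT \<theta>|circ. u (z \<theta>) powr q)"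
        by (rule nn_integral_eq_integral[OF uI]) auto
      ultimately have "ennreal (LINT \<theta>|circ. u (z \<theta>) powr q) \<le> ennreal (m powr q * (LINT t|circ. G t powr q))"
        by (simp only:)
      then show ?thesis by (subst (asm) ennreal_le_iff) (auto intro!: mult_nonneg_nonneg integral_nonneg_AE)
    qed
    have le: "(LINT \<theta>|circ. \<bar>v (z \<theta>)\<bar> powr q) \<le> A * 2 powr q * m powr q * (LINT t|circ. G t powr q) + e" if
        e: "e > 0" for e
    proof -
      \<comment> \<open>\<open>\<eta>\<close> is chosen such that its contribution is at most \<open>e\<close>.\<close>
      define c where "c = A * 2 powr q * (2 * pi) + 1"
      have c: "c > 0" using AB by (simp add: c_def add_nonneg_pos)
      define \<eta> where "\<eta> = (e / c) powr (1 / q)"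
      have \<eta>: "\<eta> > 0" "\<eta> powr q = e / c" using e c q by (auto simp: \<eta>_def powr_powr)
      have "(LINT \<theta>|circ. (u (z \<theta>) + \<eta>) powr q) \<le> (LINT \<theta>|circ. 2 powr q * u (z \<theta>) powr q + 2 powr q * \<eta>
          powr q)"
      proof (intro integral_mono Bochner_Integration.integrable_add integrable_mult_right uI
          finite_measure.integrable_const[OF circ_finite_measure])
        show "integrable circ (\<lambda>\<theta>. (u (z \<theta>) + \<eta>) powr q)"
          by (intro continuous_imp_integrable_real continuous_on_powr' continuous_intros uc) (use u0 \<eta> q in
              \<open>auto intro: add_nonneg_nonneg\<close>)
        fix \<theta>
        have "(u (z \<theta>) + \<eta>) powr q \<le> (2 * max (u (z \<theta>)) \<eta>) powr q" using q u0[of "z \<theta>"] \<eta> by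
            (intro powr_mono2) auto
        also have "\<dots> = 2 powr q * max (u (z \<theta>)) \<eta> powr q" by (simp add: powr_mult)
        also have "max (u (z \<theta>)) \<eta> powr q \<le> u (z \<theta>) powr q + \<eta> powr q" by (simp add: max_def)
        finally show "(u (z \<theta>) + \<eta>) powr q \<le> 2 powr q * u (z \<theta>) powr q + 2 powr q * \<eta> powr q" by
            (simp add: algebra_simps)
      qed
      also have "\<dots> = 2 powr q * (LINT \<theta>|circ. u (z \<theta>) powr q) + 2 powr q * (e / c) * (2 * pi)"
        using uI by (subst Bochner_Integration.integral_add) (auto simp: \<eta>(2)
            finite_measure.integrable_const[OF circ_finite_measure] measure_restrict_space)
      also have "2 powr q * (LINT \<theta>|circ. u (z \<theta>) powr q) \<le> 2 powr q * (m powr q * (LINT t|circ. G t powr q))"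
        by (intro mult_left_mono uP) auto
      finally have "(LINT \<theta>|circ. (u (z \<theta>) + \<eta>) powr q) \<le> 2 powr q * (m powr q * (LINT t|circ. G t powr q))
          + 2 powr q * (e / c) * (2 * pi)"
        by simp
      from mult_left_mono[OF this AB(1)] step[OF \<eta>(1)]
      have "(LINT \<theta>|circ. \<bar>v (z \<theta>)\<bar> powr q) \<le> A * 2 powr q * m powr q * (LINT t|circ. G t powr q) +
          (A * 2 powr q * (2 * pi)) * (e / c)"
        by (simp add: algebra_simps)
      also have "(A * 2 powr q * (2 * pi)) * (e / c) \<le> c * (e / c)"
        using e c by (intro mult_right_mono) (auto simp: c_def)
      also have "c * (e / c) = e" using c by simp
      finally show ?thesis by simp
    qed
    show ?thesis
      using field_le_epsilon[OF le] unfolding tr z_def by simp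
  qed
  show ?thesis by (rule that[OF main])
qed

abbreviation conj_poisson :: "(real \<Rightarrow> complex) \<Rightarrow> complex \<Rightarrow> complex" where
  "conj_poisson \<equiv> circ_transform (conj_ker 0)"

definition conj_poisson_bound :: "real \<Rightarrow> real \<Rightarrow> (real \<Rightarrow> complex) \<Rightarrow> bool" where
  "conj_poisson_bound q A G \<longleftrightarrow> (\<forall>r. 0 \<le> r \<longrightarrow> r < 1 \<longrightarrow>
    (LINT \<theta>|circ. norm (conj_poisson G (polar r \<theta>)) powr q) \<le> A * (LINT t|circ. norm (G t) powr q))"

text \<open>A complex density is a combination of four nonnegative ones, which inherit its continuity.\<close>

lemma riesz_continuous:
  assumes q: "1 < q" "q \<le> 2"
  obtains A where "A \<ge> 0" "\<And>G. continuous_on {0..2*pi} G \<Longrightarrow> conj_poisson_bound q A G"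
proof -
  from riesz_positive[OF q] obtain A0 where
    A0: "\<And>G r. continuous_on {0..2*pi} G \<Longrightarrow> (\<And>t. G t \<ge> (0::real)) \<Longrightarrow> 0 \<le> r \<Longrightarrow> r < 1 \<Longrightarrow>
    (LINT \<theta>|circ. norm (conj_poisson (\<lambda>t. of_real (G t)) (polar r \<theta>)) powr q) \<le> A0 * (LINT t|circ. G t powr
        q)"
    by blast
  define A where "A = 4 powr q * (4 * \<bar>A0\<bar>)"
  have "(LINT \<theta>|circ. norm (conj_poisson G (polar r \<theta>)) powr q) \<le> A * (LINT t|circ. norm (G t) powr q)"
    if G: "continuous_on {0..2*pi} G" and r: "0 \<le> r" "r < 1" for G r
  proof -
    define z where "z \<theta> = polar r \<theta>" for \<theta> :: real
    have z: "norm (z \<theta>) < 1" for \<theta> using r by (simp add: z_def norm_polar)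
    define g where "g i t = (if i = (0::nat) then max (Re (G t)) 0 else if i = 1 then max (- Re (G t)) 0
       else if i = 2 then max (Im (G t)) 0 else max (- Im (G t)) 0)" for i t
    have gc: "continuous_on {0..2*pi} (g i)" for i
      unfolding g_def by (cases "i = 0"; cases "i = 1"; cases "i = 2") (auto intro!: continuous_intros G)
    have gc': "continuous_on {0..2*pi} (\<lambda>t. complex_of_real (g i t))" for i by (intro continuous_intros gc)
    have g0: "g i t \<ge> 0" for i t by (simp add: g_def)
    have gle: "g i t \<le> norm (G t)" for i t
      using abs_Re_le_cmod[of "G t"] abs_Im_le_cmod[of "G t"] by (auto simp: g_def)
    define v where "v i \<theta> = conj_poisson (\<lambda>t. of_real (g i t)) (z \<theta>)" for i \<theta>
    have vc: "continuous_on {0..2*pi} (v i)" for i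
      unfolding v_def z_def
      by (intro circ_transform_polar_continuous disc_kernel_conj_ker continuous_imp_integrable_real gc' r)
    have vI: "integrable circ (\<lambda>\<theta>. norm (v i \<theta>) powr q)" for i
      using q by (intro circ_power_integrable vc) auto
    have bnd: "(LINT \<theta>|circ. norm (v i \<theta>) powr q) \<le> \<bar>A0\<bar> * (LINT t|circ. norm (G t) powr q)" for i
    proof -
      have "(LINT \<theta>|circ. norm (v i \<theta>) powr q) \<le> A0 * (LINT t|circ. g i t powr q)"
        unfolding v_def z_def by (intro A0 gc g0 r)
      also have "\<dots> \<le> \<bar>A0\<bar> * (LINT t|circ. g i t powr q)"
        by (intro mult_right_mono integral_nonneg_AE) auto
      also have "\<dots> \<le> \<bar>A0\<bar> * (LINT t|circ. norm (G t) powr q)"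
        using circ_power_integrable[OF gc', of q i] q g0 gle
        by (intro mult_left_mono integral_mono circ_power_integrable G powr_mono2) auto
      finally show ?thesis .
    qed
    have dec: "conj_poisson G (z \<theta>) = (v 0 \<theta> - v 1 \<theta>) + \<i> * (v 2 \<theta> - v 3 \<theta>)" for \<theta>
    proof -
      have i: "integrable circ (\<lambda>t. conj_ker 0 (z \<theta>) t *\<^sub>R complex_of_real (g i t))" for i
        by (intro circ_transform_integrable disc_kernel_conj_ker gc' z)
      have "conj_poisson G (z \<theta>) = (LINT t|circ. (conj_ker 0 (z \<theta>) t *\<^sub>R complex_of_real (g 0 t) - conj_ker
          0 (z \<theta>) t *\<^sub>R complex_of_real (g 1 t))
         + \<i> * (conj_ker 0 (z \<theta>) t *\<^sub>R complex_of_real (g 2 t) - conj_ker 0 (z \<theta>) t *\<^sub>R complex_of_real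
             (g 3 t)))"
        unfolding circ_transform_def
        by (intro Bochner_Integration.integral_cong refl) (auto simp: complex_eq_iff g_def max_def)
      also have "\<dots> = (v 0 \<theta> - v 1 \<theta>) + \<i> * (v 2 \<theta> - v 3 \<theta>)"
        unfolding v_def circ_transform_def
        by (subst Bochner_Integration.integral_add Bochner_Integration.integral_diff integral_mult_right_zero
            | intro Bochner_Integration.integrable_diff integrable_mult_right i refl)+
      finally show ?thesis .
    qed
    have pt: "norm (conj_poisson G (z \<theta>)) powr q \<le> 4 powr q * (norm (v 0 \<theta>) powr q + norm (v 1 \<theta>) powr q +
        norm (v 2 \<theta>) powr q + norm (v 3 \<theta>) powr q)" for \<theta>
    proof -
      define M where "M = max (max (norm (v 0 \<theta>)) (norm (v 1 \<theta>))) (max (norm (v 2 \<theta>)) (norm (v 3 \<theta>)))"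
      have "norm (conj_poisson G (z \<theta>)) \<le> norm (v 0 \<theta> - v 1 \<theta>) + norm (v 2 \<theta> - v 3 \<theta>)"
        unfolding dec by (rule order_trans[OF norm_triangle_ineq]) (simp add: norm_mult)
      also have "\<dots> \<le> (norm (v 0 \<theta>) + norm (v 1 \<theta>)) + (norm (v 2 \<theta>) + norm (v 3 \<theta>))"
        by (intro add_mono norm_triangle_ineq4)
      also have "\<dots> \<le> 4 * M" by (simp add: M_def)
      finally have "norm (conj_poisson G (z \<theta>)) powr q \<le> (4 * M) powr q" using q by (intro powr_mono2) auto
      also have "\<dots> = 4 powr q * M powr q" by (simp add: powr_mult M_def le_max_iff_disj)
      also have "M powr q \<le> norm (v 0 \<theta>) powr q + norm (v 1 \<theta>) powr q + norm (v 2 \<theta>) powr q + norm (v 3 \<theta>)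
          powr q"
        by (simp add: M_def max_def add_nonneg_nonneg add_increasing add_increasing2)
      finally show ?thesis by simp
    qed
    have HI: "integrable circ (\<lambda>\<theta>. norm (conj_poisson G (z \<theta>)) powr q)"
      using q unfolding z_def
      by (intro circ_power_integrable circ_transform_polar_continuous disc_kernel_conj_ker
          continuous_imp_integrable_real G r) auto
    have "(LINT \<theta>|circ. norm (conj_poisson G (z \<theta>)) powr q) \<le>
       (LINT \<theta>|circ. 4 powr q * (norm (v 0 \<theta>) powr q + norm (v 1 \<theta>) powr q + norm (v 2 \<theta>) powr q + norm
           (v 3 \<theta>) powr q))"
      by (intro integral_mono HI integrable_mult_right Bochner_Integration.integrable_add vI pt)
    also have "\<dots> = 4 powr q * ((LINT \<theta>|circ. norm (v 0 \<theta>) powr q) + (LINT \<theta>|circ. norm (v 1 \<theta>) powr q)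
       + (LINT \<theta>|circ. norm (v 2 \<theta>) powr q) + (LINT \<theta>|circ. norm (v 3 \<theta>) powr q))"
      using vI by simp
    also have "\<dots> \<le> 4 powr q * (4 * (\<bar>A0\<bar> * (LINT t|circ. norm (G t) powr q)))"
      using bnd[of 0] bnd[of 1] bnd[of 2] bnd[of 3] by (intro mult_left_mono) auto
    finally show ?thesis by (simp add: A_def z_def mult.assoc)
  qed
  then have "conj_poisson_bound q A G" if "continuous_on {0..2*pi} G" for G
    using that by (simp add: conj_poisson_bound_def)
  moreover have "A \<ge> 0" by (simp add: A_def)
  ultimately show ?thesis using that by blast
qed

text \<open>Multiplication by \<open>x\<close> turns this into \<open>|x| powr p\<close>: it is the function that realises the
  \<open>L\<^sup>p\<close> norm by duality.\<close>

definition dual_power :: "real \<Rightarrow> complex \<Rightarrow> complex" where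
  "dual_power p x = norm x powr (p - 1) *\<^sub>R cnj (sgn x)"

lemma norm_dual_power: "p > 1 \<Longrightarrow> norm (dual_power p x) = norm x powr (p - 1)"
  by (simp add: dual_power_def norm_sgn)

lemma mult_dual_power:
  assumes "p > 1"
  shows "x * dual_power p x = of_real (norm x powr p)"
proof (cases "x = 0")
  case False
  have "x * cnj (sgn x) = (x * cnj x) / of_real (norm x)"
    by (simp add: sgn_div_norm scaleR_conv_of_real divide_inverse mult_ac)
  also have "\<dots> = of_real ((norm x)\<^sup>2) / of_real (norm x)" by (simp only: complex_norm_square)
  also have "\<dots> = of_real (norm x)" using False by (simp add: power2_eq_square)
  finally have "x * cnj (sgn x) = of_real (norm x)" .
  then have "x * dual_power p x = of_real (norm x powr (p - 1)) * of_real (norm x)"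
    by (simp add: dual_power_def scaleR_conv_of_real mult.left_commute)
  also have "\<dots> = of_real (norm x powr p)"
  proof -
    have "norm x powr (p - 1) * norm x = norm x powr p" using False by (simp add: powr_diff)
    then show ?thesis by (simp only: of_real_mult[symmetric])
  qed
  finally show ?thesis .
qed (simp add: dual_power_def)

lemma continuous_dual_power:
  assumes "p > 1"
  shows "continuous_on UNIV (dual_power p)"
proof (rule continuous_at_imp_continuous_on, rule ballI)
  fix x :: complex
  show "isCont (dual_power p) x"
  proof (cases "x = 0")
    case True
    have "((\<lambda>y::complex. norm y powr (p - 1)) \<longlongrightarrow> norm (0::complex) powr (p - 1)) (at 0)"
      by (rule tendsto_powr2) (use assms in \<open>auto intro!: tendsto_norm_zero tendsto_ident_at\<close>)
    then have "((\<lambda>y. norm (dual_power p y)) \<longlongrightarrow> 0) (at 0)" by (simp only: norm_dual_power[OF assms]) simp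
    moreover have "dual_power p 0 = 0" by (simp add: dual_power_def)
    ultimately show ?thesis unfolding True isCont_def by (simp only: tendsto_norm_zero_cancel)
  next
    case False
    have "continuous_on (- {0}) (dual_power p)"
      unfolding dual_power_def sgn_div_norm by (intro continuous_intros) auto
    with False show ?thesis by (simp add: continuous_on_eq_continuous_at open_Compl)
  qed
qed

text \<open>On each circle the conjugate Poisson kernel is antisymmetric in the two angles.\<close>

lemma conj_poisson_skew:
  assumes \<phi>: "integrable circ \<phi>" and g: "continuous_on {0..2*pi} g" and r: "0 \<le> r" "r < 1"
  shows "(LINT \<theta>|circ. conj_poisson \<phi> (polar r \<theta>) * g \<theta>) = - (LINT t|circ. \<phi> t * conj_poisson g (polar r t))"
    and "integrable circ (\<lambda>t. \<phi> t * conj_poisson g (polar r t))"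
proof -
  interpret finite_measure circ by (rule circ_finite_measure)
  interpret pair_sigma_finite circ circ ..
  define Q where "Q \<theta> t = conj_ker 0 (polar r \<theta>) t" for \<theta> t
  have kc: "continuous_on UNIV (\<lambda>(\<theta>, t). Q \<theta> t)"
    unfolding Q_def by (rule disc_kernel_polar_continuous[OF disc_kernel_conj_ker r])
  have "bounded ((\<lambda>(\<theta>, t). Q \<theta> t) ` ({0..2*pi} \<times> {0..2*pi}))" "bounded (g ` {0..2*pi})"
    by (intro compact_imp_bounded compact_continuous_image compact_Times continuous_on_subset[OF kc] g; simp)+
  then obtain C1 C2 where C1: "\<And>\<theta> t. \<theta> \<in> {0..2*pi} \<Longrightarrow> t \<in> {0..2*pi} \<Longrightarrow> \<bar>Q \<theta> t\<bar> \<le> C1"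
    and C2: "\<And>\<theta>. \<theta> \<in> {0..2*pi} \<Longrightarrow> norm (g \<theta>) \<le> C2"
    unfolding bounded_iff by fastforce
  have [measurable]: "\<phi> \<in> borel_measurable circ" "g \<in> borel_measurable circ"
    using \<phi> measurable_circ_continuous[OF g] by auto
  have [measurable]: "(\<lambda>(\<theta>, t). Q \<theta> t) \<in> borel_measurable (circ \<Otimes>\<^sub>M circ)" by
      (rule measurable_circ_pair_continuous[OF kc])
  have Phi: "integrable (circ \<Otimes>\<^sub>M circ) (\<lambda>(\<theta>, t). \<phi> t)"
  proof (rule Fubini_integrable)
    show "(\<lambda>(\<theta>, t). \<phi> t) \<in> borel_measurable (circ \<Otimes>\<^sub>M circ)" by measurable
  qed (use \<phi> in auto)
  have int: "integrable (circ \<Otimes>\<^sub>M circ) (\<lambda>(\<theta>, t). (Q \<theta> t *\<^sub>R \<phi> t) * g \<theta>)"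
  proof (rule Bochner_Integration.integrable_bound)
    show "integrable (circ \<Otimes>\<^sub>M circ) (\<lambda>x. (C1 * C2) *\<^sub>R (case x of (\<theta>, t) \<Rightarrow> \<phi> t))" using Phi by simp
    show "(\<lambda>(\<theta>, t). (Q \<theta> t *\<^sub>R \<phi> t) * g \<theta>) \<in> borel_measurable (circ \<Otimes>\<^sub>M circ)" by measurable
    show "AE x in circ \<Otimes>\<^sub>M circ. norm (case x of (\<theta>, t) \<Rightarrow> (Q \<theta> t *\<^sub>R \<phi> t) * g \<theta>)
        \<le> norm ((C1 * C2) *\<^sub>R (case x of (\<theta>, t) \<Rightarrow> \<phi> t))"
    proof (intro AE_I2)
      fix x assume "x \<in> space (circ \<Otimes>\<^sub>M circ)"
      then obtain \<theta> t where x: "x = (\<theta>, t)" "\<theta> \<in> {0..2*pi}" "t \<in> {0..2*pi}" by (auto simp: space_pair_measure)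
      have "\<bar>Q \<theta> t\<bar> * norm (\<phi> t) * norm (g \<theta>) \<le> C1 * norm (\<phi> t) * C2"
        using C1[OF x(2,3)] C2[OF x(2)] by (intro mult_mono) (auto intro: mult_nonneg_nonneg order_trans[OF
            abs_ge_zero])
      also have "\<dots> \<le> \<bar>C1 * C2\<bar> * norm (\<phi> t)"
        using mult_right_mono[OF abs_ge_self[of "C1 * C2"] norm_ge_zero[of "\<phi> t"]] by (simp add: mult_ac)
      finally show "norm (case x of (\<theta>, t) \<Rightarrow> (Q \<theta> t *\<^sub>R \<phi> t) * g \<theta>) \<le> norm ((C1 * C2) *\<^sub>R (case x of (\<theta>, t)
          \<Rightarrow> \<phi> t))"
        by (simp add: x norm_mult)
    qed
  qed
  have inner: "(LINT \<theta>|circ. (Q \<theta> t *\<^sub>R \<phi> t) * g \<theta>) = - (\<phi> t * conj_poisson g (polar r t))" for t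
  proof -
    have "(LINT \<theta>|circ. (Q \<theta> t *\<^sub>R \<phi> t) * g \<theta>) = (LINT \<theta>|circ. (- \<phi> t) * (conj_ker 0 (polar r t) \<theta> *\<^sub>R g \<theta>))"
      unfolding Q_def conj_ker_antisym[of 0 r _ t] by (simp add: mult_ac)
    also have "\<dots> = (- \<phi> t) * (LINT \<theta>|circ. conj_ker 0 (polar r t) \<theta> *\<^sub>R g \<theta>)"
      by (rule integral_mult_right_zero)
    finally show ?thesis unfolding circ_transform_def by simp
  qed
  have "(LINT \<theta>|circ. conj_poisson \<phi> (polar r \<theta>) * g \<theta>) = (LINT \<theta>|circ. LINT t|circ. (Q \<theta> t *\<^sub>R \<phi> t) * g \<theta>)"
    by (simp only: circ_transform_def Q_def integral_mult_left_zero)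
  also have "\<dots> = (LINT t|circ. LINT \<theta>|circ. (Q \<theta> t *\<^sub>R \<phi> t) * g \<theta>)"
    by (rule Fubini_integral[OF int, symmetric])
  also have "\<dots> = - (LINT t|circ. \<phi> t * conj_poisson g (polar r t))" unfolding inner by simp
  finally show "(LINT \<theta>|circ. conj_poisson \<phi> (polar r \<theta>) * g \<theta>) = - (LINT t|circ. \<phi> t * conj_poisson g
      (polar r t))" .
  show "integrable circ (\<lambda>t. \<phi> t * conj_poisson g (polar r t))"
    using integrable_snd[OF int] unfolding inner by simp
qed

text \<open>With \<open>v\<close> the transform of \<open>\<phi>\<close> and \<open>g\<close> dual to \<open>v\<close>, skew symmetry expresses the integral of
  \<open>|v| powr p = v * g\<close> by that of \<open>\<phi>\<close> times the transform of \<open>g\<close>. Young's inequality with a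
  weight \<open>l\<close> bounds it by a multiple of the integral of \<open>|\<phi>| powr p\<close> plus half of that of
  \<open>|v| powr p\<close>, which is finite and can be absorbed. As \<open>g\<close> is continuous, an estimate for
  continuous densities at the exponent \<open>q\<close> suffices.\<close>

lemma riesz_dual:
  fixes p q :: real
  assumes pq: "1 < p" "1 < q" "1 / p + 1 / q = 1"
    and A: "A \<ge> 0" "\<And>G. continuous_on {0..2*pi} G \<Longrightarrow> conj_poisson_bound q A G"
  obtains A' where "A' \<ge> 0" "\<And>\<phi>. \<phi> \<in> borel_measurable circ \<Longrightarrow> integrable circ (\<lambda>t. norm (\<phi> t) powr p) \<Longrightarrow>
      conj_poisson_bound p A' \<phi>"
proof -
  \<comment> \<open>This weight makes the second term of Young's inequality at most half of the left-hand side.\<close>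
  define l where "l = (2 * (A + 1) / q) powr (1 / q)"
  have base: "2 * (A + 1) / q > 0" using A(1) pq by (auto intro!: divide_pos_pos)
  have l: "l > 0" "l powr q = 2 * (A + 1) / q" using base A(1) pq by (auto simp: l_def powr_powr)
  have pq1: "(p - 1) * q = p" using pq by (simp add: field_simps)
  define A' where "A' = 2 * l powr p / p"
  have "(LINT \<theta>|circ. norm (conj_poisson \<phi> (polar r \<theta>)) powr p) \<le> A' * (LINT t|circ. norm (\<phi> t) powr p)"
    if \<phi>: "\<phi> \<in> borel_measurable circ" "integrable circ (\<lambda>t. norm (\<phi> t) powr p)" and r: "0 \<le> r" "r < 1" for \<phi> r
  proof -
    define z where "z \<theta> = polar r \<theta>" for \<theta> :: real
    define v where "v \<theta> = conj_poisson \<phi> (z \<theta>)" for \<theta>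
    define g where "g \<theta> = dual_power p (v \<theta>)" for \<theta>
    have \<phi>1: "integrable circ \<phi>" using power_integrable_imp_integrable[OF \<phi>(1) _ \<phi>(2)] pq by simp
    have vc: "continuous_on {0..2*pi} v"
      unfolding v_def z_def by (rule circ_transform_polar_continuous[OF disc_kernel_conj_ker \<phi>1 r])
    have gc: "continuous_on {0..2*pi} g"
      unfolding g_def by (rule continuous_on_compose2[OF continuous_dual_power[OF pq(1)] vc]) auto
    have ng: "norm (g \<theta>) powr q = norm (v \<theta>) powr p" for \<theta>
      using pq by (simp add: g_def norm_dual_power powr_powr pq1)
    define V where "V = (LINT \<theta>|circ. norm (v \<theta>) powr p)"
    define \<Phi> where "\<Phi> = (LINT t|circ. norm (\<phi> t) powr p)"
    have gI: "integrable circ (\<lambda>\<theta>. norm (conj_poisson g (z \<theta>)) powr q)"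
      using pq unfolding z_def
      by (intro circ_power_integrable circ_transform_polar_continuous disc_kernel_conj_ker
          continuous_imp_integrable_real gc r) auto
    have "complex_of_real V = (LINT \<theta>|circ. v \<theta> * g \<theta>)"
      unfolding V_def g_def mult_dual_power[OF pq(1)] by simp
    also have "\<dots> = - (LINT t|circ. \<phi> t * conj_poisson g (z t))"
      unfolding v_def z_def by (rule conj_poisson_skew(1)[OF \<phi>1 gc r])
    finally have "\<bar>V\<bar> = norm (LINT t|circ. \<phi> t * conj_poisson g (z t))" by (metis norm_minus_cancel
        norm_of_real)
    then have "V \<le> norm (LINT t|circ. \<phi> t * conj_poisson g (z t))" by linarith
    also have "\<dots> \<le> (LINT t|circ. norm (\<phi> t) * norm (conj_poisson g (z t)))"
      using integral_norm_bound[of circ "\<lambda>t. \<phi> t * conj_poisson g (z t)"] by (simp add: norm_mult)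
    also have "\<dots> \<le> (LINT t|circ. (l powr p / p) * norm (\<phi> t) powr p + (1 / (l powr q * q)) * norm
        (conj_poisson g (z t)) powr q)"
    proof (intro integral_mono Bochner_Integration.integrable_add integrable_mult_right \<phi>(2) gI)
      show "integrable circ (\<lambda>t. norm (\<phi> t) * norm (conj_poisson g (z t)))"
        using integrable_norm[OF conj_poisson_skew(2)[OF \<phi>1 gc r]] by (simp add: norm_mult z_def)
      fix t
      have "(l * norm (\<phi> t)) * (norm (conj_poisson g (z t)) / l) \<le> (l * norm (\<phi> t)) powr p / p +
          (norm (conj_poisson g (z t)) / l) powr q / q"
        using l(1) pq by (intro Youngs_inequality) auto
      then show "norm (\<phi> t) * norm (conj_poisson g (z t)) \<le> (l powr p / p) * norm (\<phi> t) powr p +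
          (1 / (l powr q * q)) * norm (conj_poisson g (z t)) powr q"
        using l(1) by (simp add: powr_mult powr_divide)
    qed
    also have "\<dots> = (l powr p / p) * \<Phi> + (1 / (l powr q * q)) * (LINT t|circ. norm (conj_poisson g (z t))
        powr q)"
      using \<phi>(2) gI by (simp add: \<Phi>_def)
    also have "(1 / (l powr q * q)) * (LINT t|circ. norm (conj_poisson g (z t)) powr q) \<le>
        (1 / (l powr q * q)) * (A * V)"
      using A(2)[OF gc] r pq unfolding conj_poisson_bound_def z_def V_def ng by (intro mult_left_mono) auto
    also have "(1 / (l powr q * q)) * (A * V) \<le> V / 2"
    proof -
      have "V \<ge> 0" unfolding V_def by (intro integral_nonneg_AE) auto
      moreover have "1 / (l powr q * q) = 1 / (2 * (A + 1))" using pq A(1) by (simp add: l(2))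
      moreover have "A / (2 * (A + 1)) \<le> 1 / 2" using A(1) by (simp add: field_simps)
      ultimately show ?thesis using mult_right_mono[of "A / (2 * (A + 1))" "1 / 2" V] by simp
    qed
    finally have "V \<le> A' * \<Phi>" by (simp add: A'_def field_simps)
    then show ?thesis by (simp add: V_def \<Phi>_def v_def z_def)
  qed
  then have "conj_poisson_bound p A' \<phi>"
    if "\<phi> \<in> borel_measurable circ" "integrable circ (\<lambda>t. norm (\<phi> t) powr p)" for \<phi>
    using that by (simp add: conj_poisson_bound_def)
  moreover have "A' \<ge> 0" using pq by (simp add: A'_def)
  ultimately show ?thesis using that by blast
qed

text \<open>Duality takes exponents up to \<open>2\<close> to exponents from \<open>2\<close> on. Used a second time it leads back
  to \<open>1 < p < 2\<close>, now for all densities in \<open>L\<^sup>p\<close>.\<close>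

theorem riesz_conjugate:
  fixes p :: real
  assumes p: "1 < p"
  obtains A where "A \<ge> 0" "\<And>\<phi>. \<phi> \<in> borel_measurable circ \<Longrightarrow> integrable circ (\<lambda>t. norm (\<phi> t) powr p) \<Longrightarrow>
      conj_poisson_bound p A \<phi>"
proof -
  define q where "q = p / (p - 1)"
  have q: "1 < q" "1 / p + 1 / q = 1" "1 / q + 1 / p = 1" using p by (auto simp: q_def field_simps)
  show ?thesis
  proof (cases "p \<ge> 2")
    case True
    then have "q \<le> 2" by (simp add: q_def field_simps)
    from riesz_continuous[OF q(1) this] obtain A where "A \<ge> 0" "\<And>G. continuous_on {0..2*pi} G \<Longrightarrow>
        conj_poisson_bound q A G" by blast
    from riesz_dual[OF p q(1,2) this] that show ?thesis by blast
  next
    case False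
    then have "p \<le> 2" by simp
    from riesz_continuous[OF p this] obtain A where "A \<ge> 0" "\<And>G. continuous_on {0..2*pi} G \<Longrightarrow>
        conj_poisson_bound p A G" by blast
    from riesz_dual[OF q(1) p q(3) this] obtain A' where A': "A' \<ge> 0" "\<And>\<phi>. \<phi> \<in> borel_measurable circ \<Longrightarrow>
        integrable circ (\<lambda>t. norm (\<phi> t) powr q) \<Longrightarrow>
      conj_poisson_bound q A' \<phi>" by blast
    have "conj_poisson_bound q A' G" if "continuous_on {0..2*pi} G" for G
      using that q by (intro A'(2) measurable_circ_continuous circ_power_integrable) auto
    from riesz_dual[OF p q(1,2) A'(1) this] that show ?thesis by blast
  qed
qed

lemma mean_bounded_conj_poisson:
  assumes p: "1 < p" "p < \<infinity>" and \<phi>: "Lp_arc p \<phi>"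
  shows "mean_bounded p (conj_poisson \<phi>)"
proof -
  define q where "q = real_of_ereal p"
  have q: "1 < q" using p by (cases p) (auto simp: q_def)
  have pinf: "p \<noteq> \<infinity>" using p by auto
  have \<phi>1: "\<phi> \<in> borel_measurable circ" "integrable circ (\<lambda>t. norm (\<phi> t) powr q)"
    using \<phi> pinf by (simp_all add: Lp_arc_def q_def)
  have \<phi>2: "integrable circ \<phi>" using power_integrable_imp_integrable[OF \<phi>1(1) _ \<phi>1(2)] q by simp
  obtain A where A: "\<And>r. 0 \<le> r \<Longrightarrow> r < 1 \<Longrightarrow>
      (LINT \<theta>|circ. norm (conj_poisson \<phi> (polar r \<theta>)) powr q) \<le> A * (LINT t|circ. norm (\<phi> t) powr q)"
    using riesz_conjugate[OF q] \<phi>1 unfolding conj_poisson_bound_def by metis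
  have "(\<integral>\<^sup>+\<theta>. ennreal (norm (conj_poisson \<phi> (polar r \<theta>)) powr q) \<partial>circ) \<le> ennreal
      (A * (LINT t|circ. norm (\<phi> t) powr q))"
    if r: "r \<in> {0..<1}" for r
  proof -
    have "integrable circ (\<lambda>\<theta>. norm (conj_poisson \<phi> (polar r \<theta>)) powr q)"
      using q r by (intro circ_power_integrable circ_transform_polar_continuous disc_kernel_conj_ker \<phi>2) auto
    then have "(\<integral>\<^sup>+\<theta>. ennreal (norm (conj_poisson \<phi> (polar r \<theta>)) powr q) \<partial>circ) =
        ennreal (LINT \<theta>|circ. norm (conj_poisson \<phi> (polar r \<theta>)) powr q)"
      by (rule nn_integral_eq_integral) auto
    also have "\<dots> \<le> ennreal (A * (LINT t|circ. norm (\<phi> t) powr q))" using A r by (intro ennreal_leI) auto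
    finally show ?thesis .
  qed
  with pinf show ?thesis unfolding mean_bounded_def q_def by metis
qed

section \<open>The partial derivatives in the Hardy type space\<close>

text \<open>\<open>Im (z / cis t) = Im ((z - cis t) / cis t)\<close> is at most the distance of \<open>z\<close> from \<open>cis t\<close>; this
  extra factor lowers the order of the singularity.\<close>

lemma conj_ker_le:
  assumes z: "norm z < 1"
  shows "\<bar>conj_ker \<alpha> z t\<bar> \<le> 2 * ker \<alpha> ((\<alpha> + 1) / 2) z t"
proof -
  have D: "sqdist z t > 0" by (rule sqdist_pos[OF z])
  have "Im z * cos t - Re z * sin t = Im ((z - cis t) * cis (- t))"
    by (simp add: algebra_simps)
  then have "\<bar>Im z * cos t - Re z * sin t\<bar> \<le> norm ((z - cis t) * cis (- t))" by (simp only: abs_Im_le_cmod)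
  also have "\<dots> = sqdist z t powr (1 / 2)"
    using D by (simp add: norm_mult sqdist_eq_norm powr_half_sqrt norm_minus_commute)
  finally have 1: "\<bar>Im z * cos t - Re z * sin t\<bar> \<le> sqdist z t powr (1 / 2)" .
  have e: "sqdist z t powr (1 / 2) * sqdist z t powr - (\<alpha> / 2 + 1) = sqdist z t powr - ((\<alpha> + 1) / 2)"
  proof -
    have "1 / 2 + - (\<alpha> / 2 + 1) = - ((\<alpha> + 1) / 2)" by (simp add: field_simps)
    then show ?thesis by (simp only: powr_add[symmetric])
  qed
  have "\<bar>conj_ker \<alpha> z t\<bar> = 2 * \<bar>Im z * cos t - Re z * sin t\<bar> * ker \<alpha> (\<alpha> / 2 + 1) z t"
    using ker_nonneg[of \<alpha> "\<alpha> / 2 + 1" z t] unfolding conj_ker_def abs_mult by simp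
  also have "\<dots> \<le> 2 * sqdist z t powr (1 / 2) * ker \<alpha> (\<alpha> / 2 + 1) z t"
    by (intro mult_right_mono mult_left_mono 1 ker_nonneg) auto
  also have "\<dots> = 2 * ((1 - (norm z)\<^sup>2) powr \<alpha> * (sqdist z t powr (1 / 2) * sqdist z t powr - (\<alpha> / 2 + 1)))"
    by (simp add: ker_def)
  also have "\<dots> = 2 * ker \<alpha> ((\<alpha> + 1) / 2) z t" unfolding e by (simp add: ker_def)
  finally show ?thesis .
qed

lemma schur_conj_ker:
  assumes \<alpha>: "\<alpha> > 0"
  obtains m where "schur_kernel (conj_ker \<alpha>) m"
proof -
  have "(\<alpha> + 1) / 2 > 1 / 2" using \<alpha> by simp
  from ker_critical_integral_bound[OF this] obtain m where
    m: "\<And>z. norm z < 1 \<Longrightarrow> (LINT t|circ. ker \<alpha> ((\<alpha> + 1) / 2) z t) \<le> m" by (auto simp: field_simps)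
  have "schur_kernel (conj_ker \<alpha>) (2 * \<bar>m\<bar> + 1)"
  proof
    fix z :: complex assume z: "norm z < 1"
    have c: "continuous_on {0..2*pi} (conj_ker \<alpha> z)" "continuous_on {0..2*pi} (ker \<alpha> ((\<alpha> + 1) / 2) z)"
      by (intro disc_kernel_compose[OF disc_kernel_conj_ker] disc_kernel_compose[OF continuous_on_ker]
          continuous_intros; use z in simp)+
    have "(LINT t|circ. \<bar>conj_ker \<alpha> z t\<bar>) \<le> (LINT t|circ. 2 * ker \<alpha> ((\<alpha> + 1) / 2) z t)"
      by (intro integral_mono conj_ker_le[OF z] continuous_imp_integrable_real continuous_intros c)
    also have "\<dots> \<le> 2 * \<bar>m\<bar> + 1" using m[OF z] by simp
    finally show "(LINT t|circ. \<bar>conj_ker \<alpha> z t\<bar>) \<le> 2 * \<bar>m\<bar> + 1" .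
  next
    show "\<bar>conj_ker \<alpha> (polar r \<theta>) t\<bar> = \<bar>conj_ker \<alpha> (polar r t) \<theta>\<bar>" for r \<theta> t
      unfolding conj_ker_antisym[of \<alpha> r \<theta> t] by simp
  qed (auto simp: disc_kernel_conj_ker)
  then show ?thesis by (rule that)
qed

lemma schur_bounded_ker:
  assumes \<alpha>: "\<alpha> > 0"
  obtains m where "schur_kernel (ker \<alpha> (\<alpha> / 2)) m"
proof -
  have "schur_kernel (ker \<alpha> (\<alpha> / 2)) (2 powr \<alpha> * (2 * pi))"
  proof
    fix z :: complex assume z: "norm z < 1"
    have le: "ker \<alpha> (\<alpha> / 2) z t \<le> 2 powr \<alpha>" for t
    proof -
      have D: "sqdist z t > 0" by (rule sqdist_pos[OF z])
      have "1 - (norm z)\<^sup>2 = (1 - norm z) * (1 + norm z)" by (simp add: power2_eq_square algebra_simps)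
      also have "\<dots> \<le> norm (cis t - z) * 2"
        using z norm_triangle_ineq2[of "cis t" z] by (intro mult_mono) auto
      also have "norm (cis t - z) = sqdist z t powr (1 / 2)"
        using D by (simp add: sqdist_eq_norm powr_half_sqrt)
      finally have "(1 - (norm z)\<^sup>2) powr \<alpha> \<le> (sqdist z t powr (1 / 2) * 2) powr \<alpha>"
        using defect_pos[OF z] \<alpha> by (intro powr_mono2) auto
      also have "\<dots> = 2 powr \<alpha> * sqdist z t powr (\<alpha> / 2)" by (simp add: powr_mult powr_powr)
      finally have "ker \<alpha> (\<alpha> / 2) z t \<le> (2 powr \<alpha> * sqdist z t powr (\<alpha> / 2)) * sqdist z t powr - (\<alpha> / 2)"
        unfolding ker_def by (intro mult_right_mono) auto
      also have "\<dots> = 2 powr \<alpha> * (sqdist z t powr (\<alpha> / 2) * sqdist z t powr - (\<alpha> / 2))" by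
          (simp only: mult.assoc)
      also have "sqdist z t powr (\<alpha> / 2) * sqdist z t powr - (\<alpha> / 2) = 1"
        using D by (simp only: powr_add[symmetric]) simp
      finally show ?thesis by simp
    qed
    have "(LINT t|circ. \<bar>ker \<alpha> (\<alpha> / 2) z t\<bar>) \<le> (LINT t|circ. 2 powr \<alpha>)"
    proof (intro integral_mono finite_measure.integrable_const[OF circ_finite_measure])
      show "integrable circ (\<lambda>t. \<bar>ker \<alpha> (\<alpha> / 2) z t\<bar>)"
        by (intro continuous_imp_integrable_real continuous_intros disc_kernel_compose[OF
            continuous_on_ker]) (use z in auto)
    qed (use le ker_nonneg in auto)
    also have "\<dots> = 2 powr \<alpha> * (2 * pi)" by (simp add: measure_restrict_space)
    finally show "(LINT t|circ. \<bar>ker \<alpha> (\<alpha> / 2) z t\<bar>) \<le> 2 powr \<alpha> * (2 * pi)" .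
  qed (auto simp: continuous_on_ker ker_swap)
  then show ?thesis by (rule that)
qed

lemma cis_Arg_eq: "cis (Arg z) = (if z = 0 then 1 else sgn z)"
  by (simp add: cis_Arg Arg_zero)

lemma cis_minus_Arg_eq: "cis (- Arg z) = cnj (if z = 0 then 1 else sgn z)"
  by (simp add: cis_Arg_eq[symmetric] cis_cnj)

lemma AE_nonneg_imp_nonneg:
  fixes \<phi> :: "'a::euclidean_space \<Rightarrow> real"
  assumes "open U" "continuous_on U \<phi>" "AE z in lebesgue_on U. 0 \<le> \<phi> z" "z \<in> U"
  shows "0 \<le> \<phi> z"
proof (rule ccontr)
  assume "\<not> 0 \<le> \<phi> z"
  define S where "S = U \<inter> \<phi> -` {..<0}"
  have S: "open S" unfolding S_def by (intro continuous_open_preimage assms) auto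
  have "AE z in lebesgue. z \<in> U \<longrightarrow> 0 \<le> \<phi> z"
    using assms(1,3) by (subst (asm) AE_restrict_space_iff) (auto simp: borel_open)
  then have "AE z in lebesgue. z \<notin> S" by eventually_elim (auto simp: S_def)
  moreover have "S \<in> sets lebesgue" using S by (simp add: borel_open)
  ultimately have "S \<in> null_sets lebesgue" by (simp add: AE_iff_null_sets)
  then have "negligible S" by (simp add: negligible_iff_null_sets)
  moreover have "S \<noteq> {}" using \<open>\<not> 0 \<le> \<phi> z\<close> assms(4) by (auto simp: S_def)
  ultimately show False using S open_not_negligible by blast
qed

context poisson_extension
begin

lemma theta_cont: "continuous_on (ball 0 1) (partial_theta f)"
  unfolding partial_theta_def by (intro continuous_intros partial_z_continuous)

lemma continuous_in_hardy_space:
  "1 \<le> p \<Longrightarrow> continuous_on (ball 0 1) h \<Longrightarrow> mean_bounded p h \<Longrightarrow> h \<in> hardy_space p"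
  by (intro hardy_spaceI borel_measurable_continuous_on_restrict)

lemma mean_bounded_theta:
  assumes \<alpha>: "\<alpha> > -1" and p: "1 \<le> p" and Lp: "Lp_arc p g'"
  shows "mean_bounded p (partial_theta f)"
proof -
  obtain m where "schur_kernel (ker (2 * (\<alpha> / 2 + 1) - 1) (\<alpha> / 2 + 1)) m"
    using schur_kernel_critical[of "\<alpha> / 2 + 1"] \<alpha> by auto
  then have S: "schur_kernel P m" by (simp add: algebra_simps)
  note c = circ_transform_continuous[OF continuous_on_ker int, of "\<alpha> + 1" "\<alpha> / 2 + 1"]
  note b = schur_kernel.mean_bounded_transform[OF S p Lp]
  show ?thesis
  proof (rule mean_bounded_dominated[OF p b b c c])
    fix z :: complex assume z: "norm z < 1"
    show "norm (partial_theta f z) \<le> \<bar>cc\<bar> * (norm (circ_transform P g' z) + norm (circ_transform P g' z) + 1)"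
      unfolding partial_theta_eq[OF z] norm_scaleR by (intro mult_left_mono) auto
  qed
qed

text \<open>Near the origin the derivatives are bounded by continuity, so a pointwise bound is needed
  only for \<open>|z| \<ge> 1/2\<close>. The sum on the left-hand side dominates all three derivatives.\<close>

lemma partials_in_hardy_space:
  assumes p: "1 \<le> p" and h: "mean_bounded p h1" "mean_bounded p h2"
    and c: "continuous_on (ball 0 1) h1" "continuous_on (ball 0 1) h2"
    and le: "\<And>z. 1 / 2 \<le> norm z \<Longrightarrow> norm z < 1 \<Longrightarrow>
      norm (partial_z f z) + norm (partial_zbar f z) \<le> A * (norm (h1 z) + norm (h2 z) + 1)"
  shows "partial_r f \<in> hardy_space p \<and> partial_z f \<in> hardy_space p \<and> partial_zbar f \<in> hardy_space p"
proof -
  have "continuous_on (cball 0 (1 / 2)) (\<lambda>z. norm (partial_z f z) + norm (partial_zbar f z))"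
    by (intro continuous_intros continuous_on_subset[OF partial_z_continuous(1)] continuous_on_subset[OF
        partial_z_continuous(2)]) auto
  then have "bounded ((\<lambda>z. norm (partial_z f z) + norm (partial_zbar f z)) ` cball 0 (1 / 2))"
    by (intro compact_imp_bounded compact_continuous_image) auto
  then obtain C where C: "\<And>z. norm z \<le> 1 / 2 \<Longrightarrow> norm (partial_z f z) + norm (partial_zbar f z) \<le> C"
    unfolding bounded_iff by fastforce
  have le': "norm (partial_z f z) + norm (partial_zbar f z) \<le> (\<bar>A\<bar> + \<bar>C\<bar>) * (norm (h1 z) + norm (h2 z) + 1)"
    if z: "norm z < 1" for z
  proof -
    have n: "0 \<le> norm (h1 z) + norm (h2 z) + 1" by (simp add: add_nonneg_nonneg)
    show ?thesis
    proof (cases "norm z \<le> 1 / 2")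
      case True
      have "norm (partial_z f z) + norm (partial_zbar f z) \<le> \<bar>C\<bar> * 1" using C[OF True] by simp
      also have "\<dots> \<le> (\<bar>A\<bar> + \<bar>C\<bar>) * (norm (h1 z) + norm (h2 z) + 1)" by (intro mult_mono) auto
      finally show ?thesis .
    next
      case False
      have "norm (partial_z f z) + norm (partial_zbar f z) \<le> A * (norm (h1 z) + norm (h2 z) + 1)"
        using False z by (intro le) auto
      also have "\<dots> \<le> (\<bar>A\<bar> + \<bar>C\<bar>) * (norm (h1 z) + norm (h2 z) + 1)" by (intro mult_right_mono n) auto
      finally show ?thesis .
    qed
  qed
  note dom = mean_bounded_dominated[OF p h c, of _ "\<bar>A\<bar> + \<bar>C\<bar>"]
  have "mean_bounded p (partial_z f)" "mean_bounded p (partial_zbar f)"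
    by (rule dom, rule order_trans[OF _ le']; simp)+
  moreover have "partial_r f \<in> hardy_space p"
  proof (rule hardy_spaceI[OF p])
    show "mean_bounded p (partial_r f)"
    proof (rule dom)
      fix z :: complex assume z: "norm z < 1"
      have "norm (partial_r f z) \<le> norm (partial_z f z) + norm (partial_zbar f z)"
        unfolding partial_r_def by (rule order_trans[OF norm_triangle_ineq]) (simp add: norm_mult)
      with le'[OF z] show "norm (partial_r f z) \<le> (\<bar>A\<bar> + \<bar>C\<bar>) * (norm (h1 z) + norm (h2 z) + 1)" by linarith
    qed
    have [measurable]: "partial_z f \<in> borel_measurable (restrict_space borel (ball 0 1))"
      "partial_zbar f \<in> borel_measurable (restrict_space borel (ball 0 1))"
      by (intro borel_measurable_continuous_on_restrict partial_z_continuous)+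
    have "(\<lambda>z::complex. if z = 0 then 1 else sgn z) \<in> borel_measurable borel"
      unfolding sgn_div_norm by measurable
    then have [measurable]: "(\<lambda>z::complex. if z = 0 then 1 else sgn z) \<in> borel_measurable (restrict_space
        borel (ball 0 1))"
      by (rule measurable_restrict_space1)
    have [measurable]: "(\<lambda>z::complex. cnj (if z = 0 then 1 else sgn z)) \<in> borel_measurable (restrict_space
        borel (ball 0 1))"
      by (rule measurable_compose[OF _ borel_measurable_continuous_onI[OF continuous_on_cnj[OF
          continuous_on_id]]]) measurable
    show "partial_r f \<in> borel_measurable (restrict_space borel (ball 0 1))"
      unfolding partial_r_def[abs_def] cis_Arg_eq cis_minus_Arg_eq by measurable
  qed
  ultimately show ?thesis using p by (simp add: continuous_in_hardy_space partial_z_continuous)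
qed

lemma mean_bounded_radial:
  assumes \<alpha>: "\<alpha> > -1" and p: "1 \<le> p" and Lp: "Lp_arc p g'"
    and case_\<alpha>: "\<alpha> > 0 \<or> (\<alpha> = 0 \<and> 1 < p \<and> p < \<infinity>)"
  shows "mean_bounded p (\<lambda>z. z * partial_z f z + cnj z * partial_zbar f z)"
proof (cases "\<alpha> = 0")
  case True
  with case_\<alpha> have "1 < p" "p < \<infinity>" by auto
  then have b: "mean_bounded p (conj_poisson g')" by (rule mean_bounded_conj_poisson) (rule Lp)
  note c = circ_transform_continuous[OF disc_kernel_conj_ker int, of 0]
  show ?thesis
  proof (rule mean_bounded_dominated[OF p b b c c])
    fix z :: complex assume z: "norm z < 1"
    have "norm (z * partial_z f z + cnj z * partial_zbar f z) = \<bar>cc\<bar> * norm (conj_poisson g' z)"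
      unfolding radial_eq[OF z] norm_scaleR by (simp add: True)
    also have "\<dots> \<le> \<bar>cc\<bar> * (norm (conj_poisson g' z) + norm (conj_poisson g' z) + 1)" by
        (intro mult_left_mono) auto
    finally show "norm (z * partial_z f z + cnj z * partial_zbar f z) \<le> \<bar>cc\<bar> * (norm (conj_poisson g' z) +
        norm (conj_poisson g' z) + 1)" .
  qed
next
  case False
  with case_\<alpha> have \<alpha>0: "\<alpha> > 0" by auto
  obtain m1 where S1: "schur_kernel (conj_ker \<alpha>) m1" using schur_conj_ker[OF \<alpha>0] .
  obtain m2 where S2: "schur_kernel (ker \<alpha> (\<alpha> / 2)) m2" using schur_bounded_ker[OF \<alpha>0] .
  obtain m3 where "schur_kernel (ker (2 * (\<alpha> / 2 + 1) - 1) (\<alpha> / 2 + 1)) m3"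
    using schur_kernel_critical[of "\<alpha> / 2 + 1"] \<alpha> by auto
  then have "schur_kernel P m3" by (simp add: algebra_simps)
  note S = S1 S2 this
  have Lg: "Lp_arc p g" by (rule Lp_arc_continuous[OF g_cont p])
  let ?h1 = "circ_transform (conj_ker \<alpha>) g'" and ?h2 = "circ_transform (ker \<alpha> (\<alpha> / 2)) g" and ?h3 =
      "circ_transform P g"
  have c: "continuous_on (ball 0 1) ?h1" "continuous_on (ball 0 1) ?h2" "continuous_on (ball 0 1) ?h3"
    by (intro circ_transform_continuous disc_kernel_conj_ker continuous_on_ker int g_int)+
  have b: "mean_bounded p ?h1" "mean_bounded p ?h2" "mean_bounded p ?h3"
    using S by (auto intro: schur_kernel.mean_bounded_transform p Lp Lg)
  have d: "mean_bounded p (\<lambda>z. ?h3 z - ?h2 z)"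
    by (rule mean_bounded_dominated[OF p b(3,2) c(3,2), of _ 1]) (simp add: norm_triangle_le_diff)
  have dc: "continuous_on (ball 0 1) (\<lambda>z. ?h3 z - ?h2 z)" by (intro continuous_intros c)
  show ?thesis
  proof (rule mean_bounded_dominated[OF p b(1) d c(1) dc, of _ "\<bar>cc\<bar> * (1 + \<bar>\<alpha>\<bar>)"])
    fix z :: complex assume z: "norm z < 1"
    have "norm (?h1 z + (\<alpha> / 2) *\<^sub>R (?h3 z - ?h2 z)) \<le> norm (?h1 z) + \<bar>\<alpha> / 2\<bar> * norm (?h3 z - ?h2 z)"
      by (rule order_trans[OF norm_triangle_ineq]) simp
    also have "\<dots> \<le> (1 + \<bar>\<alpha>\<bar>) * norm (?h1 z) + (1 + \<bar>\<alpha>\<bar>) * norm (?h3 z - ?h2 z)"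
      by (intro add_mono mult_right_mono) (auto simp: mult_le_cancel_right1)
    also have "\<dots> \<le> (1 + \<bar>\<alpha>\<bar>) * (norm (?h1 z) + norm (?h3 z - ?h2 z) + 1)" by (simp add: algebra_simps)
    finally have "\<bar>cc\<bar> * norm (?h1 z + (\<alpha> / 2) *\<^sub>R (?h3 z - ?h2 z)) \<le> \<bar>cc\<bar> * ((1 + \<bar>\<alpha>\<bar>) * (norm (?h1 z) +
        norm (?h3 z - ?h2 z) + 1))"
      by (rule mult_left_mono) simp
    then show "norm (z * partial_z f z + cnj z * partial_zbar f z) \<le> \<bar>cc\<bar> * (1 + \<bar>\<alpha>\<bar>) * (norm (?h1 z) + norm
        (?h3 z - ?h2 z) + 1)"
      unfolding radial_eq[OF z] norm_scaleR by (simp only: mult.assoc)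
  qed
qed

text \<open>With \<open>R\<close> for the radial and \<open>T\<close> for the angular derivative, \<open>2 z \<partial>\<^sub>z f = R - \<i> T\<close>; the other
  derivative has the opposite sign.\<close>

lemma partials_in_hardy_space_radial:
  assumes p: "1 \<le> p" and t: "mean_bounded p (partial_theta f)"
    and r: "mean_bounded p (\<lambda>z. z * partial_z f z + cnj z * partial_zbar f z)"
  shows "partial_r f \<in> hardy_space p \<and> partial_z f \<in> hardy_space p \<and> partial_zbar f \<in> hardy_space p"
proof (rule partials_in_hardy_space[OF p t r theta_cont, of 2])
  show "continuous_on (ball 0 1) (\<lambda>z. z * partial_z f z + cnj z * partial_zbar f z)"
    by (intro continuous_intros partial_z_continuous)
  fix z :: complex assume z: "1 / 2 \<le> norm z" "norm z < 1"
  define R T where "R = z * partial_z f z + cnj z * partial_zbar f z" and "T = partial_theta f z"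
  have "z * partial_z f z = (R - \<i> * T) / 2" "cnj z * partial_zbar f z = (R + \<i> * T) / 2"
    by (simp_all add: R_def T_def partial_theta_def algebra_simps)
  then have "norm (z * partial_z f z) = norm (R - \<i> * T) / 2" "norm (cnj z * partial_zbar f z) = norm
      (R + \<i> * T) / 2"
    by (simp_all only: norm_divide) simp_all
  then have "norm (z * partial_z f z) \<le> (norm R + norm T) / 2" "norm (cnj z * partial_zbar f z) \<le>
      (norm R + norm T) / 2"
    using norm_triangle_ineq4[of R "\<i> * T"] norm_triangle_ineq[of R "\<i> * T"] by (simp_all add:
        norm_mult[of \<i>] del: norm_mult)
  then have "norm z * (norm (partial_z f z) + norm (partial_zbar f z)) \<le> norm R + norm T"
    by (simp add: norm_mult algebra_simps)
  moreover have "1 / 2 * (norm (partial_z f z) + norm (partial_zbar f z)) \<le> norm z * (norm (partial_z f z) +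
      norm (partial_zbar f z))"
    using z by (intro mult_right_mono) auto
  ultimately have "1 / 2 * (norm (partial_z f z) + norm (partial_zbar f z)) \<le> norm R + norm T" by
      (rule order_trans[rotated])
  then have "norm (partial_z f z) + norm (partial_zbar f z) \<le> 2 * (norm T + norm R + 1)" by simp
  then show "norm (partial_z f z) + norm (partial_zbar f z) \<le> 2 * (norm (partial_theta f z) + norm
      (z * partial_z f z + cnj z * partial_zbar f z) + 1)"
    by (simp only: R_def T_def)
qed

text \<open>With \<open>d\<close> for the norm of the differential, the Jacobian is \<open>d l\<close>. If \<open>d\<close> exceeded
  \<open>K * max l 0 + sqrt K'\<close>, then \<open>d\<^sup>2\<close> would exceed \<open>K d l + K'\<close>. The triangle inequality bounds
  \<open>|z| l\<close> by the angular derivative.\<close>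

lemma partials_in_hardy_space_elliptic:
  assumes p: "1 \<le> p" and t: "mean_bounded p (partial_theta f)"
    and K: "K \<ge> 1" "K' \<ge> 0" and e: "elliptic_disc K K' f"
  shows "partial_r f \<in> hardy_space p \<and> partial_z f \<in> hardy_space p \<and> partial_zbar f \<in> hardy_space p"
proof (rule partials_in_hardy_space[OF p t t theta_cont theta_cont, of "2 * K + sqrt K'"])
  fix z :: complex assume z: "1 / 2 \<le> norm z" "norm z < 1"
  have Jc: "continuous_on unit_disc (jacobian f)" and Dc: "continuous_on unit_disc (D_norm f)"
    unfolding jacobian_def D_norm_def by (intro continuous_intros partial_z_continuous)+
  have J: "0 \<le> jacobian f z"
    by (rule AE_nonneg_imp_nonneg[OF open_ball Jc]) (use e z in \<open>auto simp: elliptic_disc_def\<close>)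
  have "0 \<le> K * jacobian f z + K' - (D_norm f z)\<^sup>2"
  proof (rule AE_nonneg_imp_nonneg[OF open_ball, where \<phi> = "\<lambda>z. K * jacobian f z + K' - (D_norm f z)\<^sup>2"])
    show "continuous_on unit_disc (\<lambda>z. K * jacobian f z + K' - (D_norm f z)\<^sup>2)" by (intro continuous_intros
        Jc Dc)
    show "AE z in lebesgue_on unit_disc. 0 \<le> K * jacobian f z + K' - (D_norm f z)\<^sup>2"
      using e by (simp add: elliptic_disc_def)
  qed (use z in auto)
  then have D: "(D_norm f z)\<^sup>2 \<le> K * jacobian f z + K'" by simp
  define d l where "d = D_norm f z" and "l = norm (partial_z f z) - norm (partial_zbar f z)"
  have Jdl: "jacobian f z = d * l" by (simp add: jacobian_def d_def D_norm_def l_def power2_eq_square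
      algebra_simps)
  have dl: "d \<le> K * max l 0 + sqrt K'"
  proof (rule ccontr)
    assume "\<not> ?thesis"
    then have g: "K * max l 0 + sqrt K' < d" by simp
    moreover have "0 \<le> K * max l 0" "0 \<le> sqrt K'" using K by auto
    ultimately have dp: "d > 0" "sqrt K' \<le> d" by linarith+
    have "K * (d * l) + K' \<le> d * (K * max l 0) + sqrt K' * sqrt K'"
    proof -
      have "d * l \<le> d * max l 0" using dp by (intro mult_left_mono) auto
      then have "K * (d * l) \<le> K * (d * max l 0)" using K dp by (intro mult_left_mono) auto
      then show ?thesis using K dp by (simp add: mult_ac)
    qed
    also have "\<dots> \<le> d * (K * max l 0) + d * sqrt K'"
      using dp K by (intro add_left_mono mult_right_mono) auto
    also have "\<dots> = d * (K * max l 0 + sqrt K')" by (simp add: algebra_simps)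
    also have "\<dots> < d * d" using g dp by (intro mult_strict_left_mono) auto
    finally show False using D unfolding Jdl d_def[symmetric] by (simp add: power2_eq_square)
  qed
  have "norm (partial_theta f z) = norm (z * partial_z f z - cnj z * partial_zbar f z)"
    unfolding partial_theta_def norm_mult[of \<i>] by simp
  then have "norm z * l \<le> norm (partial_theta f z)"
    using norm_triangle_ineq2[of "z * partial_z f z" "cnj z * partial_zbar f z"]
    by (simp add: norm_mult l_def right_diff_distrib)
  then have "1 / 2 * l \<le> norm (partial_theta f z)" if "l > 0"
    using that z(1) by (intro order_trans[OF mult_right_mono[of "1 / 2" "norm z" l]]) auto
  then have "max l 0 \<le> 2 * norm (partial_theta f z)" by (cases "l > 0") auto
  then have "K * max l 0 \<le> K * (2 * norm (partial_theta f z))" using K by (intro mult_left_mono) auto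
  with dl have "d \<le> 2 * K * norm (partial_theta f z) + sqrt K'" by simp
  also have "\<dots> \<le> (2 * K + sqrt K') * (norm (partial_theta f z) + norm (partial_theta f z) + 1)"
    using K by (simp add: algebra_simps add_nonneg_nonneg)
  finally show "norm (partial_z f z) + norm (partial_zbar f z) \<le> (2 * K + sqrt K') *
      (norm (partial_theta f z) + norm (partial_theta f z) + 1)"
    by (simp add: d_def D_norm_def)
qed

end

theorem corollary1p1:
  fixes \<alpha> :: real and p :: ereal and F f :: "complex \<Rightarrow> complex"
  assumes "-1 < \<alpha>" and "1 \<le> p" and "p \<le> \<infinity>"
    and "abs_cont_circle F"
    and "Lp_circle p (circle_deriv F)"
    and "\<And>z. z \<in> unit_disc \<Longrightarrow> f z = poisson_integral \<alpha> F z"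
  shows "((\<alpha>, p) \<in> Pi0 \<longrightarrow> partial_theta f \<in> hardy_space p) \<and>
    ((\<alpha>, p) \<in> Pi1 \<longrightarrow>
       partial_r f \<in> hardy_space p \<and> partial_z f \<in> hardy_space p \<and>
       partial_zbar f \<in> hardy_space p) \<and>
    ((\<alpha>, p) \<in> Pi2 \<union> Pi3 \<and> (\<exists>K K'. K \<ge> 1 \<and> K' \<ge> 0 \<and> elliptic_disc K K' f) \<longrightarrow>
       partial_r f \<in> hardy_space p \<and> partial_z f \<in> hardy_space p \<and>
       partial_zbar f \<in> hardy_space p)"
proof -
  have Lp: "Lp_arc p (\<lambda>t. circle_deriv F (cis t))" using assms(5) by (simp only: Lp_circle_eq)
  interpret poisson_extension \<alpha> F f
    using assms(4,6) Lp_arc_integrable[OF Lp assms(2)] by unfold_locales auto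
  note T = mean_bounded_theta[OF assms(1,2) Lp]
  show ?thesis
  proof (intro conjI impI)
    show "partial_theta f \<in> hardy_space p"
      by (rule continuous_in_hardy_space[OF assms(2) theta_cont T])
  next
    assume "(\<alpha>, p) \<in> Pi1"
    then have "\<alpha> > 0 \<or> (\<alpha> = 0 \<and> 1 < p \<and> p < \<infinity>)" by (auto simp: Pi1_def)
    from partials_in_hardy_space_radial[OF assms(2) T mean_bounded_radial[OF assms(1,2) Lp this]]
    show "partial_r f \<in> hardy_space p" "partial_z f \<in> hardy_space p" "partial_zbar f \<in> hardy_space p" by auto
  next
    assume "(\<alpha>, p) \<in> Pi2 \<union> Pi3 \<and> (\<exists>K K'. K \<ge> 1 \<and> K' \<ge> 0 \<and> elliptic_disc K K' f)"
    then obtain K K' where "K \<ge> 1" "K' \<ge> 0" "elliptic_disc K K' f" by blast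
    from partials_in_hardy_space_elliptic[OF assms(2) T this]
    show "partial_r f \<in> hardy_space p" "partial_z f \<in> hardy_space p" "partial_zbar f \<in> hardy_space p" by auto
  qed
qed

end
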